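(* Consider the optimal control problem (P) with the data described in the context. Assume: (a) there exist nonnegative measurable functions $\kappa_1,\kappa_2,\kappa_3,\kappa_4$ on $\Xi$ with $\mathbb{E}[\kappa_i(\xi)]<\infty$ ($i=1,2,3,4$) such that for all $z_1,z_2\in\mathbb{R}^n$, $|F(z_1,\xi)-F(z_2,\xi)|\le\kappa_1(\xi)\|z_1-z_2\|$ and $\|g(z_1,\xi)\|\le\kappa_2(\xi)\|z_1\|$ for a.e. $\xi\in\Xi$, and $\|M(\xi)\|\le\kappa_3(\xi)$, $\|q(\xi)\|\le\kappa_4(\xi)$ for all $\xi\in\Xi$; (b) $D\in\mathbb{R}^{l\times m}$ has full row rank with $l<m$, and the matrix $\mathcal{R}=[BY\;\;(A-BD^\dag C)BY\;\;(A-BD^\dag C)^2BY\;\cdots\;(A-BD^\dag C)^{n-1}BY]\in\mathbb{R}^{n\times n(m-l)}$ has full row rank, where $Y\in\mathbb{R}^{m\times(m-l)}$ is a matrix of full column rank $m-l$ with $DY=0$; (c) $\mathcal{B}(0,\beta\,\mathbb{E}[\kappa_2(\xi)]\,\|\mathbb{E}[q(\xi)]\|_1)\subseteq K$; (d) the set $\mathcal{V}=\{v\in\mathbb{R}^n:\ \mathbb{E}[M(\xi)v+q(\xi)]\ge 0,\ v\ge 0\}$ is nonempty; (e) $\mathbb{E}[M(\xi)]$ is an adequate matrix or a Z-matrix. Then problem (P) has a feasible solution $(x,u)\in H^1(0,T)^n\times L^2(0,T)^m$. Moreover, if $\mathbb{E}[F(\cdot,\xi)]$ is bounded from below, then (P)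 admits an optimal solution.
   Context: $\|\cdot\|$ is the Euclidean norm of a vector and a matrix; $\|\cdot\|_1$ is the 1-norm. $L^2(0,T)^n$ carries the norm $\|x\|_{L^2}=(\int_0^T\|x(t)\|^2dt)^{1/2}$; $H^1(0,T)^n$ is the space of $x\in L^2(0,T)^n$ with weak derivative $\dot x\in L^2(0,T)^n$, with $\|x\|_{H^1}=(\|x\|_{L^2}^2+\|\dot x\|_{L^2}^2)^{1/2}$. $\mathcal{B}(v,\varepsilon)=\{w:\|w-v\|\le\varepsilon\}$. $D^\dag$ is the pseudoinverse of $D$ ($D^\dag=D^\top(DD^\top)^{-1}$ when $D$ has full row rank). $a\perp b$ means $a^\top b=0$; vector inequalities are componentwise. Data: $\xi$ is a random variable on a probability space $(\Omega,\mathcal{F},\mathcal{P})$ with support $\Xi=\xi(\Omega)\subseteq\mathbb{R}^d$. $A\in\mathbb{R}^{n\times n}$, $B\in\mathbb{R}^{n\times m}$, $C\in\mathbb{R}^{l\times n}$, $D\in\mathbb{R}^{l\times m}$, $x_0\in\mathbb{R}^n$, $f\in L^2(0,T)^l$, $\delta>0$, $x_d\in L^2(0,T)^n$, $u_d\in L^2(0,T)^m$; $K\subseteq\mathbb{R}^{\ell}$ is nonempty, closed, convex. $F:\mathbb{R}^n\times\Xi\to\mathbb{R}$ and $g:\mathbb{R}^n\times\Xi\to\mathbb{R}^{\ell}$ are continuously differentiable in the first variable for a.e. $\xi\in\Xi$ and measurable in $\xi$ for each first argument; $M:\Xi\to\mathbb{R}^{n\times n}$ and $q:\Xi\to\mathbb{R}^n$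 are measurable. Problem (P): minimize over $(x,u)\in H^1(0,T)^n\times L^2(0,T)^m$ $$\Phi(x,u)=\mathbb{E}[F(x(T),\xi)]+\tfrac12\|x-x_d\|_{L^2}^2+\tfrac{\delta}{2}\|u-u_d\|_{L^2}^2$$ subject to $\dot x(t)=Ax(t)+Bu(t)$ and $Cx(t)+Du(t)-f(t)\le 0$ for a.e. $t\in(0,T)$; $0\le x(T)\perp\mathbb{E}[M(\xi)x(T)+q(\xi)]\ge 0$; $x(0)=x_0$; $\mathbb{E}[g(x(T),\xi)]\in K$. A feasible solution is a pair $(x,u)\in H^1(0,T)^n\times L^2(0,T)^m$ satisfying all these constraints. For $J\subseteq\{1,\dots,n\}$ nonempty, $\mathbb{E}[M_{J,J}(\xi)]$ is the principal submatrix of $\mathbb{E}[M(\xi)]$ with rows and columns in $J$. Let $\mathcal{J}=\{J:\mathbb{E}[M_{J,J}(\xi)]\text{ is nonsingular}\}$; $\beta=1$ if $\mathcal{J}=\emptyset$, and $\beta=\max\{\|(\mathbb{E}[M_{J,J}(\xi)])^{-1}\|_1: J\in\mathcal{J}\}$ otherwise. A square matrix is a Z-matrix if its off-diagonal entries are non-positive. A matrix $N\in\mathbb{R}^{n\times n}$ is column adequate if for each $z\in\mathbb{R}^n$, $z_i(Nz)_i\le 0$ for all $i$ implies $Nz=0$; row adequate if $N^\top$ is column adequate; adequate if both. *)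

theory Defs
  imports "HOL-Probability.Probability"
begin

section \<open>Matrices\<close>

definition pseudoinverse :: "real^'m^'l \<Rightarrow> real^'l^'m" where
  "pseudoinverse D =
     (THE X. D ** X ** D = D \<and> X ** D ** X = X \<and>
        transpose (D ** X) = D ** X \<and> transpose (X ** D) = X ** D)"

lemma pseudoinverse_full_row_rank:
  fixes D :: "real^'m^'l"
  assumes "rank D = CARD('l)"
  shows "invertible (D ** transpose D)"
    and "pseudoinverse D = transpose D ** matrix_inv (D ** transpose D)"
proof -
  let ?G = "D ** transpose D"
  have inj: "inj ((*v) (transpose D))"
    using full_rank_injective[of "transpose D"] assms by (simp add: rank_transpose)
  have "v = 0" if "?G *v v = 0" for v
  proof -
    have "(transpose D *v v) \<bullet> (transpose D *v v) = v \<bullet> (?G *v v)"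
      by (metis dot_lmul_matrix matrix_vector_mul_assoc transpose_matrix_vector)
    then have "transpose D *v v = transpose D *v 0"
      using that by simp
    then show ?thesis
      using inj by (metis injD)
  qed
  then show inv: "invertible ?G"
    by (metis invertible_left_inverse matrix_left_invertible_ker)
  have Ginv: "?G ** matrix_inv ?G = mat 1"
    using inv unfolding invertible_def matrix_inv_def by (metis (mono_tags, lifting) someI_ex)
  let ?X = "transpose D ** matrix_inv ?G"
  have DX: "D ** ?X = mat 1"
    using Ginv by (simp add: matrix_mul_assoc)
  have "transpose (matrix_inv ?G) ** ?G = mat 1"
    using arg_cong[OF Ginv, of transpose]
    by (simp add: matrix_transpose_mul transpose_mat)
  then have symG: "transpose (matrix_inv ?G) = matrix_inv ?G"
    by (metis Ginv matrix_mul_assoc matrix_mul_lid matrix_mul_rid)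
  then have XDsym: "transpose (?X ** D) = ?X ** D"
    by (simp add: matrix_transpose_mul matrix_mul_assoc)
  show "pseudoinverse D = ?X"
    unfolding pseudoinverse_def
  proof (rule the_equality)
    show "D ** ?X ** D = D \<and> ?X ** D ** ?X = ?X \<and>
        transpose (D ** ?X) = D ** ?X \<and> transpose (?X ** D) = ?X ** D"
      using XDsym DX by (metis matrix_mul_assoc matrix_mul_lid matrix_mul_rid transpose_mat)
  next
    fix Z
    assume Z: "D ** Z ** D = D \<and> Z ** D ** Z = Z \<and>
        transpose (D ** Z) = D ** Z \<and> transpose (Z ** D) = Z ** D"
    have DZ: "D ** Z = mat 1"
      using Z DX by (metis matrix_mul_assoc matrix_mul_rid)
    have XDZD: "?X ** D ** (Z ** D) = ?X ** D"
      using DZ by (metis matrix_mul_assoc matrix_mul_rid)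
    have ZDXD: "Z ** D ** (?X ** D) = Z ** D"
      using DX by (metis matrix_mul_assoc matrix_mul_rid)
    have "?X ** D = Z ** D"
      using arg_cong[OF XDZD, of transpose] XDsym Z ZDXD by (simp add: matrix_transpose_mul)
    then show "Z = ?X"
      using DX DZ by (metis matrix_mul_assoc matrix_mul_rid)
  qed
qed

(* The class instance for * on vectors is componentwise, so ^ is not the matrix power. *)
definition matpow :: "real^'n^'n \<Rightarrow> nat \<Rightarrow> real^'n^'n" where
  "matpow N k = ((**) N ^^ k) (mat 1)"

(* The matrix [G  NG  N^2 G ... N^(n-1) G].  A column is indexed by a pair (block, column of
   that block); to_nat_on UNIV is a bijection from the index type 'n onto {..<CARD('n)}, so every
   exponent 0, ..., n-1 occurs in exactly one block. *)
definition krylov_matrix :: "real^'n^'n \<Rightarrow> real^'k^'n \<Rightarrow> real^('n \<times> 'k)^'n" where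
  "krylov_matrix N G =
     (\<chi> i c. (matpow N (to_nat_on (UNIV :: 'n set) (fst c)) ** G) $ i $ snd c)"

definition Z_matrix :: "real^'n^'n \<Rightarrow> bool" where
  "Z_matrix N \<longleftrightarrow> (\<forall>i j. i \<noteq> j \<longrightarrow> N $ i $ j \<le> 0)"

definition column_adequate :: "real^'n^'n \<Rightarrow> bool" where
  "column_adequate N \<longleftrightarrow> (\<forall>z. (\<forall>i. z $ i * (N *v z) $ i \<le> 0) \<longrightarrow> N *v z = 0)"

definition row_adequate :: "real^'n^'n \<Rightarrow> bool" where
  "row_adequate N \<longleftrightarrow> column_adequate (transpose N)"

definition adequate :: "real^'n^'n \<Rightarrow> bool" where
  "adequate N \<longleftrightarrow> column_adequate N \<and> row_adequate N"

definition vec_norm1 :: "real^'n \<Rightarrow> real" where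
  "vec_norm1 v = (\<Sum>i\<in>UNIV. \<bar>v $ i\<bar>)"

(* The matrix norm induced by vec_norm1: the maximal absolute column sum. *)
definition mat_norm1 :: "real^'n^'m \<Rightarrow> real" where
  "mat_norm1 N = Max (range (\<lambda>j. \<Sum>i\<in>UNIV. \<bar>N $ i $ j\<bar>))"

(* A J x J matrix is stored as an n x n matrix that vanishes outside J x J.  On such matrices ** is
   the product of J x J matrices, principal_submatrix (mat 1) J is the J x J identity, and
   mat_norm1 is the 1-norm of the J x J matrix. *)
definition principal_submatrix :: "real^'n^'n \<Rightarrow> 'n set \<Rightarrow> real^'n^'n" where
  "principal_submatrix N J = (\<chi> i j. if i \<in> J \<and> j \<in> J then N $ i $ j else 0)"

definition is_principal_inverse :: "real^'n^'n \<Rightarrow> 'n set \<Rightarrow> real^'n^'n \<Rightarrow> bool" where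
  "is_principal_inverse N J R \<longleftrightarrow>
     principal_submatrix R J = R \<and>
     principal_submatrix N J ** R = principal_submatrix (mat 1) J \<and>
     R ** principal_submatrix N J = principal_submatrix (mat 1) J"

definition nonsingular_index_sets :: "real^'n^'n \<Rightarrow> 'n set set" where
  "nonsingular_index_sets N = {J. J \<noteq> {} \<and> (\<exists>R. is_principal_inverse N J R)}"

definition principal_inverse :: "real^'n^'n \<Rightarrow> 'n set \<Rightarrow> real^'n^'n" where
  "principal_inverse N J = (THE R. is_principal_inverse N J R)"

definition beta_const :: "real^'n^'n \<Rightarrow> real" where
  "beta_const N =
     (if nonsingular_index_sets N = {} then 1
      else Max ((\<lambda>J. mat_norm1 (principal_inverse N J)) ` nonsingular_index_sets N))"

section \<open>Function spaces\<close>

definition continuously_differentiable ::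
    "('a::real_normed_vector \<Rightarrow> 'b::real_normed_vector) \<Rightarrow> bool" where
  "continuously_differentiable h \<longleftrightarrow>
     (\<exists>h'. (\<forall>z. (h has_derivative blinfun_apply (h' z)) (at z)) \<and> continuous_on UNIV h')"

definition L2_space :: "real \<Rightarrow> (real \<Rightarrow> real^'n) set" where
  "L2_space T =
     {x. x \<in> borel_measurable (lebesgue_on {0<..<T}) \<and>
         integrable (lebesgue_on {0<..<T}) (\<lambda>t. (norm (x t))\<^sup>2)}"

definition L2_norm :: "real \<Rightarrow> (real \<Rightarrow> real^'n) \<Rightarrow> real" where
  "L2_norm T x = sqrt (\<integral>t. (norm (x t))\<^sup>2 \<partial>lebesgue_on {0<..<T})"

definition test_function :: "real \<Rightarrow> (real \<Rightarrow> real) \<Rightarrow> bool" where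
  "test_function T \<phi> \<longleftrightarrow>
     (\<forall>k t. ((deriv ^^ k) \<phi>) field_differentiable (at t)) \<and>
     closure {t. \<phi> t \<noteq> 0} \<subseteq> {0<..<T}"

definition has_weak_derivative ::
    "real \<Rightarrow> (real \<Rightarrow> real^'n) \<Rightarrow> (real \<Rightarrow> real^'n) \<Rightarrow> bool" where
  "has_weak_derivative T x v \<longleftrightarrow>
     (\<forall>\<phi>. test_function T \<phi> \<longrightarrow>
        (\<integral>t. deriv \<phi> t *\<^sub>R x t \<partial>lebesgue_on {0<..<T}) =
        - (\<integral>t. \<phi> t *\<^sub>R v t \<partial>lebesgue_on {0<..<T}))"

(* Each H^1 class is represented by its unique representative that is continuous on [0,T]; this is
   what gives the point values x 0 and x T their meaning. *)
definition H1_space :: "real \<Rightarrow> (real \<Rightarrow> real^'n) set" where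
  "H1_space T =
     {x. x \<in> L2_space T \<and> (\<exists>v \<in> L2_space T. has_weak_derivative T x v) \<and>
         continuous_on {0..T} x}"

section \<open>The optimal control problem\<close>

definition feasible ::
    "'w measure \<Rightarrow> ('w \<Rightarrow> real^'d) \<Rightarrow> real \<Rightarrow>
     real^'n^'n \<Rightarrow> real^'m^'n \<Rightarrow> real^'n^'l \<Rightarrow> real^'m^'l \<Rightarrow> (real \<Rightarrow> real^'l) \<Rightarrow> real^'n \<Rightarrow>
     (real^'d \<Rightarrow> real^'n^'n) \<Rightarrow> (real^'d \<Rightarrow> real^'n) \<Rightarrow>
     (real^'n \<Rightarrow> real^'d \<Rightarrow> real^'p) \<Rightarrow> (real^'p) set \<Rightarrow>
     (real \<Rightarrow> real^'n) \<Rightarrow> (real \<Rightarrow> real^'m) \<Rightarrow> bool" where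
  "feasible P \<xi> T A B C D f x0 M q g K x u \<longleftrightarrow>
     x \<in> H1_space T \<and> u \<in> L2_space T \<and>
     (\<exists>v \<in> L2_space T. has_weak_derivative T x v \<and>
        (AE t in lebesgue_on {0<..<T}. v t = A *v x t + B *v u t)) \<and>
     (AE t in lebesgue_on {0<..<T}. C *v x t + D *v u t - f t \<le> 0) \<and>
     0 \<le> x T \<and>
     x T \<bullet> (\<integral>\<omega>. M (\<xi> \<omega>) *v x T + q (\<xi> \<omega>) \<partial>P) = 0 \<and>
     0 \<le> (\<integral>\<omega>. M (\<xi> \<omega>) *v x T + q (\<xi> \<omega>) \<partial>P) \<and>
     x 0 = x0 \<and>
     (\<integral>\<omega>. g (x T) (\<xi> \<omega>) \<partial>P) \<in> K"

definition objective ::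
    "'w measure \<Rightarrow> ('w \<Rightarrow> real^'d) \<Rightarrow> real \<Rightarrow> (real^'n \<Rightarrow> real^'d \<Rightarrow> real) \<Rightarrow> real \<Rightarrow>
     (real \<Rightarrow> real^'n) \<Rightarrow> (real \<Rightarrow> real^'m) \<Rightarrow>
     (real \<Rightarrow> real^'n) \<Rightarrow> (real \<Rightarrow> real^'m) \<Rightarrow> real" where
  "objective P \<xi> T F \<delta> xd ud x u =
     (\<integral>\<omega>. F (x T) (\<xi> \<omega>) \<partial>P) + 1/2 * (L2_norm T (\<lambda>t. x t - xd t))\<^sup>2
       + \<delta>/2 * (L2_norm T (\<lambda>t. u t - ud t))\<^sup>2"

end

theory Submission
  imports Defs
begin

text \<open>
  A feasible endpoint is a solution of the linear complementarity problem given by \<open>N = E[M]\<close> and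
  \<open>p = E[q]\<close>. For a Z-matrix, a nonnegative \<open>v\<close> with \<open>N v + p \<ge> 0\<close> of least component sum solves it;
  for an adequate matrix, the regularized problems with \<open>N + I/k\<close> on the boxes \<open>[0,k]\<^sup>n\<close> have solutions
  by Brouwer's theorem, and these stay bounded. A solution of minimal support has a nonsingular
  principal block, so its norm is at most \<open>\<beta> \<parallel>p\<parallel>\<^sub>1\<close>, and (c) puts \<open>E[g]\<close> into \<open>K\<close>. Controllability of
  \<open>(A - B D\<^sup>\<dagger> C, B Y)\<close> steers the state to any endpoint while \<open>C x + D u = f\<close>.

  For optimality, weak derivatives are turned into integral equations. The endpoints of a minimizing
  sequence subconverge; small controllable corrections make all endpoints equal to the limit. On the
  convex set of admissible pairs with this endpoint the quadratic part of the cost is minimized in the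
  limit, so by the parallelogram identity the corrected sequence is Cauchy in \<open>L\<^sup>2\<close>.
\<close>

section \<open>Linear complementarity problems\<close>

text \<open>Complementarity makes the set of feasible endpoints nonconvex, and \<open>E[F]\<close>
  need not be convex either, so no convexity argument applies to (P) as a whole. Both depend only on
  the finite-dimensional endpoint, where bounded sequences subconverge; once the endpoint is frozen,
  a strictly convex quadratic cost over a convex set is left. For this reason the corrections must
  have size proportional to the endpoint error: they then change the energy by a vanishing amount.
  The constant \<open>\<beta>\<close> arises because a solution \<open>z\<close> with support
  \<open>J\<close> satisfies \<open>N_JJ z_J = - p_J\<close>. Nonsingularity of \<open>N_JJ\<close>
  comes from minimality: a kernel vector of the block is a direction in which \<open>z\<close> can
  move, to a smaller feasible vector for a Z-matrix, to a solution of smaller support for a column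
  adequate matrix.\<close>

definition lcp_solution :: "real^'n^'n \<Rightarrow> real^'n \<Rightarrow> real^'n \<Rightarrow> bool" where
  "lcp_solution N p z \<longleftrightarrow> 0 \<le> z \<and> 0 \<le> N *v z + p \<and> z \<bullet> (N *v z + p) = 0"

definition vec_support :: "real^'n \<Rightarrow> 'n set" where
  "vec_support z = {i. z $ i \<noteq> 0}"

lemma lcp_solution_iff:
  fixes z :: "real^'n"
  shows "lcp_solution N p z \<longleftrightarrow>
    (\<forall>i. 0 \<le> z $ i \<and> 0 \<le> (N *v z) $ i + p $ i \<and> z $ i * ((N *v z) $ i + p $ i) = 0)"
proof -
  have "z \<bullet> (N *v z + p) = 0 \<longleftrightarrow> (\<forall>i. z $ i * ((N *v z) $ i + p $ i) = 0)"
    if "\<forall>i. 0 \<le> z $ i" "\<forall>i. 0 \<le> (N *v z) $ i + p $ i"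
    using that by (simp add: inner_vec_def sum_nonneg_eq_0_iff)
  then show ?thesis
    by (auto simp: lcp_solution_def less_eq_vec_def)
qed

section \<open>Principal blocks of a matrix and the constant \<open>\<beta>\<close>\<close>

lemma principal_identity_mult:
  "(principal_submatrix (mat 1) J ** X) $ i $ j = (if i \<in> J then X $ i $ j else 0)"
proof -
  have "(principal_submatrix (mat 1) J ** X) $ i $ j =
      (\<Sum>k\<in>UNIV. if k = i then (if i \<in> J then X $ i $ j else 0) else 0)"
    unfolding matrix_matrix_mult_def principal_submatrix_def mat_def vec_lambda_beta
    by (rule sum.cong) auto
  then show ?thesis by simp
qed

lemma mult_principal_identity:
  "(X ** principal_submatrix (mat 1) J) $ i $ j = (if j \<in> J then X $ i $ j else 0)"
proof -
  have "(X ** principal_submatrix (mat 1) J) $ i $ j =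
      (\<Sum>k\<in>UNIV. if k = j then (if j \<in> J then X $ i $ j else 0) else 0)"
    unfolding matrix_matrix_mult_def principal_submatrix_def mat_def vec_lambda_beta
    by (rule sum.cong) auto
  then show ?thesis by simp
qed

lemma principal_submatrix_alt:
  "principal_submatrix N J = principal_submatrix (mat 1) J ** N ** principal_submatrix (mat 1) J"
  by (auto simp: vec_eq_iff mult_principal_identity principal_identity_mult)
    (auto simp: principal_submatrix_def)

lemma principal_identity_idem:
  "principal_submatrix (mat 1) J ** principal_submatrix (mat 1) J = principal_submatrix (mat 1) J"
  by (auto simp: vec_eq_iff principal_identity_mult) (auto simp: principal_submatrix_def)

lemma principal_identity_mult_vec:
  "(principal_submatrix (mat 1) J *v z) $ i = (if i \<in> J then z $ i else 0)"
proof -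
  have "(principal_submatrix (mat 1) J *v z) $ i = (\<Sum>j\<in>UNIV. if j = i then (if i \<in> J then z $ i else 0) else 0)"
    unfolding matrix_vector_mult_def principal_submatrix_def mat_def vec_lambda_beta
    by (rule sum.cong) auto
  then show ?thesis by simp
qed

lemma is_principal_inverse_unique:
  assumes "is_principal_inverse N J R" "is_principal_inverse N J R'"
  shows "R = R'"
proof -
  let ?E = "principal_submatrix (mat 1) J"
  have "R = R ** ?E" "R' = ?E ** R'"
    using assms principal_submatrix_alt[of R J] principal_submatrix_alt[of R' J] principal_identity_idem[of J]
    unfolding is_principal_inverse_def
    by (metis matrix_mul_assoc)+
  then show ?thesis
    using assms unfolding is_principal_inverse_def by (metis matrix_mul_assoc)
qed

text \<open>The block is completed by the identity off \<open>J\<close>: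
  \<open>N' = E N E + (1 - E)\<close> is an ordinary square matrix, and the kernel condition makes
  it injective, hence invertible. As \<open>E N' = N' E\<close>, the inverse \<open>R'\<close>
  commutes with \<open>E\<close> too, and \<open>E ** R'\<close> inverts the block.\<close>

lemma is_principal_inverse_exists:
  assumes ker: "\<And>d. \<lbrakk>\<And>i. i \<notin> J \<Longrightarrow> d $ i = 0; \<And>i. i \<in> J \<Longrightarrow> (N *v d) $ i = 0\<rbrakk> \<Longrightarrow> d = 0"
  shows "\<exists>R. is_principal_inverse N J R"
proof -
  define E where "E = principal_submatrix (mat 1) J"
  define N' where "N' = E ** N ** E + (mat 1 - E)"
  have EE: "E ** E = E"
    by (simp add: E_def principal_identity_idem)
  have "d = 0" if "N' *v d = 0" for d
  proof (rule ker)
    have *: "(E *v (N *v (E *v d))) $ i + (d $ i - (E *v d) $ i) = 0" for i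
      using that by (simp add: N'_def vec_eq_iff matrix_vector_mult_add_rdistrib
          matrix_vector_mult_diff_rdistrib matrix_vector_mul_assoc matrix_mul_assoc)
    show d0: "d $ i = 0" if "i \<notin> J" for i
      using *[of i] that by (simp add: E_def principal_identity_mult_vec)
    then have "E *v d = d"
      by (auto simp: E_def principal_identity_mult_vec vec_eq_iff)
    then show "(N *v d) $ i = 0" if "i \<in> J" for i
      using *[of i] that by (simp add: E_def principal_identity_mult_vec)
  qed
  then have "invertible N'"
    by (metis invertible_left_inverse matrix_left_invertible_ker)
  then obtain R' where R': "R' ** N' = mat 1" "N' ** R' = mat 1"
    unfolding invertible_def by auto
  have N'E: "N' ** E = E ** N ** E" "E ** N' = E ** N ** E"
    by (auto simp: vec_eq_iff E_def mult_principal_identity principal_identity_mult N'_def)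
      (auto simp: principal_submatrix_def mat_def)
  have comm: "E ** R' = R' ** E"
  proof -
    have "E ** R' = R' ** (N' ** E) ** R'"
      by (simp add: matrix_mul_assoc R')
    also have "\<dots> = R' ** (E ** N') ** R'"
      by (simp only: N'E)
    also have "\<dots> = R' ** E ** (N' ** R')"
      by (simp only: matrix_mul_assoc)
    finally show ?thesis by (simp add: R')
  qed
  have "E ** R' ** E = E ** R'"
    by (metis EE comm matrix_mul_assoc)
  then have ERE: "E ** (E ** R') ** E = E ** R'"
    by (simp add: matrix_mul_assoc EE)
  have right: "(E ** N ** E) ** (E ** R') = E"
    by (metis EE N'E R'(2) matrix_mul_assoc matrix_mul_rid)
  have left: "(E ** R') ** (E ** N ** E) = E"
    by (metis EE N'E R'(1) comm matrix_mul_assoc matrix_mul_lid)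
  have "is_principal_inverse N J (E ** R')"
    unfolding is_principal_inverse_def
    using principal_submatrix_alt[of N J, folded E_def] principal_submatrix_alt[of "E ** R'" J, folded E_def]
      ERE right left E_def
    by simp
  then show ?thesis ..
qed

lemma vec_norm1_nonneg: "0 \<le> vec_norm1 v"
  by (simp add: vec_norm1_def sum_nonneg)

lemma norm_le_vec_norm1: "norm v \<le> vec_norm1 v"
  by (simp add: vec_norm1_def norm_le_l1_cart)

lemma mat_norm1_nonneg: "0 \<le> mat_norm1 N"
proof -
  have "mat_norm1 N \<in> range (\<lambda>j. \<Sum>i\<in>UNIV. \<bar>N $ i $ j\<bar>)"
    unfolding mat_norm1_def by (rule Max_in) auto
  then obtain j where "mat_norm1 N = (\<Sum>i\<in>UNIV. \<bar>N $ i $ j\<bar>)" by auto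
  then show ?thesis by (simp add: sum_nonneg)
qed

lemma vec_norm1_mult_le: "vec_norm1 (N *v v) \<le> mat_norm1 N * vec_norm1 v"
proof -
  have "vec_norm1 (N *v v) \<le> (\<Sum>i\<in>UNIV. \<Sum>j\<in>UNIV. \<bar>N $ i $ j\<bar> * \<bar>v $ j\<bar>)"
    unfolding vec_norm1_def matrix_vector_mult_def
    by (auto intro!: sum_mono order_trans[OF sum_abs] simp: abs_mult)
  also have "\<dots> = (\<Sum>j\<in>UNIV. (\<Sum>i\<in>UNIV. \<bar>N $ i $ j\<bar>) * \<bar>v $ j\<bar>)"
    by (subst sum.swap) (simp add: sum_distrib_right)
  also have "\<dots> \<le> (\<Sum>j\<in>UNIV. mat_norm1 N * \<bar>v $ j\<bar>)"
    unfolding mat_norm1_def by (intro sum_mono mult_right_mono Max_ge) auto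
  finally show ?thesis by (simp add: vec_norm1_def sum_distrib_left)
qed

lemma beta_const_nonneg: "0 \<le> beta_const (N :: real^'n^'n)"
proof (cases "nonsingular_index_sets N = {}")
  case False
  then have "beta_const N \<in> (\<lambda>J. mat_norm1 (principal_inverse N J)) ` nonsingular_index_sets N"
    unfolding beta_const_def using Max_in[of "(\<lambda>J. mat_norm1 (principal_inverse N J)) ` nonsingular_index_sets N"]
    by simp
  then show ?thesis using mat_norm1_nonneg by auto
qed (simp add: beta_const_def)

text \<open>On the support of \<open>z\<close> complementarity turns the inequality into an
  equation, so \<open>z\<close> is minus the block inverse applied to \<open>p\<close>, and the
  1-norm of that inverse is one of the numbers in the maximum \<open>beta_const\<close>. The zero
  solution is treated separately: its support is empty, and empty index sets are excluded.\<close>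

lemma lcp_solution_norm_le:
  assumes z: "lcp_solution N p z"
    and ker: "\<And>d. \<lbrakk>vec_support d \<subseteq> vec_support z; \<And>i. i \<in> vec_support z \<Longrightarrow> (N *v d) $ i = 0\<rbrakk> \<Longrightarrow> d = 0"
  shows "norm z \<le> beta_const N * vec_norm1 p"
proof (cases "z = 0")
  case True
  then show ?thesis by (simp add: beta_const_nonneg vec_norm1_nonneg)
next
  case False
  define J where "J = vec_support z"
  define E where "E = principal_submatrix (mat 1 :: real^'a^'a) J"
  have zi: "z $ i = 0" if "i \<notin> J" for i
    using that by (auto simp: J_def vec_support_def)
  have "\<exists>R. is_principal_inverse N J R"
    by (rule is_principal_inverse_exists, rule ker) (auto simp: J_def vec_support_def)
  then obtain R where R: "is_principal_inverse N J R" ..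
  have "J \<noteq> {}"
    using False by (auto simp: J_def vec_support_def vec_eq_iff)
  with R have J: "J \<in> nonsingular_index_sets N"
    by (auto simp: nonsingular_index_sets_def)
  have "principal_inverse N J = R"
    unfolding principal_inverse_def using R is_principal_inverse_unique by blast
  then have "mat_norm1 R \<le> beta_const N"
    unfolding beta_const_def using J by (auto intro!: Max_ge)
  moreover have "z = R *v (- p)"
  proof -
    have Ez: "E *v z = z"
      using zi by (auto simp: E_def vec_eq_iff principal_identity_mult_vec)
    have "(N *v z) $ i + p $ i = 0" if "i \<in> J" for i
      using z that unfolding lcp_solution_iff by (auto simp: J_def vec_support_def)
    then have Ep: "E *v (N *v z) = E *v (- p)"
      by (auto simp: E_def vec_eq_iff principal_identity_mult_vec eq_neg_iff_add_eq_0)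
    have RE: "R ** E = R"
      using R principal_submatrix_alt[of R J] principal_identity_idem[of J]
      unfolding is_principal_inverse_def E_def by (metis matrix_mul_assoc)
    have "z = (R ** (E ** N ** E)) *v z"
      using R Ez unfolding is_principal_inverse_def principal_submatrix_alt[of N J] E_def[symmetric] by simp
    also have "\<dots> = R *v (E *v (N *v (E *v z)))"
      by (simp add: matrix_vector_mul_assoc matrix_mul_assoc)
    also have "\<dots> = R *v (E *v (- p))"
      by (simp only: Ez Ep)
    also have "\<dots> = R *v (- p)"
      by (simp only: matrix_vector_mul_assoc RE)
    finally show ?thesis .
  qed
  then have "vec_norm1 z \<le> mat_norm1 R * vec_norm1 p"
    using vec_norm1_mult_le[of R "- p"] by (simp add: vec_norm1_def)
  ultimately show ?thesis
    by (meson mult_right_mono norm_le_vec_norm1 order_trans vec_norm1_nonneg)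
qed

text \<open>A minimizer of the component sum over the feasible set \<open>S\<close> is also minimal
  for the componentwise order. Lowering one coordinate can only raise the other rows of
  \<open>N *v z\<close>, because their entries in that column are nonpositive; so a positive
  coordinate with positive slack could still be lowered.\<close>

lemma Z_matrix_lcp_solution:
  fixes N :: "real^'n^'n"
  assumes Z: "Z_matrix N" and v: "0 \<le> v" "0 \<le> N *v v + p"
  shows "\<exists>z. lcp_solution N p z \<and> norm z \<le> beta_const N * vec_norm1 p"
proof -
  define S where "S = {w. 0 \<le> w \<and> 0 \<le> N *v w + p}"
  \<comment> \<open>Bounding the sum by that of \<open>v\<close> makes the feasible set compact
    without losing a minimizer.\<close>
  define T where "T = S \<inter> {w. (\<Sum>i\<in>UNIV. w $ i) \<le> (\<Sum>i\<in>UNIV. v $ i)}"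
  have "compact (cbox 0 (\<chi> i. \<Sum>j\<in>UNIV. v $ j) \<inter> T)"
  proof (rule compact_Int_closed)
    have "closed {w. 0 \<le> w $ i \<and> 0 \<le> (N *v w) $ i + p $ i}" for i
      unfolding matrix_vector_mult_def
      by (intro closed_Collect_conj closed_Collect_le continuous_intros) 
    then have "closed S"
      unfolding S_def less_eq_vec_def by (simp add: closed_Collect_all flip: all_conj_distrib)
    then show "closed T"
      unfolding T_def by (intro closed_Int closed_Collect_le continuous_intros)
  qed simp
  moreover have "cbox 0 (\<chi> i. \<Sum>j\<in>UNIV. v $ j) \<inter> T = T"
  proof -
    have "w $ i \<le> (\<Sum>j\<in>UNIV. v $ j)" if "w \<in> T" for w i
    proof -
      have "w $ i \<le> (\<Sum>j\<in>UNIV. w $ j)"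
        using that by (intro member_le_sum) (auto simp: T_def S_def less_eq_vec_def)
      then show ?thesis using that by (simp add: T_def)
    qed
    then have "T \<subseteq> cbox 0 (\<chi> i. \<Sum>j\<in>UNIV. v $ j)"
      by (auto simp: mem_box_cart T_def S_def less_eq_vec_def)
    then show ?thesis by auto
  qed
  ultimately have "compact T" by simp
  moreover have "v \<in> T" using v by (simp add: T_def S_def)
  moreover have "continuous_on T (\<lambda>w. \<Sum>i\<in>UNIV. w $ i)"
    by (intro continuous_intros)
  ultimately obtain z where z: "z \<in> T" "\<And>w. w \<in> T \<Longrightarrow> (\<Sum>i\<in>UNIV. z $ i) \<le> (\<Sum>i\<in>UNIV. w $ i)"
    using continuous_attains_inf[of T "\<lambda>w. \<Sum>i\<in>UNIV. w $ i"] by blast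
  have zS: "0 \<le> z $ i" "0 \<le> (N *v z) $ i + p $ i" for i
    using z(1) by (auto simp: T_def S_def less_eq_vec_def)
  have minimal: "w = z" if "w \<le> z" "w \<in> S" for w
  proof -
    have "(\<Sum>i\<in>UNIV. w $ i) \<le> (\<Sum>i\<in>UNIV. z $ i)"
      using that by (intro sum_mono) (auto simp: less_eq_vec_def)
    then have "w \<in> T" using z(1) that by (auto simp: T_def)
    then have "(\<Sum>i\<in>UNIV. z $ i - w $ i) \<le> 0"
      using z(2)[of w] by (simp add: sum_subtractf)
    moreover have nn: "0 \<le> z $ i - w $ i" for i
      using that by (simp add: less_eq_vec_def)
    ultimately have "(\<Sum>i\<in>UNIV. z $ i - w $ i) = 0"
      using sum_nonneg[of UNIV "\<lambda>i. z $ i - w $ i"] by simp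
    then show ?thesis
      using nn by (simp add: sum_nonneg_eq_0_iff vec_eq_iff)
  qed
  have "z $ i * ((N *v z) $ i + p $ i) = 0" for i
  proof (rule ccontr)
    assume "z $ i * ((N *v z) $ i + p $ i) \<noteq> 0"
    then have pos: "0 < z $ i" "0 < (N *v z) $ i + p $ i"
      using zS[of i] by (auto simp: less_le)
    \<comment> \<open>The first bound keeps coordinate \<open>i\<close> nonnegative, the second lets
      row \<open>i\<close> lose no more than its slack; \<open>+ 1\<close> keeps the denominator
      positive for a zero diagonal entry.\<close>
    define e where "e = min (z $ i) (((N *v z) $ i + p $ i) / (\<bar>N $ i $ i\<bar> + 1))"
    have e: "0 < e" "e \<le> z $ i" "e \<le> ((N *v z) $ i + p $ i) / (\<bar>N $ i $ i\<bar> + 1)"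
      using pos by (auto simp: e_def)
    then have e3: "e * (\<bar>N $ i $ i\<bar> + 1) \<le> (N *v z) $ i + p $ i"
      by (simp add: pos_le_divide_eq)
    define w where "w = z - e *\<^sub>R axis i 1"
    have Nw: "(N *v w) $ j = (N *v z) $ j - e * N $ j $ i" for j
      by (simp add: w_def matrix_vector_mult_diff_distrib matrix_vector_mult_scaleR
          matrix_vector_mult_basis column_def)
    have "w \<in> S"
    proof -
      have "0 \<le> w $ j" for j
        using e zS[of j] by (auto simp: w_def axis_def)
      moreover have "0 \<le> (N *v w) $ j + p $ j" for j
      proof (cases "j = i")
        case True
        have "e * N $ i $ i \<le> e * (\<bar>N $ i $ i\<bar> + 1)"
          using e by (intro mult_left_mono) auto
        then show ?thesis using e3 True by (simp add: Nw)
      next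
        case False
        then have "e * N $ j $ i \<le> 0"
          using Z e by (auto simp: Z_matrix_def intro!: mult_nonneg_nonpos)
        then show ?thesis using zS[of j] by (simp add: Nw)
      qed
      ultimately show ?thesis by (auto simp: S_def less_eq_vec_def)
    qed
    moreover have "w \<le> z" using e by (auto simp: w_def less_eq_vec_def axis_def)
    ultimately have "w = z" by (rule minimal[rotated])
    then have "w $ i = z $ i" by simp
    then show False using e by (simp add: w_def axis_def)
  qed
  then have sol: "lcp_solution N p z"
    using zS by (simp add: lcp_solution_iff)
  \<comment> \<open>Minimality forbids negative entries in a kernel vector \<open>d\<close> of the
    support block: otherwise the componentwise minimum \<open>w\<close> of \<open>z\<close> and
    \<open>z + e d\<close> would be a smaller element of \<open>S\<close>. Applied to
    \<open>d\<close> and \<open>- d\<close>, this gives \<open>d = 0\<close>.\<close>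
  have no_neg: "0 \<le> d $ i0"
    if d: "vec_support d \<subseteq> vec_support z" "\<And>i. i \<in> vec_support z \<Longrightarrow> (N *v d) $ i = 0" for d i0
  proof (rule ccontr)
    assume neg: "\<not> 0 \<le> d $ i0"
    let ?J = "vec_support z"
    have d0: "d $ i = 0" if "i \<notin> ?J" for i
      using that d(1) by (auto simp: vec_support_def)
    have zpos: "0 < z $ i" if "i \<in> ?J" for i
      using that zS[of i] by (auto simp: vec_support_def)
    obtain e where e: "0 < e" "\<And>i. i \<in> ?J \<Longrightarrow> e * \<bar>d $ i\<bar> \<le> z $ i"
    proof -
      \<comment> \<open>The inserted 1 keeps the set nonempty in every case, and \<open>+ 1\<close>
        guards against a zero \<open>d $ i\<close>.\<close>
      define X where "X = insert 1 ((\<lambda>i. z $ i / (\<bar>d $ i\<bar> + 1)) ` ?J)"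
      have X: "finite X" "X \<noteq> {}" "\<forall>x\<in>X. 0 < x"
        using zpos by (auto simp: X_def)
      show ?thesis
      proof
        show "0 < Min X" using X by (simp add: Min_gr_iff)
        show "Min X * \<bar>d $ i\<bar> \<le> z $ i" if "i \<in> ?J" for i
        proof -
          have "Min X \<le> z $ i / (\<bar>d $ i\<bar> + 1)"
            using X(1) that by (intro Min_le) (auto simp: X_def)
          then have "Min X * (\<bar>d $ i\<bar> + 1) \<le> z $ i"
            by (simp add: field_simps)
          moreover have "0 < Min X" using X by (simp add: Min_gr_iff)
          ultimately show ?thesis by (simp add: algebra_simps)
        qed
      qed
    qed
    define w where "w = (\<chi> i. min (z $ i) (z $ i + e * d $ i))"
    have wz: "w \<le> z" by (simp add: w_def less_eq_vec_def)
    have wi: "w $ i = z $ i \<or> w $ i = z $ i + e * d $ i" "w $ i \<le> z $ i" "w $ i \<le> z $ i + e * d $ i" for i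
      by (auto simp: w_def min_def)
    have "w \<in> S"
    proof -
      have "0 \<le> w $ i" for i
      proof (cases "i \<in> ?J")
        case True
        have "e * - \<bar>d $ i\<bar> \<le> e * d $ i" using e(1) by (intro mult_left_mono) auto
        then show ?thesis using e(2)[OF True] zS[of i] by (auto simp: w_def)
      next
        case False then show ?thesis using d0[of i] zS[of i] by (auto simp: w_def)
      qed
      moreover have "0 \<le> (N *v w) $ i + p $ i" for i
      proof (cases "i \<in> ?J \<and> w $ i \<noteq> z $ i")
        case True
        then have wi': "w $ i = z $ i + e * d $ i" using wi[of i] by auto
        \<comment> \<open>Row \<open>i\<close> is compared with the vector that attains the minimum
          at \<open>i\<close>: the diagonal terms agree, and elsewhere \<open>w\<close> is smaller
          while the entries of the row are nonpositive.\<close>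
        have "(N *v (z + e *\<^sub>R d)) $ i \<le> (N *v w) $ i"
          unfolding matrix_vector_mult_def vec_lambda_beta
        proof (rule sum_mono)
          fix j show "N $ i $ j * (z + e *\<^sub>R d) $ j \<le> N $ i $ j * w $ j"
            using Z wi[of j] wi' by (cases "i = j") (auto simp: Z_matrix_def intro!: mult_left_mono_neg)
        qed
        moreover have "(N *v (z + e *\<^sub>R d)) $ i = (N *v z) $ i"
          using d(2) True by (simp add: matrix_vector_right_distrib matrix_vector_mult_scaleR)
        ultimately show ?thesis using zS[of i] by simp
      next
        case False
        then have wi': "w $ i = z $ i" using d0[of i] wi[of i] by auto
        have "(N *v z) $ i \<le> (N *v w) $ i"
          unfolding matrix_vector_mult_def vec_lambda_beta
        proof (rule sum_mono)
          fix j show "N $ i $ j * z $ j \<le> N $ i $ j * w $ j"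
            using Z wi[of j] wi' by (cases "i = j") (auto simp: Z_matrix_def intro!: mult_left_mono_neg)
        qed
        then show ?thesis using zS[of i] by simp
      qed
      ultimately show ?thesis by (auto simp: S_def less_eq_vec_def)
    qed
    then have "w = z" using minimal wz by blast
    then have "z $ i0 \<le> z $ i0 + e * d $ i0" using wi(3)[of i0] by simp
    then show False using neg e(1) by (simp add: zero_le_mult_iff)
  qed
  have "norm z \<le> beta_const N * vec_norm1 p"
  proof (rule lcp_solution_norm_le[OF sol])
    fix d :: "real^'n" assume d: "vec_support d \<subseteq> vec_support z" "\<And>i. i \<in> vec_support z \<Longrightarrow> (N *v d) $ i = 0"
    have "0 \<le> d $ i" for i using no_neg[OF d] .
    moreover have "0 \<le> (- d) $ i" for i
      using d by (intro no_neg) (auto simp: vec_support_def vec.neg)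
    ultimately show "d = 0" by (simp add: vec_eq_iff order_antisym)
  qed
  with sol show ?thesis by blast
qed

text \<open>For \<open>d\<close> in the kernel of the support block every product
  \<open>d $ i * (N *v d) $ i\<close> is zero, so column adequacy upgrades this to
  \<open>N *v d = 0\<close>. Moving \<open>z\<close> along \<open>d\<close> then leaves all slacks
  unchanged and can go on until a coordinate vanishes, against the minimality of the
  support.\<close>

lemma column_adequate_lcp_norm_le:
  fixes N :: "real^'n^'n"
  assumes N: "column_adequate N" and ex: "lcp_solution N p y"
  shows "\<exists>z. lcp_solution N p z \<and> norm z \<le> beta_const N * vec_norm1 p"
proof -

  obtain z where z: "lcp_solution N p z"
    and zmin: "\<And>w. lcp_solution N p w \<Longrightarrow> card (vec_support z) \<le> card (vec_support w)"
    using ex_has_least_nat[where P = "lcp_solution N p" and m = "\<lambda>z. card (vec_support z)", OF ex] by blast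
  have "norm z \<le> beta_const N * vec_norm1 p"
  proof (rule lcp_solution_norm_le[OF z], rule ccontr)
    fix d :: "real^'n"
    assume d: "vec_support d \<subseteq> vec_support z" "\<And>i. i \<in> vec_support z \<Longrightarrow> (N *v d) $ i = 0" "d \<noteq> 0"
    have "d $ i * (N *v d) $ i \<le> 0" for i
      using d(1) d(2)[of i] by (cases "d $ i = 0") (auto simp: vec_support_def)
    then have Nd: "N *v d = 0"
      using N by (auto simp: column_adequate_def)
    \<comment> \<open>Either \<open>d\<close> or \<open>- d\<close> has a negative entry; the move
      needs a decreasing coordinate in order to stop.\<close>
    obtain e where e: "vec_support e \<subseteq> vec_support z" "N *v e = 0" "\<exists>i. e $ i < 0"
    proof (cases "\<exists>i. d $ i < 0")
      case True then show ?thesis using that[of d] d Nd by auto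
    next
      case False
      then have "\<exists>i. (- d) $ i < 0"
        using d(3) by (auto simp: vec_eq_iff not_less order_le_less)
      moreover have "N *v (- d) = 0" using Nd by (simp add: vec.neg)
      ultimately show ?thesis using that[of "- d"] d(1) by (auto simp: vec_support_def)
    qed
    define I where "I = {i. e $ i < 0}"
    \<comment> \<open>Ratio test: the largest step that keeps \<open>z + t e\<close> nonnegative. An
      index \<open>k\<close> attaining the minimum leaves the support.\<close>
    define t where "t = Min ((\<lambda>i. z $ i / - e $ i) ` I)"
    have I: "finite I" "I \<noteq> {}" using e(3) by (auto simp: I_def)
    have zpos: "0 \<le> z $ i" for i using z by (simp add: lcp_solution_iff)
    have "t \<in> (\<lambda>i. z $ i / - e $ i) ` I"
      unfolding t_def using I by (intro Min_in) auto
    then obtain k where k: "k \<in> I" "t = z $ k / - e $ k" by auto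
    have t: "t \<le> z $ i / - e $ i" if "i \<in> I" for i
      unfolding t_def using I that by (intro Min_le) auto
    have t0: "0 \<le> t" using k zpos[of k] by (auto simp: I_def intro!: divide_nonneg_nonpos)
    define w where "w = z + t *\<^sub>R e"
    have Nw: "N *v w = N *v z"
      by (simp add: w_def matrix_vector_right_distrib matrix_vector_mult_scaleR e)
    have wk: "w $ k = 0" using k by (auto simp: w_def I_def)
    have wpos: "0 \<le> w $ i" for i
    proof (cases "i \<in> I")
      case True
      then show ?thesis using t[OF True] by (auto simp: I_def w_def field_simps)
    next
      case False
      then show ?thesis using zpos[of i] t0 by (auto simp: I_def w_def)
    qed
    have supp: "vec_support w \<subseteq> vec_support z"
      using e(1) by (auto simp: vec_support_def w_def)
    have "k \<in> vec_support e" using k by (simp add: vec_support_def I_def)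
    then have "k \<in> vec_support z" using e(1) by blast
    moreover have "k \<notin> vec_support w" using wk by (simp add: vec_support_def)
    ultimately have "vec_support w \<subset> vec_support z" using supp by auto
    then have "card (vec_support w) < card (vec_support z)"
      by (intro psubset_card_mono) auto
    moreover have "lcp_solution N p w"
      unfolding lcp_solution_iff
    proof (intro allI conjI)
      fix i
      show "0 \<le> w $ i" "0 \<le> (N *v w) $ i + p $ i" using wpos z by (auto simp: Nw lcp_solution_iff)
      show "w $ i * ((N *v w) $ i + p $ i) = 0"
        using z supp by (cases "w $ i = 0") (auto simp: Nw lcp_solution_iff vec_support_def)
    qed
    ultimately show False using zmin[of w] by simp
  qed
  with z show ?thesis by blast
qed

text \<open>Brouwer's theorem is applied to \<open>z - G z\<close> clipped to the box, and the
  fixed-point equation is read off coordinate by coordinate. The upper faces are artificial: there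
  \<open>G z $ i\<close> may be negative.\<close>

lemma box_complementarity:
  fixes G :: "real^'n \<Rightarrow> real^'n"
  assumes G: "continuous_on UNIV G" and k: "0 \<le> k"
  obtains z where "\<And>i. 0 \<le> z $ i" "\<And>i. z $ i \<le> k"
    "\<And>i. z $ i < k \<Longrightarrow> 0 \<le> G z $ i" "\<And>i. 0 < z $ i \<Longrightarrow> G z $ i \<le> 0"
proof -
  define S where "S = cbox (0 :: real^'n) (\<chi> i. k)"
  define h where "h = (\<lambda>z. \<chi> i. max 0 (min k (z $ i - G z $ i)))"
  have "(0 :: real^'n) \<in> S" using k by (auto simp: S_def mem_box_cart)
  then have ne: "S \<noteq> {}" by auto
  have "continuous_on S h"
    unfolding h_def
    by (intro continuous_intros continuous_on_subset[OF G]) auto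
  moreover have "h \<in> S \<rightarrow> S" using k by (auto simp: S_def h_def mem_box_cart)
  ultimately obtain z where z: "z \<in> S" "h z = z"
    using brouwer[of S h] ne by (auto simp: S_def)
  have "max 0 (min k (z $ i - G z $ i)) = z $ i" for i
    using arg_cong[OF z(2), of "\<lambda>v. v $ i"] by (simp add: h_def)
  note * = this
  show thesis
  proof
    fix i
    show "0 \<le> z $ i" "z $ i \<le> k" using z(1) by (auto simp: S_def mem_box_cart)
    show "0 \<le> G z $ i" if "z $ i < k" using *[of i] that by (auto simp: max_def min_def split: if_splits)
    show "G z $ i \<le> 0" if "0 < z $ i" using *[of i] that by (auto simp: max_def min_def split: if_splits)
  qed
qed

text \<open>The alternative to a nonnegative kernel vector of the transpose is a vector with
  \<^term>\<open>N *v s\<close> positive on the support of \<^term>\<open>d\<close>; subtracting a large multiple of \<^term>\<open>d\<close>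
  from it contradicts column adequacy.\<close>

lemma adequate_nonneg_left_kernel:
  fixes N :: "real^'n^'n"
  assumes N: "adequate N" and d: "0 \<le> d" "d \<noteq> 0" "N *v d = 0"
  obtains y where "0 \<le> y" "y \<noteq> 0" "transpose N *v y = 0" "vec_support y \<subseteq> vec_support d"
proof -
  define I where "I = vec_support d"
  define E where "E = principal_submatrix (mat 1 :: real^'n^'n) I"
  have Ei: "(E *v z) $ i = (if i \<in> I then z $ i else 0)" for z i
    by (simp add: E_def principal_identity_mult_vec)
  have "I \<noteq> {}" using d(2) by (auto simp: I_def vec_support_def vec_eq_iff)
  then obtain i0 where i0: "i0 \<in> I" by auto
  have dpos: "0 < d $ i" if "i \<in> I" for i
    using that d(1) by (auto simp: I_def vec_support_def less_eq_vec_def less_le)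
  \<comment> \<open>The simplex of weights carried by \<open>I\<close>; a zero of \<open>L\<close>
    on it is the wanted \<open>y\<close>, up to the rows outside \<open>I\<close>.\<close>
  define \<Delta> where "\<Delta> = {y :: real^'n. (\<forall>i. 0 \<le> y $ i \<and> (i \<notin> I \<longrightarrow> y $ i = 0)) \<and> (\<Sum>i\<in>UNIV. y $ i) = 1}"
  have cvx: "convex \<Delta>"
    by (rule convexI) (auto simp: \<Delta>_def sum.distrib simp flip: sum_distrib_left)
  have cl: "closed \<Delta>"
    unfolding \<Delta>_def
    by (intro closed_Collect_conj closed_Collect_all closed_Collect_imp closed_Collect_le
        closed_Collect_eq continuous_intros) auto
  have "y $ i \<le> 1" if "y \<in> \<Delta>" for y i
    using that member_le_sum[of i UNIV "\<lambda>i. y $ i"] by (auto simp: \<Delta>_def)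
  then have "\<Delta> \<subseteq> cbox 0 (\<chi> i. 1)" by (auto simp: \<Delta>_def mem_box_cart)
  then have cpt: "compact \<Delta>"
    using compact_Int_closed[OF compact_cbox cl, of 0 "\<chi> i. 1"] by (simp add: inf.absorb2)
  define L where "L = (\<lambda>y. E *v (transpose N *v y))"
  have bl: "bounded_linear L"
    unfolding L_def by (intro bounded_linear_compose[OF matrix_vector_mul_bounded_linear]) simp
  have "0 \<in> L ` \<Delta>"
  proof (rule ccontr)
    assume "0 \<notin> L ` \<Delta>"
    moreover have "convex (L ` \<Delta>)"
      using cvx bl by (intro convex_linear_image) (auto simp: bounded_linear.linear)
    moreover have "closed (L ` \<Delta>)"
      using cpt bl by (intro compact_imp_closed compact_continuous_image linear_continuous_on)
    ultimately obtain a b where ab: "0 < b" "\<And>x. x \<in> L ` \<Delta> \<Longrightarrow> b < a \<bullet> x"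
      using separating_hyperplane_closed_0[of "L ` \<Delta>"] by blast
    \<comment> \<open>The separating functional restricted to \<open>I\<close>; testing it on the
      vertices \<open>axis i 1\<close> of the simplex gives \<open>(N *v s) $ i > 0\<close> on
      \<open>I\<close>.\<close>
    define s where "s = E *v a"
    have Ns: "0 < (N *v s) $ i" if i: "i \<in> I" for i
    proof -
      have "axis i 1 \<in> \<Delta>" using i by (auto simp: \<Delta>_def axis_def)
      then have "b < a \<bullet> L (axis i 1)" using ab(2) by blast
      also have "a \<bullet> L (axis i 1) = s \<bullet> (transpose N *v axis i 1)"
        by (auto simp: L_def s_def inner_vec_def Ei intro!: sum.cong)
      also have "\<dots> = (N *v s) \<bullet> axis i 1"
        by (metis dot_lmul_matrix transpose_matrix_vector transpose_transpose)
      also have "\<dots> = (N *v s) $ i" by (simp add: inner_axis)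
      finally show ?thesis using ab(1) by simp
    qed
    have s0: "s $ i = 0" if "i \<notin> I" for i using that by (simp add: s_def Ei)
    \<comment> \<open>Large enough that \<open>s - t d\<close> is nonpositive on \<open>I\<close>;
      since \<open>N *v d = 0\<close>, its image under \<open>N\<close> is still that of
      \<open>s\<close>.\<close>
    define t where "t = Max ((\<lambda>i. \<bar>s $ i\<bar> / d $ i) ` I)"
    have t: "s $ i \<le> t * d $ i" if "i \<in> I" for i
    proof -
      have "\<bar>s $ i\<bar> / d $ i \<le> t" unfolding t_def using that by (intro Max_ge) auto
      then show ?thesis using dpos[OF that] by (simp add: field_simps)
    qed
    have "(s - t *\<^sub>R d) $ i * (N *v (s - t *\<^sub>R d)) $ i \<le> 0" for i
    proof (cases "i \<in> I")
      case True
      then show ?thesis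
        using t[OF True] Ns[OF True]
        by (auto simp: matrix_vector_mult_diff_distrib matrix_vector_mult_scaleR d(3) intro!: mult_nonpos_nonneg)
    next
      case False
      then show ?thesis using s0 by (simp add: I_def vec_support_def)
    qed
    then have "N *v (s - t *\<^sub>R d) = 0"
      using N by (auto simp: adequate_def column_adequate_def)
    then show False
      using Ns[OF i0] by (simp add: matrix_vector_mult_diff_distrib matrix_vector_mult_scaleR d(3))
  qed
  then obtain y where y: "y \<in> \<Delta>" "L y = 0" by auto
  have y0: "y $ i = 0" if "i \<notin> I" for i using y(1) that by (auto simp: \<Delta>_def)
  \<comment> \<open>\<open>L y = 0\<close> only kills the rows in \<open>I\<close>; as
    \<open>y\<close> vanishes elsewhere, row adequacy yields the remaining rows.\<close>
  have "(transpose N *v y) $ i = 0" if "i \<in> I" for i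
    using arg_cong[OF y(2), of "\<lambda>v. v $ i"] that by (simp add: L_def Ei)
  then have "y $ i * (transpose N *v y) $ i \<le> 0" for i
    using y0 by (cases "i \<in> I") auto
  then have "transpose N *v y = 0"
    using N by (auto simp: adequate_def row_adequate_def column_adequate_def)
  moreover have "y \<noteq> 0" using y(1) by (auto simp: \<Delta>_def)
  moreover have "vec_support y \<subseteq> vec_support d"
    using y0 unfolding I_def[symmetric] by (auto simp: vec_support_def)
  moreover have "0 \<le> y" using y(1) by (auto simp: \<Delta>_def less_eq_vec_def)
  ultimately show thesis using that by blast
qed

text \<open>A bounded family of regularized solutions eventually stays off the upper faces of the
  boxes, and a limit point solves the problem. In the unbounded case column adequacy gives a limit
  direction \<open>d\<close> with \<open>N *v d = 0\<close>, and a left kernel vector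
  \<open>y\<close> supported in that of \<open>d\<close> is paired with \<open>w k z\<close>. The
  pairing is nonpositive by the sign conditions, but positive by feasibility of \<open>v\<close> and
  the regularizing term.\<close>

lemma adequate_lcp_solvable:
  fixes N :: "real^'n^'n"
  assumes N: "adequate N" and v: "0 \<le> v" "0 \<le> N *v v + p"
  shows "\<exists>z. lcp_solution N p z"
proof -
  define w where "w = (\<lambda>k z. N *v z + p + (1 / real (Suc k)) *\<^sub>R z)"
  have wi: "w k z $ i = (N *v z) $ i + p $ i + (1 / real (Suc k)) * z $ i" for k z i
    by (simp add: w_def)
  have "\<exists>z. \<forall>i. 0 \<le> z $ i \<and> z $ i \<le> real k \<and> (z $ i < real k \<longrightarrow> 0 \<le> w k z $ i)
      \<and> (0 < z $ i \<longrightarrow> w k z $ i \<le> 0)" for k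
  proof -
    have "continuous_on UNIV (w k)"
      unfolding w_def
      by (intro continuous_intros linear_continuous_on[OF matrix_vector_mul_bounded_linear])
    then show ?thesis
      by (rule box_complementarity[of "w k" "real k"]) (simp, blast)
  qed
  then obtain Z where Z: "\<And>k i. 0 \<le> Z k $ i" "\<And>k i. Z k $ i < real k \<Longrightarrow> 0 \<le> w k (Z k) $ i"
    "\<And>k i. 0 < Z k $ i \<Longrightarrow> w k (Z k) $ i \<le> 0"
    by metis
  show ?thesis
  proof (cases "bounded (range Z)")
    case True
    then obtain r z where r: "strict_mono r" "(\<lambda>k. Z (r k)) \<longlonglongrightarrow> z"
      using bounded_imp_convergent_subsequence[OF True] by (auto simp: o_def)
    obtain b where b: "\<And>k. norm (Z k) \<le> b" using True by (auto simp: bounded_iff)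
    have Zb: "Z k $ i \<le> b" for k i
      using component_le_norm_cart[of "Z k" i] b[of k] by linarith
    \<comment> \<open>From here on the bound \<open>b\<close> lies below the box size, so
      \<open>0 \<le> w\<close> holds in every coordinate.\<close>
    have ev: "\<forall>\<^sub>F k in sequentially. b < real (r k)"
    proof -
      have "filterlim (\<lambda>k. real (r k)) at_top sequentially"
        using r(1) by (intro filterlim_compose[OF filterlim_real_sequentially] filterlim_subseq)
      then show ?thesis by (simp add: filterlim_at_top_dense)
    qed
    have lz: "(\<lambda>k. Z (r k) $ i) \<longlonglongrightarrow> z $ i" for i
      using r(2) by (rule tendsto_vec_nth)
    have lN: "(\<lambda>k. (N *v Z (r k)) $ i) \<longlonglongrightarrow> (N *v z) $ i" for i
      by (intro tendsto_vec_nth bounded_linear.tendsto[OF matrix_vector_mul_bounded_linear] r(2))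
    have "(\<lambda>k. 1 / real (Suc (r k))) \<longlonglongrightarrow> 0"
      using LIMSEQ_subseq_LIMSEQ[OF LIMSEQ_Suc[OF lim_1_over_n] r(1)] by (simp add: o_def)
    note lr = tendsto_mult[OF this lz]
    have lw: "(\<lambda>k. w (r k) (Z (r k)) $ i) \<longlonglongrightarrow> (N *v z) $ i + p $ i" for i
      unfolding wi using tendsto_add[OF tendsto_add[OF lN tendsto_const] lr]
      by simp
    have "lcp_solution N p z"
      unfolding lcp_solution_iff
    proof (intro allI conjI)
      fix i
      show "0 \<le> z $ i" by (rule LIMSEQ_le_const[OF lz]) (use Z in auto)
      have wev: "\<forall>\<^sub>F k in sequentially. 0 \<le> w (r k) (Z (r k)) $ i"
        using ev by eventually_elim (use Zb Z(2) in \<open>meson le_less_trans\<close>)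
      then show "0 \<le> (N *v z) $ i + p $ i"
        by (rule tendsto_lowerbound[OF lw]) simp
      have "\<forall>\<^sub>F k in sequentially. Z (r k) $ i * w (r k) (Z (r k)) $ i = 0"
        using wev by eventually_elim (use Z(1,3) in \<open>metis mult_eq_0_iff order_antisym order_le_less\<close>)
      then have "(\<lambda>k. Z (r k) $ i * w (r k) (Z (r k)) $ i) \<longlonglongrightarrow> 0"
        by (simp add: tendsto_eventually)
      with tendsto_mult[OF lz lw] show "z $ i * ((N *v z) $ i + p $ i) = 0"
        by (rule LIMSEQ_unique)
    qed
    then show ?thesis ..
  next
    case False
    then have "\<exists>k. real n < norm (Z k)" for n
      unfolding bounded_iff by (auto simp: not_le)
    then obtain s where s: "\<And>n. real n < norm (Z (s n))" by metis
    define e where "e = (\<lambda>n. inverse (norm (Z (s n))) *\<^sub>R Z (s n))"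
    have pos: "0 < norm (Z (s n))" for n using s[of n] by linarith
    have "e n \<in> sphere 0 1" for n using pos[of n] by (simp add: e_def)
    then obtain d r where d: "d \<in> sphere 0 1" "strict_mono r" "(e \<circ> r) \<longlonglongrightarrow> d"
      using compact_sphere[of "0 :: real^'n" 1] unfolding compact_def by metis
    have ld: "(\<lambda>n. e (r n) $ i) \<longlonglongrightarrow> d $ i" for i
      using tendsto_vec_nth[OF d(3)] by (simp add: o_def)
    have lN: "(\<lambda>n. (N *v e (r n)) $ i) \<longlonglongrightarrow> (N *v d) $ i" for i
      using bounded_linear.tendsto[OF matrix_vector_mul_bounded_linear d(3)]
      by (intro tendsto_vec_nth) (simp add: o_def)
    have linv: "(\<lambda>n. inverse (norm (Z (s (r n))))) \<longlonglongrightarrow> 0"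
    proof (intro tendsto_inverse_0_at_top)
      have "filterlim (\<lambda>n. norm (Z (s n))) at_top sequentially"
        by (rule filterlim_at_top_mono[OF filterlim_real_sequentially]) (use s in \<open>auto intro: always_eventually less_imp_le\<close>)
      then show "filterlim (\<lambda>n. norm (Z (s (r n)))) at_top sequentially"
        by (rule filterlim_compose[OF _ filterlim_subseq[OF d(2)]])
    qed
    have d0: "0 \<le> d $ i" for i
      by (rule LIMSEQ_le_const[OF ld]) (use Z(1) in \<open>auto simp: e_def\<close>)
    have "d $ i * (N *v d) $ i \<le> 0" for i
    proof (rule tendsto_le[OF _ _ tendsto_mult[OF ld lN]])
      show "(\<lambda>n. inverse (norm (Z (s (r n)))) * (e (r n) $ i * - p $ i)) \<longlonglongrightarrow> 0"
        using tendsto_mult[OF linv tendsto_mult[OF ld tendsto_const[of "- p $ i"]], of i] by (simp only: mult_zero_left)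
      show "\<forall>\<^sub>F n in sequentially. e (r n) $ i * (N *v e (r n)) $ i
          \<le> inverse (norm (Z (s (r n)))) * (e (r n) $ i * - p $ i)"
      proof (rule always_eventually, rule allI)
        fix n
        let ?z = "Z (s (r n))" let ?c = "inverse (norm ?z)"
        have "?z $ i * w (s (r n)) ?z $ i \<le> 0"
          using Z(1,3) by (metis mult_nonneg_nonpos mult_zero_left order_le_less)
        then have "?z $ i * (N *v ?z) $ i + ?z $ i * p $ i + (1 / real (Suc (s (r n)))) * (?z $ i * ?z $ i) \<le> 0"
          by (simp add: wi algebra_simps)
        moreover have "0 \<le> (1 / real (Suc (s (r n)))) * (?z $ i * ?z $ i)" by simp
        ultimately have "?z $ i * (N *v ?z) $ i \<le> ?z $ i * - p $ i"
          unfolding mult_minus_right by linarith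
        then have "?c * ?c * (?z $ i * (N *v ?z) $ i) \<le> ?c * ?c * (?z $ i * - p $ i)"
          by (rule mult_left_mono) simp
        then show "e (r n) $ i * (N *v e (r n)) $ i \<le> ?c * (e (r n) $ i * - p $ i)"
          by (simp add: e_def matrix_vector_mult_scaleR mult_ac)
      qed
    qed simp
    then have Nd: "N *v d = 0"
      using N by (auto simp: adequate_def column_adequate_def)
    have "0 \<le> d" "d \<noteq> 0" using d0 d(1) by (auto simp: less_eq_vec_def)
    then obtain y where y: "0 \<le> y" "y \<noteq> 0" "transpose N *v y = 0" "vec_support y \<subseteq> vec_support d"
      using adequate_nonneg_left_kernel[OF N _ _ Nd] by metis
    have yN: "y \<bullet> (N *v x) = 0" for x
      using y(3) by (metis dot_lmul_matrix inner_zero_left transpose_matrix_vector)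
    \<comment> \<open>Late normalized solutions inherit positivity on the support of
      \<open>d\<close>, so \<open>w\<close> is nonpositive there.\<close>
    have "\<forall>\<^sub>F n in sequentially. \<forall>i\<in>vec_support d. 0 < e (r n) $ i"
      by (intro eventually_ball_finite ballI order_tendstoD(1)[OF ld])
        (use d0 in \<open>auto simp: vec_support_def less_le\<close>)
    then obtain n where "\<forall>i\<in>vec_support d. 0 < e (r n) $ i"
      by (auto simp: eventually_sequentially)
    then have zp: "0 < Z (s (r n)) $ i" if "i \<in> vec_support d" for i
      using that pos by (auto simp: e_def zero_less_mult_iff)
    define z k where "z = Z (s (r n))" and "k = s (r n)"
    have yz: "y $ i \<noteq> 0 \<Longrightarrow> 0 < y $ i \<and> 0 < z $ i \<and> w k z $ i \<le> 0" for i
      using zp[of i] y(1,4) Z(3)[of k i] by (auto simp: z_def k_def vec_support_def less_eq_vec_def less_le)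
    obtain j where "y $ j \<noteq> 0" using y(2) by (auto simp: vec_eq_iff)
    then have "0 < y $ j * z $ j" using yz by auto
    also have "\<dots> \<le> y \<bullet> z"
      unfolding inner_vec_def inner_real_def
      using y(1) Z(1) by (intro member_le_sum) (auto simp: z_def less_eq_vec_def)
    finally have "0 < (1 / real (Suc k)) * (y \<bullet> z)" by simp
    moreover have "y \<bullet> w k z \<le> 0"
      unfolding inner_vec_def inner_real_def
      by (rule sum_nonpos) (metis yz mult_nonneg_nonpos mult_zero_left order_le_less order_refl)
    \<comment> \<open>\<open>y\<close> annihilates the range of \<open>N\<close>, so feasibility of
      \<open>v\<close> fixes the sign of \<open>y \<bullet> p\<close>.\<close>
    moreover have "0 \<le> y \<bullet> p"
    proof -
      have "0 \<le> y \<bullet> (N *v v + p)"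
        unfolding inner_vec_def inner_real_def
        using y(1) v(2) by (intro sum_nonneg mult_nonneg_nonneg) (auto simp: less_eq_vec_def)
      then show ?thesis by (simp add: inner_add_right yN)
    qed
    moreover have "y \<bullet> w k z = y \<bullet> p + (1 / real (Suc k)) * (y \<bullet> z)"
      unfolding w_def by (simp add: inner_add_right yN)
    ultimately show ?thesis by linarith
  qed
qed

theorem lcp_solution_bounded:
  fixes N :: "real^'n^'n"
  assumes "adequate N \<or> Z_matrix N" and "0 \<le> v" "0 \<le> N *v v + p"
  shows "\<exists>z. lcp_solution N p z \<and> norm z \<le> beta_const N * vec_norm1 p"
  using assms Z_matrix_lcp_solution adequate_lcp_solvable column_adequate_lcp_norm_le
  by (metis adequate_def)

section \<open>Linear differential equations and controllability\<close>

lemma bounded_bilinear_matrix_vector_mult: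
  "bounded_bilinear ((*v) :: real^'n^'m \<Rightarrow> real^'n \<Rightarrow> real^'m)"
  by (simp add: bilinear_conv_bounded_bilinear[symmetric] bilinear_def linear_iff
      matrix_vector_right_distrib matrix_vector_mult_add_rdistrib
      matrix_vector_mult_scaleR scaleR_matrix_vector_assoc)

lemma bounded_bilinear_matrix_matrix_mult:
  "bounded_bilinear ((**) :: real^'n^'m \<Rightarrow> real^'k^'n \<Rightarrow> real^'k^'m)"
  by (simp add: bilinear_conv_bounded_bilinear[symmetric] bilinear_def linear_iff
      vec_eq_iff matrix_matrix_mult_def algebra_simps sum.distrib sum_distrib_left)

section \<open>Matrix powers and the matrix exponential\<close>

lemma matpow_0 [simp]: "matpow N 0 = mat 1"
  and matpow_Suc: "matpow N (Suc k) = N ** matpow N k"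
  by (simp_all add: matpow_def)

lemma matpow_Suc_right: "matpow N (Suc k) = matpow N k ** N"
  by (induction k) (simp_all add: matpow_Suc matrix_mul_assoc)

text \<open>This is exp(t N), written as one real power series per entry so that the termwise
  differentiation of real power series applies.\<close>

definition mexp :: "real^'n^'n \<Rightarrow> real \<Rightarrow> real^'n^'n" where
  "mexp N t = (\<chi> i j. \<Sum>k. matpow N k $ i $ j / fact k * t ^ k)"

lemma matpow_component_le:
  fixes N :: "real^'n^'n"
  shows "\<bar>matpow N k $ i $ j\<bar> \<le> (\<Sum>i\<in>UNIV. \<Sum>j\<in>UNIV. \<bar>N $ i $ j\<bar>) ^ k"
proof (induction k arbitrary: i j)
  case 0
  then show ?case by (simp add: mat_def)
next
  case (Suc k)
  let ?c = "\<Sum>i\<in>UNIV. \<Sum>j\<in>UNIV. \<bar>N $ i $ j\<bar>"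
  have c: "0 \<le> ?c" by (intro sum_nonneg) auto
  have "\<bar>matpow N (Suc k) $ i $ j\<bar> \<le> (\<Sum>l\<in>UNIV. \<bar>N $ i $ l\<bar> * \<bar>matpow N k $ l $ j\<bar>)"
    by (simp add: matpow_Suc matrix_matrix_mult_def order_trans[OF sum_abs] abs_mult)
  also have "\<dots> \<le> (\<Sum>l\<in>UNIV. \<bar>N $ i $ l\<bar> * ?c ^ k)"
    by (intro sum_mono mult_left_mono Suc.IH) auto
  also have "\<dots> = (\<Sum>l\<in>UNIV. \<bar>N $ i $ l\<bar>) * ?c ^ k"
    by (simp add: sum_distrib_right)
  also have "(\<Sum>l\<in>UNIV. \<bar>N $ i $ l\<bar>) \<le> ?c"
    by (rule member_le_sum[of i UNIV "\<lambda>i. \<Sum>l\<in>UNIV. \<bar>N $ i $ l\<bar>"]) (auto intro: sum_nonneg)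
  finally show ?case
    using c by (simp add: mult_right_mono)
qed

lemma summable_mexp: "summable (\<lambda>k. matpow N k $ i $ j / fact k * t ^ k)"
proof (rule summable_comparison_test')
  let ?c = "\<Sum>i\<in>UNIV. \<Sum>j\<in>UNIV. \<bar>N $ i $ j\<bar>"
  show "summable (\<lambda>k. inverse (fact k) * (?c * \<bar>t\<bar>) ^ k)"
    by (rule summable_exp)
  show "norm (matpow N k $ i $ j / fact k * t ^ k) \<le> inverse (fact k) * (?c * \<bar>t\<bar>) ^ k" for k
    using mult_right_mono[OF matpow_component_le[of N k i j], of "inverse (fact k) * \<bar>t\<bar> ^ k"]
    by (simp add: abs_mult power_abs power_mult_distrib divide_inverse mult_ac)
qed

lemma diffs_mexp: "diffs (\<lambda>k. matpow N k $ i $ j / fact k) k = matpow N (Suc k) $ i $ j / fact k"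
  by (simp add: diffs_def field_simps del: of_nat_Suc)

lemma mexp_0 [simp]: "mexp N 0 = mat 1"
proof -
  have *: "(\<Sum>k. a k * 0 ^ k) = a 0" for a :: "nat \<Rightarrow> real"
    by (rule powser_zero)
  show ?thesis by (simp only: mexp_def vec_eq_iff vec_lambda_beta *) simp
qed

lemma mexp_component_derivative:
  "((\<lambda>t. mexp N t $ i $ j) has_real_derivative (\<Sum>k. matpow N (Suc k) $ i $ j / fact k * t ^ k)) (at t)"
  using termdiffs_strong_converges_everywhere[OF summable_mexp[of N i j], of t]
  by (simp add: mexp_def diffs_mexp)

lemma mexp_mult_left: "(\<Sum>k. matpow N (Suc k) $ i $ j / fact k * t ^ k) = (N ** mexp N t) $ i $ j"
proof -
  have "(\<Sum>k. matpow N (Suc k) $ i $ j / fact k * t ^ k)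
      = (\<Sum>k. \<Sum>l\<in>UNIV. N $ i $ l * (matpow N k $ l $ j / fact k * t ^ k))"
    by (intro suminf_cong)
      (simp add: matpow_Suc matrix_matrix_mult_def divide_inverse sum_distrib_left sum_distrib_right mult_ac)
  also have "\<dots> = (\<Sum>l\<in>UNIV. \<Sum>k. N $ i $ l * (matpow N k $ l $ j / fact k * t ^ k))"
    by (rule suminf_sum) (intro summable_mult summable_mexp)
  also have "\<dots> = (\<Sum>l\<in>UNIV. N $ i $ l * (\<Sum>k. matpow N k $ l $ j / fact k * t ^ k))"
    by (intro sum.cong refl suminf_mult summable_mexp)
  finally show ?thesis by (simp add: mexp_def matrix_matrix_mult_def)
qed

lemma mexp_mult_right: "(\<Sum>k. matpow N (Suc k) $ i $ j / fact k * t ^ k) = (mexp N t ** N) $ i $ j"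
proof -
  have "(\<Sum>k. matpow N (Suc k) $ i $ j / fact k * t ^ k)
      = (\<Sum>k. \<Sum>l\<in>UNIV. N $ l $ j * (matpow N k $ i $ l / fact k * t ^ k))"
    by (intro suminf_cong)
      (simp add: matpow_Suc_right matrix_matrix_mult_def divide_inverse sum_distrib_left sum_distrib_right mult_ac)
  also have "\<dots> = (\<Sum>l\<in>UNIV. \<Sum>k. N $ l $ j * (matpow N k $ i $ l / fact k * t ^ k))"
    by (rule suminf_sum) (intro summable_mult summable_mexp)
  also have "\<dots> = (\<Sum>l\<in>UNIV. N $ l $ j * (\<Sum>k. matpow N k $ i $ l / fact k * t ^ k))"
    by (intro sum.cong refl suminf_mult summable_mexp)
  finally show ?thesis by (simp add: mexp_def matrix_matrix_mult_def mult_ac)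
qed

text \<open>Both sides are the same derivative series, read with the extra factor \<open>N\<close>
  on the left or on the right.\<close>

lemma mexp_commute: "N ** mexp N t = mexp N t ** N"
  by (simp add: vec_eq_iff flip: mexp_mult_left mexp_mult_right)

lemma mexp_derivative: "(mexp N has_vector_derivative N ** mexp N t) (at t within S)"
proof -
  have "(mexp N has_derivative (\<lambda>h. h *\<^sub>R (N ** mexp N t))) (at t)"
  proof (subst has_derivative_componentwise_within, intro ballI)
    fix b :: "real^'a^'a" assume "b \<in> Basis"
    then obtain i j where b: "b = axis i (axis j 1)"
      by (auto simp: Basis_vec_def)
    show "((\<lambda>t. mexp N t \<bullet> b) has_derivative (\<lambda>h. (h *\<^sub>R (N ** mexp N t)) \<bullet> b)) (at t)"
      using mexp_component_derivative[of N i j t] unfolding mexp_mult_left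
      by (simp add: b inner_axis has_field_derivative_def mult_commute_abs)
  qed
  then show ?thesis
    unfolding has_vector_derivative_def by (rule has_derivative_at_withinI)
qed

lemma mexp_neg_derivative:
  "((\<lambda>s. mexp N (- s)) has_vector_derivative - (mexp N (- t) ** N)) (at t within S)"
proof -
  have "((\<lambda>s::real. - s) has_vector_derivative - 1) (at t within S)"
    by (auto intro!: derivative_eq_intros)
  from vector_diff_chain_within[OF this mexp_derivative[of N "- t" "uminus ` S"]]
  show ?thesis by (simp add: o_def mexp_commute)
qed

lemma mexp_continuous: "continuous_on S (mexp N)" "continuous_on S (\<lambda>s. mexp N (- s))"
  unfolding continuous_on_eq_continuous_within
  by (blast intro: has_vector_derivative_continuous mexp_derivative mexp_neg_derivative)+

text \<open>The product has zero derivative and so keeps its value at \<open>t = 0\<close>.\<close>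

lemma mexp_inverse: "mexp N (- t) ** mexp N t = mat 1"
proof -
  have "((\<lambda>t. mexp N (- t) ** mexp N t) has_vector_derivative
      mexp N (- t) ** (N ** mexp N t) + - (mexp N (- t) ** N) ** mexp N t) (at t within UNIV)" for t
    by (rule bounded_bilinear.has_vector_derivative[OF bounded_bilinear_matrix_matrix_mult
          mexp_neg_derivative mexp_derivative])
  moreover have "mexp N (- t) ** (N ** mexp N t) + - (mexp N (- t) ** N) ** mexp N t = 0" for t
    by (simp add: matrix_mul_assoc bounded_bilinear.minus_left[OF bounded_bilinear_matrix_matrix_mult])
  ultimately obtain c where c: "mexp N (- t) ** mexp N t = c" for t
    using has_vector_derivative_zero_constant[of UNIV "\<lambda>t. mexp N (- t) ** mexp N t"] by auto
  show ?thesis using c[of t] c[of 0] by simp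
qed

lemma mexp_inverse': "mexp N t ** mexp N (- t) = mat 1"
  using mexp_inverse[of N "- t"] by simp

text \<open>Variation of constants. Continuity of \<open>k\<close> is what gives a classical
  derivative at every point of the interval.\<close>

lemma linear_ode_solution:
  fixes N :: "real^'n^'n" and k :: "real \<Rightarrow> real^'n" and a :: "real^'n"
  assumes k: "continuous_on {0..T} k"
  defines "c \<equiv> \<lambda>t. mexp N t *v (a + integral {0..t} (\<lambda>s. mexp N (- s) *v k s))"
  shows "\<And>t. t \<in> {0..T} \<Longrightarrow> (c has_vector_derivative N *v c t + k t) (at t within {0..T})"
    and "c 0 = a"
proof -
  show "c 0 = a" by (simp add: c_def)
  fix t assume t: "t \<in> {0..T}"
  have "continuous_on {0..T} (\<lambda>s. mexp N (- s) *v k s)"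
    by (rule bounded_bilinear.continuous_on[OF bounded_bilinear_matrix_vector_mult mexp_continuous(2) k])
  from integral_has_vector_derivative[OF this t]
  have "((\<lambda>t. a + integral {0..t} (\<lambda>s. mexp N (- s) *v k s)) has_vector_derivative
      mexp N (- t) *v k t) (at t within {0..T})"
    by (auto intro!: derivative_eq_intros)
  from bounded_bilinear.has_vector_derivative[OF bounded_bilinear_matrix_vector_mult mexp_derivative[of N t] this]
  show "(c has_vector_derivative N *v c t + k t) (at t within {0..T})"
    unfolding c_def by (simp add: matrix_vector_mul_assoc mexp_inverse' add.commute)
qed

text \<open>Each column of the Krylov matrix is some \<open>matpow N k *v (G *v e)\<close> with a
  unit vector \<open>e\<close>, so \<open>y\<close> lies in the kernel of the transpose, which full
  row rank makes injective.\<close>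

lemma krylov_orthogonal_eq_0:
  fixes N :: "real^'n^'n" and G :: "real^'k^'n"
  assumes rank: "rank (krylov_matrix N G) = CARD('n)"
    and y: "\<And>k w. y \<bullet> (matpow N k *v (G *v w)) = 0"
  shows "y = 0"
proof -
  let ?K = "krylov_matrix N G"
  have "(transpose ?K *v y) $ c = 0" for c
  proof -
    let ?k = "to_nat_on (UNIV :: 'n set) (fst c)"
    have "(transpose ?K *v y) $ c = y \<bullet> column (snd c) (matpow N ?k ** G)"
      by (simp add: matrix_vector_mult_def transpose_def krylov_matrix_def inner_vec_def column_def mult_ac)
    also have "\<dots> = y \<bullet> (matpow N ?k *v (G *v axis (snd c) 1))"
      by (simp only: matrix_vector_mult_basis[symmetric] matrix_vector_mul_assoc)
    finally show ?thesis using y by simp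
  qed
  then have "transpose ?K *v y = transpose ?K *v 0"
    by (simp add: vec_eq_iff)
  moreover have "inj ((*v) (transpose ?K))"
    using full_rank_injective[of "transpose ?K"] rank by (simp add: rank_transpose)
  ultimately show ?thesis by (metis injD)
qed

text \<open>Steering by the controllability Gramian: its kernel vectors are orthogonal to
  the Krylov space, by repeated differentiation.\<close>

lemma controllability:
  fixes N :: "real^'n^'n" and G :: "real^'k^'n"
  assumes T: "0 < T" and rank: "rank (krylov_matrix N G) = CARD('n)"
  shows "\<exists>\<phi> w. continuous_on {0..T} w \<and> \<phi> 0 = 0 \<and> \<phi> T = z \<and>
    (\<forall>t\<in>{0..T}. (\<phi> has_vector_derivative N *v \<phi> t + G *v w t) (at t within {0..T}))"
proof -
  \<comment> \<open>\<open>W v\<close> is the adjoint output for \<open>v\<close>, used as the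
    control; \<open>\<gamma>\<close> is the controllability Gramian, with the factor
    \<open>mexp N T\<close> of the endpoint map left out.\<close>
  define W where "W = (\<lambda>v s. transpose G *v (transpose (mexp N (- s)) *v v))"
  define \<gamma> where "\<gamma> = (\<lambda>v. integral {0..T} (\<lambda>s. mexp N (- s) *v (G *v W v s)))"
  have tr: "continuous_on S (\<lambda>s. transpose (mexp N (- s)))" for S
    using mexp_continuous(2)[of S N] unfolding transpose_def
    by (intro continuous_on_vec_lambda continuous_on_component) auto
  have Wc: "continuous_on {0..T} (W v)" for v
    unfolding W_def
    by (intro bounded_linear.continuous_on[OF matrix_vector_mul_bounded_linear]
        bounded_bilinear.continuous_on[OF bounded_bilinear_matrix_vector_mult tr continuous_on_const])
  have gc: "continuous_on {0..T} (\<lambda>s. mexp N (- s) *v (G *v W v s))" for v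
    by (intro bounded_bilinear.continuous_on[OF bounded_bilinear_matrix_vector_mult mexp_continuous(2)]
        bounded_linear.continuous_on[OF matrix_vector_mul_bounded_linear] Wc)
  have lin: "linear \<gamma>"
  proof
    show "\<gamma> (a + b) = \<gamma> a + \<gamma> b" for a b
      unfolding \<gamma>_def integral_add[OF integrable_continuous_real[OF gc] integrable_continuous_real[OF gc], symmetric]
      by (simp only: W_def matrix_vector_right_distrib)
    show "\<gamma> (r *\<^sub>R a) = r *\<^sub>R \<gamma> a" for r a
      unfolding \<gamma>_def by (simp only: W_def matrix_vector_mult_scaleR integral_cmul)
  qed
  have "v = 0" if "\<gamma> v = 0" for v
  proof -
    have eq: "v \<bullet> (mexp N (- s) *v (G *v w)) = W v s \<bullet> w" for w s
      unfolding W_def by (metis dot_lmul_matrix transpose_matrix_vector)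
    have "integral {0..T} (\<lambda>s. W v s \<bullet> W v s) = v \<bullet> \<gamma> v"
      unfolding \<gamma>_def eq[symmetric]
      by (intro integral_linear[where h = "\<lambda>x. v \<bullet> x", unfolded o_def] integrable_continuous_real gc
          bounded_linear_inner_right)
    then have "integral {0..T} (\<lambda>s. W v s \<bullet> W v s) = 0" using that by simp
    moreover have "continuous_on {0..T} (\<lambda>s. W v s \<bullet> W v s)"
      by (intro continuous_intros Wc)
    ultimately have W0: "W v s = 0" if "s \<in> {0..T}" for s
      using T that integral_eq_0_iff[of 0 T "\<lambda>s. W v s \<bullet> W v s"] by auto
    \<comment> \<open>Differentiating a function that is identically zero brings down one more
      factor \<open>N\<close>; the open interval allows two-sided derivatives.\<close>
    have *: "\<forall>s\<in>{0<..<T}. v \<bullet> (mexp N (- s) *v (matpow N k *v (G *v w))) = 0" for k w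
    proof (induction k)
      case 0
      then show ?case using W0 by (simp add: eq)
    next
      case (Suc k)
      show ?case
      proof
        fix s assume s: "s \<in> {0<..<T}"
        let ?u = "matpow N k *v (G *v w)"
        have "((\<lambda>s. v \<bullet> (mexp N (- s) *v ?u)) has_vector_derivative
            v \<bullet> (- (mexp N (- s) ** N) *v ?u)) (at s within UNIV)"
          by (intro bounded_linear.has_vector_derivative[OF bounded_linear_inner_right]
              bounded_linear.has_vector_derivative[OF bounded_bilinear.bounded_linear_left[OF
                bounded_bilinear_matrix_vector_mult]] mexp_neg_derivative)
        then have "((\<lambda>s. 0) has_vector_derivative v \<bullet> (- (mexp N (- s) ** N) *v ?u)) (at s)"
          by (rule has_vector_derivative_transform_within_open[of _ _ _ "{0<..<T}"])
            (use s Suc in auto)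
        moreover have "((\<lambda>s::real. 0::real) has_vector_derivative 0) (at s)"
          by simp
        ultimately have "v \<bullet> (- (mexp N (- s) ** N) *v ?u) = 0"
          by (rule vector_derivative_unique_at)
        then have "v \<bullet> ((mexp N (- s) ** N) *v ?u) = 0"
          by (simp only: bounded_bilinear.minus_left[OF bounded_bilinear_matrix_vector_mult]
              inner_minus_right neg_equal_0_iff_equal)
        then show "v \<bullet> (mexp N (- s) *v (matpow N (Suc k) *v (G *v w))) = 0"
          by (simp only: matpow_Suc matrix_vector_mul_assoc matrix_mul_assoc)
      qed
    qed
    \<comment> \<open>Any interior time would do; \<open>mexp\<close> is invertible there, so
      \<open>y = 0\<close> returns \<open>v = 0\<close>.\<close>
    define y where "y = transpose (mexp N (- (T / 2))) *v v"
    have y: "y \<bullet> u = v \<bullet> (mexp N (- (T / 2)) *v u)" for u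
      unfolding y_def by (metis dot_lmul_matrix transpose_matrix_vector)
    have "y = 0"
      by (rule krylov_orthogonal_eq_0[OF rank]) (use * T in \<open>simp add: y\<close>)
    have "v \<bullet> v = y \<bullet> (mexp N (T / 2) *v v)"
      unfolding y by (simp add: matrix_vector_mul_assoc mexp_inverse)
    then show "v = 0" using \<open>y = 0\<close> by simp
  qed
  then have "inj \<gamma>" using lin by (simp add: linear_injective_0)
  then have "surj \<gamma>" using lin by (simp add: linear_injective_imp_surjective)
  \<comment> \<open>Chosen to cancel the factor \<open>mexp N T\<close> in front of the integral in
    \<open>\<phi> T\<close>.\<close>
  then obtain v where v: "\<gamma> v = mexp N (- T) *v z" by (metis surjD)
  define \<phi> where "\<phi> = (\<lambda>t. mexp N t *v (0 + integral {0..t} (\<lambda>s. mexp N (- s) *v (G *v W v s))))"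
  have "\<phi> T = mexp N T *v \<gamma> v" by (simp add: \<phi>_def \<gamma>_def)
  then have "\<phi> T = z" by (simp add: v matrix_vector_mul_assoc mexp_inverse')
  have GW: "continuous_on {0..T} (\<lambda>s. G *v W v s)"
    by (intro bounded_linear.continuous_on[OF matrix_vector_mul_bounded_linear] Wc)
  have "\<phi> 0 = 0"
    unfolding \<phi>_def by (rule linear_ode_solution(2)[OF GW])
  moreover have "(\<phi> has_vector_derivative N *v \<phi> t + G *v W v t) (at t within {0..T})"
    if "t \<in> {0..T}" for t
    unfolding \<phi>_def by (rule linear_ode_solution(1)[OF GW that])
  ultimately show ?thesis
    by (intro exI[of _ \<phi>] exI[of _ "W v"] conjI ballI Wc \<open>\<phi> T = z\<close>)
qed

section \<open>Weak derivatives\<close>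

text \<open>The flat function exp(-1/t) with a polynomial in 1/t as an extra factor, which makes the
  family closed under differentiation.\<close>

definition exp_bump :: "real poly \<Rightarrow> real \<Rightarrow> real" where
  "exp_bump p t = (if 0 < t then poly p (1 / t) * exp (- (1 / t)) else 0)"

lemma tendsto_poly_mult_exp_neg: "((\<lambda>s. poly q s * exp (- s)) \<longlongrightarrow> (0::real)) at_top"
proof -
  have "((\<lambda>s. \<Sum>i\<le>degree q. coeff q i * (s ^ i / exp s)) \<longlongrightarrow> (\<Sum>i\<le>degree q. coeff q i * 0)) at_top"
    by (intro tendsto_sum tendsto_mult tendsto_const tendsto_power_div_exp_0)
  then show ?thesis
    by (simp add: poly_altdef sum_distrib_left exp_minus divide_inverse mult_ac)
qed

text \<open>For \<open>t > 0\<close> the chain rule gives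
  \<open>t^-2 (p - p')(1/t) exp(-1/t)\<close>, whence the factor \<open>[:0, 0, 1:]\<close>. At 0
  the right difference quotient becomes, with \<open>s = 1/h\<close>, a polynomial times
  \<open>exp (- s)\<close>, which tends to 0.\<close>

lemma exp_bump_derivative:
  "(exp_bump p has_real_derivative exp_bump ([:0, 0, 1:] * (p - pderiv p)) t) (at t)"
proof (cases t "0 :: real" rule: linorder_cases)
  case less
  have "((\<lambda>_. 0) has_real_derivative 0) (at t)" by simp
  then have "(exp_bump p has_real_derivative 0) (at t)"
    by (rule has_field_derivative_transform_within_open[of _ _ _ "{..<0}"])
      (use less in \<open>auto simp: exp_bump_def\<close>)
  then show ?thesis using less by (simp add: exp_bump_def)
next
  case greater
  have d: "((\<lambda>t. 1 / t) has_real_derivative - (1 / t\<^sup>2)) (at t)"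
    using greater by (auto intro!: derivative_eq_intros simp: power2_eq_square)
  have "((\<lambda>t. poly p (1 / t) * exp (- (1 / t))) has_real_derivative
      poly (pderiv p) (1 / t) * - (1 / t\<^sup>2) * exp (- (1 / t))
        + exp (- (1 / t)) * - (- (1 / t\<^sup>2)) * poly p (1 / t)) (at t)"
    by (rule DERIV_mult[OF DERIV_chain2[OF poly_DERIV d] DERIV_chain2[OF DERIV_exp DERIV_minus[OF d]]])
  also have "poly (pderiv p) (1 / t) * - (1 / t\<^sup>2) * exp (- (1 / t))
        + exp (- (1 / t)) * - (- (1 / t\<^sup>2)) * poly p (1 / t) = exp_bump ([:0, 0, 1:] * (p - pderiv p)) t"
    using greater by (simp add: exp_bump_def algebra_simps power2_eq_square)
  finally show ?thesis
    by (rule has_field_derivative_transform_within_open[of _ _ _ "{0<..}"])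
      (use greater in \<open>auto simp: exp_bump_def\<close>)
next
  case equal
  have "((\<lambda>h. exp_bump p h / h) \<longlongrightarrow> 0) (at 0)"
  proof (rule filterlim_split_at)
    have "\<forall>\<^sub>F h in at_left 0. exp_bump p h / h = 0"
      unfolding eventually_at_filter by (simp add: exp_bump_def)
    then show "((\<lambda>h. exp_bump p h / h) \<longlongrightarrow> 0) (at_left 0)"
      by (rule tendsto_eventually)
    have "((\<lambda>s. poly ([:0, 1:] * p) s * exp (- s)) \<longlongrightarrow> 0) at_top"
      by (rule tendsto_poly_mult_exp_neg)
    moreover have "\<forall>\<^sub>F s in at_top. poly ([:0, 1:] * p) s * exp (- s) = exp_bump p (inverse s) / inverse s"
      using eventually_gt_at_top[of 0] by eventually_elim (simp add: exp_bump_def divide_simps)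
    ultimately have "((\<lambda>s. exp_bump p (inverse s) / inverse s) \<longlongrightarrow> 0) at_top"
      by (rule Lim_transform_eventually)
    then show "((\<lambda>h. exp_bump p h / h) \<longlongrightarrow> 0) (at_right 0)"
      by (simp add: filterlim_at_right_to_top)
  qed
  then show ?thesis using equal by (simp add: has_field_derivative_iff exp_bump_def)
qed

text \<open>A class of functions that is closed under differentiation, hence consists of smooth functions.\<close>

inductive bump_generated :: "(real \<Rightarrow> real) \<Rightarrow> bool" where
  base: "bump_generated (exp_bump p)"
| const: "bump_generated (\<lambda>_. c)"
| add: "bump_generated f \<Longrightarrow> bump_generated g \<Longrightarrow> bump_generated (\<lambda>t. f t + g t)"
| mult: "bump_generated f \<Longrightarrow> bump_generated g \<Longrightarrow> bump_generated (\<lambda>t. f t * g t)"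
| affine: "bump_generated f \<Longrightarrow> bump_generated (\<lambda>t. f (a + b * t))"
| antiderivative: "bump_generated f \<Longrightarrow> (\<And>t. (h has_real_derivative f t) (at t)) \<Longrightarrow> bump_generated h"

lemma bump_generated_derivative:
  assumes "bump_generated f"
  shows "\<exists>f'. bump_generated f' \<and> (\<forall>t. (f has_real_derivative f' t) (at t))"
  using assms
proof induction
  case (base p)
  then show ?case using exp_bump_derivative bump_generated.base by blast
next
  case (const c)
  then show ?case using bump_generated.const[of 0] by (intro exI[of _ "\<lambda>_. 0"]) auto
next
  case (add f g)
  then obtain f' g' where "bump_generated f'" "bump_generated g'"
    "\<And>t. (f has_real_derivative f' t) (at t)" "\<And>t. (g has_real_derivative g' t) (at t)" by blast
  then show ?case
    by (intro exI[of _ "\<lambda>t. f' t + g' t"] conjI allI DERIV_add bump_generated.add)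
next
  case (mult f g)
  then obtain f' g' where "bump_generated f'" "bump_generated g'"
    "\<And>t. (f has_real_derivative f' t) (at t)" "\<And>t. (g has_real_derivative g' t) (at t)" by blast
  then show ?case using mult.hyps
    by (intro exI[of _ "\<lambda>t. f' t * g t + g' t * f t"] conjI allI DERIV_mult
        bump_generated.add[OF bump_generated.mult bump_generated.mult])
next
  case (affine f a b)
  then obtain f' where f': "bump_generated f'" "\<And>t. (f has_real_derivative f' t) (at t)" by blast
  have "((\<lambda>t. f (a + b * t)) has_real_derivative f' (a + b * t) * b) (at t)" for t
    by (rule DERIV_chain2[OF f'(2)]) (auto intro!: derivative_eq_intros)
  moreover have "bump_generated (\<lambda>t. f' (a + b * t) * b)"
    by (rule bump_generated.mult[OF bump_generated.affine[OF f'(1)] bump_generated.const])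
  ultimately show ?case by blast
qed blast

lemma bump_generated_smooth:
  assumes "bump_generated f"
  shows "((deriv ^^ k) f) field_differentiable (at t)"
proof -
  have "bump_generated ((deriv ^^ k) f)"
  proof (induction k)
    case (Suc k)
    then obtain f' where f': "bump_generated f'" "\<forall>t. (((deriv ^^ k) f) has_real_derivative f' t) (at t)"
      using bump_generated_derivative by blast
    then have "deriv ((deriv ^^ k) f) = f'"
      by (auto simp: fun_eq_iff intro: DERIV_imp_deriv)
    then show ?case using f' by simp
  qed (use assms in simp)
  then show ?thesis
    using bump_generated_derivative field_differentiable_def by blast
qed

lemma exp_bump_continuous: "continuous_on S (exp_bump p)"
  by (rule DERIV_continuous_on[OF has_field_derivative_at_within[OF exp_bump_derivative]])

section \<open>Compactly supported bumps, steps and mollifiers\<close>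

definition std_bump :: "real \<Rightarrow> real" where
  "std_bump t = exp_bump 1 (1 + t) * exp_bump 1 (1 - t)"

text \<open>A smooth step from 0 to the total mass \<open>std_step 1\<close> of the bump; it is not
  normalized, so this mass stays as a factor in the estimates.\<close>

definition std_step :: "real \<Rightarrow> real" where
  "std_step t = integral {-1..t} std_bump"

lemma std_bump_nonneg: "0 \<le> std_bump t"
  and std_bump_pos: "\<bar>t\<bar> < 1 \<Longrightarrow> 0 < std_bump t"
  and std_bump_outside: "1 \<le> \<bar>t\<bar> \<Longrightarrow> std_bump t = 0"
  by (auto simp: std_bump_def exp_bump_def)

lemma std_bump_generated: "bump_generated std_bump"
proof -
  have "bump_generated (\<lambda>t. exp_bump 1 (1 + 1 * t) * exp_bump 1 (1 + (-1) * t))"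
    by (rule bump_generated.mult[OF bump_generated.affine[OF bump_generated.base]
          bump_generated.affine[OF bump_generated.base]])
  then show ?thesis by (simp add: std_bump_def[abs_def])
qed

lemma std_bump_continuous: "continuous_on S std_bump"
proof -
  have "continuous_on S (\<lambda>t. exp_bump 1 (1 + t))" "continuous_on S (\<lambda>t. exp_bump 1 (1 - t))"
    by (auto intro!: continuous_on_compose2[OF exp_bump_continuous[of UNIV]] continuous_intros)
  then show ?thesis
    unfolding std_bump_def[abs_def] by (rule continuous_on_mult)
qed

lemma std_step_left:
  assumes "t \<le> -1" shows "std_step t = 0"
proof -
  have "std_step t = integral {-1..t} (\<lambda>_. 0)"
    unfolding std_step_def by (intro integral_cong std_bump_outside) (use assms in auto)
  then show ?thesis by simp
qed

text \<open>Freedom in the base point puts \<open>t\<close> into the interior of the interval of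
  integration, so the fundamental theorem gives a two-sided derivative also for
  \<open>t \<le> -1\<close>.\<close>

lemma std_step_alt:
  assumes a: "a \<le> -1" "a \<le> t"
  shows "std_step t = integral {a..t} std_bump"
proof -
  have z: "integral {a..s} std_bump = 0" if "s \<le> -1" for s
  proof -
    have "integral {a..s} std_bump = integral {a..s} (\<lambda>_. 0)"
      by (intro integral_cong std_bump_outside) (use that in auto)
    then show ?thesis by simp
  qed
  show ?thesis
  proof (cases "t \<le> -1")
    case True then show ?thesis by (simp add: z std_step_left)
  next
    case False
    then have "integral {a..-1} std_bump + integral {-1..t} std_bump = integral {a..t} std_bump"
      using a by (intro Henstock_Kurzweil_Integration.integral_combine integrable_continuous_real std_bump_continuous) auto
    then show ?thesis by (simp add: z std_step_def)
  qed
qed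

lemma std_step_derivative: "(std_step has_real_derivative std_bump t) (at t)"
proof -
  define a where "a = min (-1) t - 1"
  have "((\<lambda>u. integral {a..u} std_bump) has_real_derivative std_bump t) (at t within {a..t + 1})"
    by (rule integral_has_real_derivative[OF std_bump_continuous]) (auto simp: a_def)
  then have "((\<lambda>u. integral {a..u} std_bump) has_real_derivative std_bump t) (at t)"
    by (simp add: a_def at_within_Icc_at)
  then show ?thesis
    by (rule has_field_derivative_transform_within_open[of _ _ _ "{a<..}"])
      (auto simp: a_def intro: std_step_alt[symmetric])
qed

lemma std_step_right:
  assumes "1 \<le> t" shows "std_step t = std_step 1"
proof -
  have "integral {-1..1} std_bump + integral {1..t} std_bump = integral {-1..t} std_bump"
    using assms by (intro Henstock_Kurzweil_Integration.integral_combine integrable_continuous_real std_bump_continuous) auto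
  moreover have "integral {1..t} std_bump = integral {1..t} (\<lambda>_. 0)"
    by (intro integral_cong std_bump_outside) auto
  ultimately show ?thesis by (simp add: std_step_def)
qed

lemma std_step_1_pos: "0 < std_step 1"
proof -
  have "0 \<le> std_step 1"
    unfolding std_step_def
    by (rule Henstock_Kurzweil_Integration.integral_nonneg[OF integrable_continuous_real[OF std_bump_continuous] std_bump_nonneg])
  moreover have "std_step 1 \<noteq> 0"
  proof
    assume "std_step 1 = 0"
    then have "integral {-1..1} std_bump = 0" by (simp only: std_step_def)
    then have *: "\<forall>x\<in>{-1..1}. std_bump x = 0"
      using integral_eq_0_iff[of "-1" 1 std_bump, OF std_bump_continuous _ std_bump_nonneg] by simp
    have "std_bump 0 = 0" by (rule bspec[OF *]) simp
    then show False using std_bump_pos[of 0] by simp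
  qed
  ultimately show ?thesis by (rule order_neq_le_trans[OF not_sym, rotated])
qed

lemma scaled_step_derivative:
  assumes "0 < r"
  shows "((\<lambda>t. std_step ((t - a) / r)) has_real_derivative std_bump ((t - a) / r) / r) (at t within S)"
proof -
  have "((\<lambda>t. (t - a) / r) has_real_derivative 1 / r) (at t)"
    using assms by (auto intro!: derivative_eq_intros)
  from has_field_derivative_at_within[OF DERIV_chain2[OF std_step_derivative this]] show ?thesis
    by (simp only: mult_1_right times_divide_eq_right)
qed

text \<open>Outside \<open>[a - r, b + r]\<close> the two steps agree, which gives compact support,
  while the derivative is a difference of two mollifiers. This is the only kind of test function
  that \<open>du_Bois_Reymond\<close> uses.\<close>

lemma test_function_step_difference:
  assumes ab: "a \<le> b" "0 < r" "0 < a - r" "b + r < T"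
  defines "\<phi> \<equiv> \<lambda>t. std_step ((t - a) / r) - std_step ((t - b) / r)"
  shows "test_function T \<phi>"
    and "deriv \<phi> t = std_bump ((t - a) / r) / r - std_bump ((t - b) / r) / r"
proof -
  show "deriv \<phi> t = std_bump ((t - a) / r) / r - std_bump ((t - b) / r) / r"
    unfolding \<phi>_def
    by (rule DERIV_imp_deriv[OF DERIV_diff[OF scaled_step_derivative scaled_step_derivative]]) (rule ab)+
  have st: "bump_generated std_step"
    by (rule bump_generated.antiderivative[OF std_bump_generated std_step_derivative])
  have "bump_generated (\<lambda>t. std_step (- a / r + (1 / r) * t) + (-1) * std_step (- b / r + (1 / r) * t))"
    by (rule bump_generated.add[OF bump_generated.affine[OF st]
          bump_generated.mult[OF bump_generated.const bump_generated.affine[OF st]]])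
  moreover have "(\<lambda>t. std_step (- a / r + (1 / r) * t) + (-1) * std_step (- b / r + (1 / r) * t)) = \<phi>"
    unfolding \<phi>_def by (intro ext) (simp add: diff_divide_distrib)
  ultimately have "bump_generated \<phi>" by (simp only:)
  then have sm: "\<forall>k t. ((deriv ^^ k) \<phi>) field_differentiable (at t)"
    using bump_generated_smooth by blast
  have "\<phi> t = 0" if "t < a - r \<or> b + r < t" for t
  proof (cases "t < a - r")
    case True
    then have "(t - a) / r \<le> -1" "(t - b) / r \<le> -1" using ab by (simp_all add: pos_divide_le_eq)
    then show ?thesis by (simp add: \<phi>_def std_step_left)
  next
    case False
    then have h: "1 \<le> (t - a) / r" "1 \<le> (t - b) / r" using ab that by (simp_all add: pos_le_divide_eq)
    show ?thesis by (simp only: \<phi>_def std_step_right[OF h(1)] std_step_right[OF h(2)] diff_self)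
  qed
  then have "{t. \<phi> t \<noteq> 0} \<subseteq> {a - r..b + r}"
    by (auto simp flip: not_less)
  then have "closure {t. \<phi> t \<noteq> 0} \<subseteq> {a - r..b + r}" by (rule closure_minimal) simp
  also have "\<dots> \<subseteq> {0<..<T}" using ab by auto
  finally show "test_function T \<phi>" unfolding test_function_def by (rule conjI[OF sm])
qed

text \<open>\<open>std_bump ((t - a) / r) / r\<close> is an approximate identity of mass
  \<open>std_step 1\<close> in the window of radius \<open>r\<close>; the error is the weighted
  integral of \<open>y t - y a\<close>, at most \<open>e\<close> in norm there.\<close>

lemma mollifier_estimate:
  fixes y :: "real \<Rightarrow> 'a::euclidean_space"
  assumes y: "continuous_on {0..T} y" and r: "0 < r" "0 < a - r" "a + r < T"
    and e: "\<And>t. \<bar>t - a\<bar> \<le> r \<Longrightarrow> norm (y t - y a) \<le> e"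
  shows "norm (integral {0..T} (\<lambda>t. (std_bump ((t - a) / r) / r) *\<^sub>R y t) - std_step 1 *\<^sub>R y a)
    \<le> std_step 1 * e"
proof -
  let ?\<theta> = "\<lambda>t. std_bump ((t - a) / r) / r"
  have c: "continuous_on {0..T} ?\<theta>"
    using r by (intro continuous_intros continuous_on_compose2[OF std_bump_continuous[of UNIV]]) auto
  have "(?\<theta> has_integral (std_step ((T - a) / r) - std_step ((0 - a) / r))) {0..T}"
    by (rule fundamental_theorem_of_calculus, use r in linarith)
      (rule scaled_step_derivative[OF r(1), unfolded has_real_derivative_iff_has_vector_derivative])
  moreover have "std_step ((T - a) / r) = std_step 1" "std_step ((0 - a) / r) = 0"
    by (rule std_step_right, use r in \<open>simp add: pos_le_divide_eq\<close>)
      (rule std_step_left, use r in \<open>simp add: pos_divide_le_eq\<close>)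
  ultimately have \<theta>: "(?\<theta> has_integral std_step 1) {0..T}" by simp
  have i1: "(\<lambda>t. ?\<theta> t *\<^sub>R (y t - y a)) integrable_on {0..T}"
    by (intro integrable_continuous_real continuous_intros c y)
  have "norm (integral {0..T} (\<lambda>t. ?\<theta> t *\<^sub>R (y t - y a))) \<le> integral {0..T} (\<lambda>t. ?\<theta> t * e)"
  proof (rule Henstock_Kurzweil_Integration.integral_norm_bound_integral[OF i1])
    show "(\<lambda>t. ?\<theta> t * e) integrable_on {0..T}"
      by (intro integrable_continuous_real continuous_intros c)
    fix t assume "t \<in> {0..T}"
    show "norm (?\<theta> t *\<^sub>R (y t - y a)) \<le> ?\<theta> t * e"
    proof (cases "\<bar>t - a\<bar> \<le> r")
      case True
      then show ?thesis
        using e r std_bump_nonneg[of "(t - a) / r"] by (simp add: divide_right_mono mult_left_mono)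
    next
      case False
      then have "std_bump ((t - a) / r) = 0"
        using r by (intro std_bump_outside) (simp add: field_simps)
      then show ?thesis by simp
    qed
  qed
  also have "\<dots> = std_step 1 * e"
    using has_integral_mult_left[OF \<theta>, of e] by (rule integral_unique)
  also have "integral {0..T} (\<lambda>t. ?\<theta> t *\<^sub>R (y t - y a))
      = integral {0..T} (\<lambda>t. ?\<theta> t *\<^sub>R y t) - std_step 1 *\<^sub>R y a"
  proof -
    have "(\<lambda>t. ?\<theta> t *\<^sub>R y t) integrable_on {0..T}"
      by (intro integrable_continuous_real continuous_intros c y)
    then have "((\<lambda>t. ?\<theta> t *\<^sub>R y t) has_integral integral {0..T} (\<lambda>t. ?\<theta> t *\<^sub>R y t)) {0..T}"
      by (rule integrable_integral)
    moreover have "((\<lambda>t. ?\<theta> t *\<^sub>R y a) has_integral std_step 1 *\<^sub>R y a) {0..T}"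
      using has_integral_linear[OF \<theta> bounded_linear_scaleR_left[of "y a"]] by (simp add: o_def)
    ultimately have "((\<lambda>t. ?\<theta> t *\<^sub>R y t - ?\<theta> t *\<^sub>R y a) has_integral
        integral {0..T} (\<lambda>t. ?\<theta> t *\<^sub>R y t) - std_step 1 *\<^sub>R y a) {0..T}"
      by (rule has_integral_diff)
    then show ?thesis by (intro integral_unique) (simp add: scaleR_diff_right)
  qed
  finally show ?thesis .
qed

text \<open>A test function that steps up at \<open>a\<close> and down at \<open>b\<close> shows
  that the mollified values of \<open>y\<close> at \<open>a\<close> and \<open>b\<close> coincide.
  Small radii force \<open>y a = y b\<close> in the open interval, and continuity reaches the
  endpoints.\<close>

lemma du_Bois_Reymond:
  fixes y :: "real \<Rightarrow> 'a::euclidean_space"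
  assumes T: "0 < T" and y: "continuous_on {0..T} y"
    and test: "\<And>\<phi>. test_function T \<phi> \<Longrightarrow> integral {0..T} (\<lambda>t. deriv \<phi> t *\<^sub>R y t) = 0"
    and t: "t \<in> {0..T}"
  shows "y t = y 0"
proof -
  have eq: "y a = y b" if ab: "0 < a" "a \<le> b" "b < T" for a b
  proof (rule ccontr)
    assume ne: "y a \<noteq> y b"
    \<comment> \<open>With a third of the distance the two mollification errors add up to less than
      the distance.\<close>
    define e where "e = norm (y a - y b) / 3"
    have e: "0 < e" using ne by (simp add: e_def)
    have loc: "\<exists>r>0. \<forall>t. \<bar>t - s\<bar> \<le> r \<longrightarrow> norm (y t - y s) \<le> e" if s: "0 < s" "s < T" for s
    proof -
      have "isCont y s"
        using y s by (simp add: continuous_on_interior)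
      then obtain d where "0 < d" "\<And>t. \<bar>t - s\<bar> < d \<Longrightarrow> norm (y t - y s) < e"
        using e unfolding continuous_at_eps_delta by (auto simp: dist_norm)
      then show ?thesis by (intro exI[of _ "d / 2"]) (auto intro: less_imp_le)
    qed
    obtain r1 where r1: "0 < r1" "\<And>t. \<bar>t - a\<bar> \<le> r1 \<Longrightarrow> norm (y t - y a) \<le> e"
      using loc[of a] ab by auto
    obtain r2 where r2: "0 < r2" "\<And>t. \<bar>t - b\<bar> \<le> r2 \<Longrightarrow> norm (y t - y b) \<le> e"
      using loc[of b] ab by auto
    \<comment> \<open>Small enough for both local estimates and for both windows to stay inside the
      open interval.\<close>
    define r where "r = min (min r1 r2) (min (a / 2) ((T - b) / 2))"
    have "r \<le> a / 2" "r \<le> (T - b) / 2" "r \<le> r1" "r \<le> r2"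
      unfolding r_def by linarith+
    moreover have "0 < r" using r1(1) r2(1) ab by (simp add: r_def)
    ultimately have r: "0 < r" "r \<le> r1" "r \<le> r2" "0 < a - r" "b + r < T"
      using ab by auto
    define \<theta> where "\<theta> = (\<lambda>s t. std_bump ((t - s) / r) / r)"
    have c: "continuous_on {0..T} (\<theta> s)" for s
      unfolding \<theta>_def
      using r by (intro continuous_intros continuous_on_compose2[OF std_bump_continuous[of UNIV]]) auto
    let ?\<phi> = "\<lambda>t. std_step ((t - a) / r) - std_step ((t - b) / r)"
    have "integral {0..T} (\<lambda>t. (\<theta> a t - \<theta> b t) *\<^sub>R y t) = 0"
      using test[of ?\<phi>] test_function_step_difference[of a b r T] r ab by (simp add: \<theta>_def)
    moreover have "integral {0..T} (\<lambda>t. (\<theta> a t - \<theta> b t) *\<^sub>R y t)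
        = integral {0..T} (\<lambda>t. \<theta> a t *\<^sub>R y t) - integral {0..T} (\<lambda>t. \<theta> b t *\<^sub>R y t)"
      unfolding scaleR_diff_left
      by (intro Henstock_Kurzweil_Integration.integral_diff integrable_continuous_real continuous_intros c y)
    ultimately have I: "integral {0..T} (\<lambda>t. \<theta> a t *\<^sub>R y t) = integral {0..T} (\<lambda>t. \<theta> b t *\<^sub>R y t)"
      by simp
    have "norm (integral {0..T} (\<lambda>t. \<theta> a t *\<^sub>R y t) - std_step 1 *\<^sub>R y a) \<le> std_step 1 * e"
      unfolding \<theta>_def using r ab r1 by (intro mollifier_estimate y) auto
    moreover have "norm (integral {0..T} (\<lambda>t. \<theta> b t *\<^sub>R y t) - std_step 1 *\<^sub>R y b) \<le> std_step 1 * e"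
      unfolding \<theta>_def using r ab r2 by (intro mollifier_estimate y) auto
    moreover have "norm (std_step 1 *\<^sub>R y a - std_step 1 *\<^sub>R y b)
        \<le> norm (integral {0..T} (\<lambda>t. \<theta> b t *\<^sub>R y t) - std_step 1 *\<^sub>R y b)
          + norm (integral {0..T} (\<lambda>t. \<theta> b t *\<^sub>R y t) - std_step 1 *\<^sub>R y a)"
      using norm_triangle_ineq4[of "integral {0..T} (\<lambda>t. \<theta> b t *\<^sub>R y t) - std_step 1 *\<^sub>R y b"
          "integral {0..T} (\<lambda>t. \<theta> b t *\<^sub>R y t) - std_step 1 *\<^sub>R y a"]
      by simp
    ultimately have "norm (std_step 1 *\<^sub>R y a - std_step 1 *\<^sub>R y b) \<le> std_step 1 * e + std_step 1 * e"
      unfolding I by linarith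
    then have "std_step 1 * norm (y a - y b) \<le> std_step 1 * (2 * e)"
      using std_step_1_pos by (simp flip: scaleR_diff_right)
    then have "norm (y a - y b) \<le> 2 * e"
      using std_step_1_pos by simp
    then show False using e by (simp add: e_def)
  qed
  have mid: "y s = y (T / 2)" if "s \<in> {0<..<T}" for s
  proof (cases "s \<le> T / 2")
    case True then show ?thesis using eq[of s "T / 2"] that T by simp
  next
    case False then show ?thesis using eq[of "T / 2" s] that T by simp
  qed
  have "y s = y (T / 2)" if "s \<in> {0..T}" for s
    by (rule continuous_constant_on_closure[of "{0<..<T}", OF _ mid]) (use y that T in auto)
  from this[of t] this[of 0] show ?thesis using t T by simp
qed

section \<open>Square integrable functions\<close>

abbreviation lebesgue_interval :: "real \<Rightarrow> real measure" where
  "lebesgue_interval T \<equiv> lebesgue_on {0<..<T}"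

lemma finite_measure_interval: "finite_measure (lebesgue_interval T)"
  by (intro finite_measure_lebesgue_on) simp

lemma integrable_interval_const: "integrable (lebesgue_interval T) (\<lambda>_. c :: 'a::{banach, second_countable_topology})"
  by (rule finite_measure.integrable_const[OF finite_measure_interval])

lemma L2_spaceD:
  assumes "x \<in> L2_space T"
  shows "x \<in> borel_measurable (lebesgue_interval T)"
    and "integrable (lebesgue_interval T) (\<lambda>t. (norm (x t))\<^sup>2)"
  using assms by (auto simp: L2_space_def)

lemma L2_integrable:
  assumes "x \<in> L2_space T"
  shows "integrable (lebesgue_interval T) x"
proof (rule Bochner_Integration.integrable_bound)
  show "integrable (lebesgue_interval T) (\<lambda>t. 1 + (norm (x t))\<^sup>2)"
    by (intro Bochner_Integration.integrable_add integrable_interval_const L2_spaceD assms)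
  have "s \<le> 1 + s\<^sup>2" for s :: real
  proof -
    have "2 * s \<le> 1 + s\<^sup>2" using zero_le_power2[of "s - 1"] by (simp add: power2_diff)
    then show ?thesis using zero_le_power2[of s] by linarith
  qed
  then show "AE t in lebesgue_interval T. norm (x t) \<le> norm (1 + (norm (x t))\<^sup>2)"
    by simp
qed (rule L2_spaceD[OF assms])

lemma L2_bounded_by:
  fixes x :: "real \<Rightarrow> real^'n" and w :: "real \<Rightarrow> real"
  assumes "x \<in> borel_measurable (lebesgue_interval T)"
    and "integrable (lebesgue_interval T) w" "\<And>t. (norm (x t))\<^sup>2 \<le> w t"
  shows "x \<in> L2_space T"
proof -
  have "integrable (lebesgue_interval T) (\<lambda>t. (norm (x t))\<^sup>2)"
    by (rule Bochner_Integration.integrable_bound[OF assms(2)])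
      (use assms in \<open>auto intro: order_trans[OF _ abs_ge_self]\<close>)
  then show ?thesis using assms(1) by (simp add: L2_space_def)
qed

lemma norm_add_square_le: "(norm (a + b))\<^sup>2 \<le> 2 * (norm a)\<^sup>2 + 2 * (norm (b :: 'a::real_inner))\<^sup>2"
  using zero_le_power2[of "norm (a - b)"]
  unfolding power2_norm_eq_inner by (simp add: inner_add inner_diff inner_commute)

lemma L2_add:
  assumes "x \<in> L2_space T" "y \<in> L2_space T"
  shows "(\<lambda>t. x t + y t) \<in> L2_space T"
proof (rule L2_bounded_by)
  show "(\<lambda>t. x t + y t) \<in> borel_measurable (lebesgue_interval T)"
    by (intro borel_measurable_add L2_spaceD assms)
  show "integrable (lebesgue_interval T) (\<lambda>t. 2 * (norm (x t))\<^sup>2 + 2 * (norm (y t))\<^sup>2)"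
    by (intro Bochner_Integration.integrable_add integrable_mult_right L2_spaceD assms)
  show "(norm (x t + y t))\<^sup>2 \<le> 2 * (norm (x t))\<^sup>2 + 2 * (norm (y t))\<^sup>2" for t
    by (rule norm_add_square_le)
qed

lemma L2_matrix_mult:
  fixes N :: "real^'n^'m"
  assumes "x \<in> L2_space T" shows "(\<lambda>t. N *v x t) \<in> L2_space T"
proof -
  obtain c where c: "\<And>v. norm (N *v v) \<le> norm v * c"
    using bounded_linear.bounded[OF matrix_vector_mul_bounded_linear[of N]] by auto
  show ?thesis
  proof (rule L2_bounded_by[of _ _ "\<lambda>t. (norm (x t))\<^sup>2 * c\<^sup>2"])
    show "(\<lambda>t. N *v x t) \<in> borel_measurable (lebesgue_interval T)"
      by (rule borel_measurable_continuous_on[OF matrix_vector_mult_linear_continuous_on L2_spaceD(1)[OF assms]])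
    show "integrable (lebesgue_interval T) (\<lambda>t. (norm (x t))\<^sup>2 * c\<^sup>2)"
      using L2_spaceD(2)[OF assms] by simp
    show "(norm (N *v x t))\<^sup>2 \<le> (norm (x t))\<^sup>2 * c\<^sup>2" for t
      using power_mono[OF c[of "x t"], of 2] by (simp add: power_mult_distrib)
  qed
qed

lemma L2_scaleR:
  assumes "x \<in> L2_space T" shows "(\<lambda>t. c *\<^sub>R x t) \<in> L2_space T"
proof (rule L2_bounded_by)
  show "(\<lambda>t. c *\<^sub>R x t) \<in> borel_measurable (lebesgue_interval T)"
    by (intro borel_measurable_scaleR borel_measurable_const L2_spaceD assms)
  show "integrable (lebesgue_interval T) (\<lambda>t. c\<^sup>2 * (norm (x t))\<^sup>2)"
    by (intro integrable_mult_right L2_spaceD assms)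
  show "(norm (c *\<^sub>R x t))\<^sup>2 \<le> c\<^sup>2 * (norm (x t))\<^sup>2" for t
    by (simp add: power_mult_distrib)
qed

lemma L2_diff:
  assumes "x \<in> L2_space T" "y \<in> L2_space T"
  shows "(\<lambda>t. x t - y t) \<in> L2_space T"
  using L2_add[OF assms(1) L2_scaleR[OF assms(2), of "-1"]] by simp

lemma continuous_measurable_interval:
  fixes x :: "real \<Rightarrow> 'a::euclidean_space"
  assumes "continuous_on {0..T} x"
  shows "x \<in> borel_measurable (lebesgue_interval T)"
  by (rule continuous_imp_measurable_on_sets_lebesgue[OF continuous_on_subset[OF assms]]) auto

lemma continuous_bounded_interval:
  fixes x :: "real \<Rightarrow> 'a::euclidean_space"
  assumes "continuous_on {0..T} x"
  obtains b where "\<And>t. t \<in> {0..T} \<Longrightarrow> norm (x t) \<le> b"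
proof -
  have "bounded (x ` {0..T})"
    by (rule compact_imp_bounded[OF compact_continuous_image[OF assms compact_Icc]])
  then show thesis using that unfolding bounded_iff by blast
qed

lemma continuous_integrable_interval:
  fixes x :: "real \<Rightarrow> 'a::euclidean_space"
  assumes "continuous_on {0..T} x"
  shows "integrable (lebesgue_interval T) x"
proof -
  obtain b where b: "\<And>t. t \<in> {0..T} \<Longrightarrow> norm (x t) \<le> b"
    using continuous_bounded_interval[OF assms] by blast
  show ?thesis
  proof (rule Bochner_Integration.integrable_bound[OF integrable_interval_const[of T b]
        continuous_measurable_interval[OF assms] AE_I2])
    fix t assume "t \<in> space (lebesgue_interval T)"
    then have "norm (x t) \<le> b" using b by simp
    then show "norm (x t) \<le> norm b" by simp
  qed
qed

lemma L2_continuous: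
  assumes "continuous_on {0..T} x" shows "x \<in> L2_space T"
  unfolding L2_space_def
  by (intro CollectI conjI continuous_measurable_interval continuous_integrable_interval
      continuous_on_power continuous_on_norm assms)

text \<open>Bridge between the Bochner integral over the open interval, in which the function spaces
  are stated, and the gauge integral over closed intervals, in which the fundamental theorem is
  stated.\<close>

lemma interval_integrable_on:
  fixes v :: "real \<Rightarrow> 'a::euclidean_space"
  assumes "integrable (lebesgue_interval T) v"
  shows "v integrable_on {0..T}"
    and "integral {0..T} v = (\<integral>t. v t \<partial>lebesgue_interval T)"
  using integrable_on_lebesgue_on[OF assms] lebesgue_integral_eq_integral[OF assms]
  by (simp_all add: integrable_on_Icc_iff_Ioo integral_open_interval_real)

text \<open>Cutting off inside the integrand keeps one fixed measure space, as Fubini's theorem and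
  the norm bounds on partial intervals require.\<close>

lemma integral_indicator_interval:
  fixes v :: "real \<Rightarrow> 'a::euclidean_space"
  assumes v: "integrable (lebesgue_interval T) v" and S: "S \<in> sets borel"
  shows "integrable (lebesgue_interval T) (\<lambda>s. if s \<in> S then v s else 0)"
    and "(\<integral>s. (if s \<in> S then v s else 0) \<partial>lebesgue_interval T) = integral (S \<inter> {0<..<T}) v"
proof -
  show i: "integrable (lebesgue_interval T) (\<lambda>s. if s \<in> S then v s else 0)"
  proof (rule Bochner_Integration.integrable_bound[OF v])
    have "S \<in> sets lebesgue" using S by simp
    then have "indicat_real S \<in> borel_measurable (lebesgue_interval T)"
      by (intro measurable_restrict_space1 borel_measurable_indicator)
    then have "(\<lambda>s. indicat_real S s *\<^sub>R v s) \<in> borel_measurable (lebesgue_interval T)"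
      by (rule borel_measurable_scaleR) (rule borel_measurable_integrable[OF v])
    then show "(\<lambda>s. if s \<in> S then v s else 0) \<in> borel_measurable (lebesgue_interval T)"
      by (simp add: indicator_scaleR_eq_if)
  qed auto
  show "(\<integral>s. (if s \<in> S then v s else 0) \<partial>lebesgue_interval T) = integral (S \<inter> {0<..<T}) v"
    using lebesgue_integral_eq_integral[OF i] by (simp add: Henstock_Kurzweil_Integration.integral_restrict_Int)
qed

lemma continuous_indefinite_integral:
  fixes v :: "real \<Rightarrow> 'a::euclidean_space"
  assumes "integrable (lebesgue_interval T) v"
  shows "continuous_on {0..T} (\<lambda>t. a + integral {0..t} v)"
  by (intro continuous_intros indefinite_integral_continuous_1 interval_integrable_on assms)

section \<open>Sobolev functions as indefinite integrals\<close>

lemma test_function_derivative: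
  assumes "test_function T \<phi>"
  shows "(\<phi> has_real_derivative deriv \<phi> t) (at t)" and "continuous_on S (deriv \<phi>)"
proof -
  have d: "((deriv ^^ k) \<phi>) field_differentiable (at t)" for k t
    using assms unfolding test_function_def by blast
  show "(\<phi> has_real_derivative deriv \<phi> t) (at t)"
    using d[of 0 t] by (simp only: DERIV_deriv_iff_field_differentiable funpow_0)
  have "isCont (deriv \<phi>) t" for t
    using field_differentiable_imp_continuous_at[OF d[of 1 t]] by simp
  then show "continuous_on S (deriv \<phi>)"
    by (simp add: continuous_at_imp_continuous_on)
qed

lemma test_function_vanishes:
  assumes "test_function T \<phi>" "t \<le> 0 \<or> T \<le> t"
  shows "\<phi> t = 0"
proof (rule ccontr)
  assume "\<phi> t \<noteq> 0"
  then have "t \<in> closure {t. \<phi> t \<noteq> 0}" by (intro subsetD[OF closure_subset] CollectI)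
  then have "t \<in> {0<..<T}" 
    using assms(1) unfolding test_function_def by (meson subsetD)
  then show False using assms(2) by auto
qed

lemma test_function_derivative_integral:
  assumes "test_function T \<phi>" "s \<le> T"
  shows "(deriv \<phi> has_integral - \<phi> s) {s..T}"
proof -
  have "(deriv \<phi> has_integral \<phi> T - \<phi> s) {s..T}"
    by (intro fundamental_theorem_of_calculus assms)
      (rule has_field_derivative_at_within[OF test_function_derivative(1)[OF assms(1)],
          unfolded has_real_derivative_iff_has_vector_derivative])
  then show ?thesis using test_function_vanishes[OF assms(1), of T] by simp
qed

text \<open>Fubini's theorem on the triangle \<open>s < t\<close>.\<close>

lemma integral_deriv_test_function:
  fixes v :: "real \<Rightarrow> 'a::euclidean_space"
  assumes T: "0 < T" and v: "integrable (lebesgue_interval T) v" and \<phi>: "test_function T \<phi>"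
  shows "(\<integral>t. deriv \<phi> t *\<^sub>R (a + integral {0..t} v) \<partial>lebesgue_interval T) =
    - (\<integral>t. \<phi> t *\<^sub>R v t \<partial>lebesgue_interval T)"
proof -
  let ?L = "lebesgue_interval T"
  interpret L: finite_measure ?L by (rule finite_measure_interval)
  interpret LL: pair_sigma_finite ?L ?L ..
  have sp: "space ?L = {0<..<T}" by simp
  have dm: "deriv \<phi> \<in> borel_measurable ?L"
    by (intro continuous_measurable_interval test_function_derivative[OF \<phi>])
  have vm: "v \<in> borel_measurable ?L" using v by (rule borel_measurable_integrable)
  have idm: "(\<lambda>t. t) \<in> borel_measurable ?L"
    by (intro continuous_measurable_interval continuous_intros)
  obtain b where b: "\<And>t. t \<in> {0..T} \<Longrightarrow> norm (deriv \<phi> t) \<le> b"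
    using continuous_bounded_interval[OF test_function_derivative(2)[OF \<phi>]] by blast
  \<comment> \<open>The triangle encoded on the square: integrating in \<open>s\<close> first
    produces the primitive of \<open>v\<close>, integrating in \<open>t\<close> first produces
    \<open>- \<phi> s\<close>.\<close>
  define h where "h = (\<lambda>(s, t). if s < t then deriv \<phi> t *\<^sub>R v s else 0)"
  have hm: "h \<in> borel_measurable (?L \<Otimes>\<^sub>M ?L)"
    unfolding h_def using dm vm idm by measurable
  \<comment> \<open>A dominating function for \<open>h\<close>, since \<open>deriv \<phi>\<close> is
    bounded by \<open>b\<close>; it depends on one variable only, so its integrability follows from
    that of \<open>v\<close>.\<close>
  have iv: "integrable (?L \<Otimes>\<^sub>M ?L) (\<lambda>x. b *\<^sub>R v (fst x))"
  proof (rule LL.Fubini_integrable)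
    show "(\<lambda>x. b *\<^sub>R v (fst x)) \<in> borel_measurable (?L \<Otimes>\<^sub>M ?L)" using vm by measurable
    show "integrable ?L (\<lambda>x. \<integral>y. norm (b *\<^sub>R v (fst (x, y))) \<partial>?L)"
      using v by simp
  qed (simp add: integrable_interval_const)
  have hi: "integrable (?L \<Otimes>\<^sub>M ?L) h"
  proof (rule Bochner_Integration.integrable_bound[OF iv hm AE_I2])
    fix x assume "x \<in> space (?L \<Otimes>\<^sub>M ?L)"
    then have "snd x \<in> {0..T}" by (auto simp: space_pair_measure)
    then have "norm (deriv \<phi> (snd x)) \<le> \<bar>b\<bar>" using b by force
    then show "norm (h x) \<le> norm (b *\<^sub>R v (fst x))"
      by (auto simp: h_def split: prod.split intro!: mult_right_mono)
  qed
  have inner1: "(\<integral>s. h (s, t) \<partial>?L) = deriv \<phi> t *\<^sub>R integral {0..t} v" if t: "t \<in> space ?L" for t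
  proof -
    have "(\<integral>s. h (s, t) \<partial>?L) = (\<integral>s. deriv \<phi> t *\<^sub>R (if s \<in> {..<t} then v s else 0) \<partial>?L)"
      by (intro Bochner_Integration.integral_cong) (auto simp: h_def)
    also have "\<dots> = deriv \<phi> t *\<^sub>R integral ({..<t} \<inter> {0<..<T}) v"
      using integral_indicator_interval[OF v, of "{..<t}"] by simp
    also have "{..<t} \<inter> {0<..<T} = {0<..<t}" using t by auto
    finally show ?thesis by (simp add: integral_open_interval_real)
  qed
  have inner2: "(\<integral>t. h (s, t) \<partial>?L) = - (\<phi> s *\<^sub>R v s)" if s: "s \<in> space ?L" for s
  proof -
    have di: "integrable ?L (deriv \<phi>)"
      by (intro continuous_integrable_interval test_function_derivative[OF \<phi>])
    have "(\<integral>t. h (s, t) \<partial>?L) = (\<integral>t. (if t \<in> {s<..} then deriv \<phi> t else 0) *\<^sub>R v s \<partial>?L)"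
      by (intro Bochner_Integration.integral_cong) (auto simp: h_def)
    also have "\<dots> = integral ({s<..} \<inter> {0<..<T}) (deriv \<phi>) *\<^sub>R v s"
      using integral_indicator_interval[OF di, of "{s<..}"] by simp
    also have "{s<..} \<inter> {0<..<T} = {s<..<T}" using s by auto
    also have "integral {s<..<T} (deriv \<phi>) = - \<phi> s"
      using test_function_derivative_integral[OF \<phi>, of s] s
      by (simp add: integral_open_interval_real[symmetric] integral_unique)
    finally show ?thesis by simp
  qed
  have "(\<integral>t. deriv \<phi> t *\<^sub>R integral {0..t} v \<partial>?L) = (\<integral>t. \<integral>s. h (s, t) \<partial>?L \<partial>?L)"
    by (intro Bochner_Integration.integral_cong refl) (simp only: inner1)
  also have "\<dots> = (\<integral>s. \<integral>t. h (s, t) \<partial>?L \<partial>?L)"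
    using LL.Fubini_integral[of "\<lambda>s t. h (s, t)"] hi by simp
  also have "\<dots> = (\<integral>s. - (\<phi> s *\<^sub>R v s) \<partial>?L)"
    by (intro Bochner_Integration.integral_cong refl) (simp only: inner2)
  finally have main: "(\<integral>t. deriv \<phi> t *\<^sub>R integral {0..t} v \<partial>?L) = - (\<integral>s. \<phi> s *\<^sub>R v s \<partial>?L)"
    by simp
  have cv: "continuous_on {0..T} (\<lambda>t. integral {0..t} v)"
    using continuous_indefinite_integral[OF v, of 0] by simp
  have "(\<integral>t. deriv \<phi> t *\<^sub>R (a + integral {0..t} v) \<partial>?L)
      = (\<integral>t. deriv \<phi> t *\<^sub>R a \<partial>?L) + (\<integral>t. deriv \<phi> t *\<^sub>R integral {0..t} v \<partial>?L)"
    unfolding scaleR_add_right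
    by (intro Bochner_Integration.integral_add continuous_integrable_interval continuous_intros
        test_function_derivative[OF \<phi>] cv)
  also have "(\<integral>t. deriv \<phi> t *\<^sub>R a \<partial>?L) = integral {0..T} (\<lambda>t. deriv \<phi> t *\<^sub>R a)"
    by (intro interval_integrable_on(2)[symmetric] continuous_integrable_interval continuous_intros
        test_function_derivative[OF \<phi>])
  also have "\<dots> = - \<phi> 0 *\<^sub>R a"
    using has_integral_linear[OF test_function_derivative_integral[OF \<phi>, of 0] bounded_linear_scaleR_left[of a]] T
    by (intro integral_unique) (simp add: o_def)
  \<comment> \<open>The constant \<open>a\<close> drops out because test functions vanish at
    0.\<close>
  also have "\<phi> 0 = 0" using test_function_vanishes[OF \<phi>, of 0] by simp
  finally show ?thesis using main by simp
qed

text \<open>In the forward direction \<open>x\<close> minus the primitive of \<open>v\<close> is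
  continuous with weak derivative 0, hence constant by \<open>du_Bois_Reymond\<close>. The converse
  is Fubini's theorem in the form of \<open>integral_deriv_test_function\<close>.\<close>

theorem has_weak_derivative_iff:
  assumes T: "0 < T" and x: "continuous_on {0..T} x" and v: "integrable (lebesgue_interval T) v"
  shows "has_weak_derivative T x v \<longleftrightarrow> (\<forall>t\<in>{0..T}. x t = x 0 + integral {0..t} v)"
proof
  assume R: "\<forall>t\<in>{0..T}. x t = x 0 + integral {0..t} v"
  show "has_weak_derivative T x v"
    unfolding has_weak_derivative_def
  proof (intro allI impI)
    fix \<phi> assume \<phi>: "test_function T \<phi>"
    have "(\<integral>t. deriv \<phi> t *\<^sub>R x t \<partial>lebesgue_interval T)
        = (\<integral>t. deriv \<phi> t *\<^sub>R (x 0 + integral {0..t} v) \<partial>lebesgue_interval T)"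
    proof (rule Bochner_Integration.integral_cong[OF refl])
      fix t assume "t \<in> space (lebesgue_interval T)"
      then have "t \<in> {0..T}" by simp
      then have "x t = x 0 + integral {0..t} v" using R by blast
      then show "deriv \<phi> t *\<^sub>R x t = deriv \<phi> t *\<^sub>R (x 0 + integral {0..t} v)" by (rule arg_cong)
    qed
    then show "(\<integral>t. deriv \<phi> t *\<^sub>R x t \<partial>lebesgue_interval T) = - (\<integral>t. \<phi> t *\<^sub>R v t \<partial>lebesgue_interval T)"
      using integral_deriv_test_function[OF T v \<phi>] by simp
  qed
next
  assume W: "has_weak_derivative T x v"
  define y where "y = (\<lambda>t. x t - (x 0 + integral {0..t} v))"
  have yc: "continuous_on {0..T} y"
    unfolding y_def by (intro continuous_on_diff x continuous_indefinite_integral v)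
  have "y t = y 0" if "t \<in> {0..T}" for t
  proof (rule du_Bois_Reymond[OF T yc _ that])
    fix \<phi> assume \<phi>: "test_function T \<phi>"
    note d = test_function_derivative(2)[OF \<phi>]
    have "integral {0..T} (\<lambda>t. deriv \<phi> t *\<^sub>R y t) = (\<integral>t. deriv \<phi> t *\<^sub>R y t \<partial>lebesgue_interval T)"
      by (intro interval_integrable_on(2) continuous_integrable_interval continuous_intros d yc)
    also have "\<dots> = (\<integral>t. deriv \<phi> t *\<^sub>R x t \<partial>lebesgue_interval T)
        - (\<integral>t. deriv \<phi> t *\<^sub>R (x 0 + integral {0..t} v) \<partial>lebesgue_interval T)"
      unfolding y_def scaleR_diff_right
      by (intro Bochner_Integration.integral_diff continuous_integrable_interval continuous_on_scaleR d x
          continuous_indefinite_integral v)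
    also have "\<dots> = 0"
      using W \<phi> integral_deriv_test_function[OF T v \<phi>, of "x 0"] by (simp add: has_weak_derivative_def)
    finally show "integral {0..T} (\<lambda>t. deriv \<phi> t *\<^sub>R y t) = 0" .
  qed
  moreover have "y 0 = 0" by (simp add: y_def)
  ultimately have "y t = 0" if "t \<in> {0..T}" for t using that by (simp only:)
  then show "\<forall>t\<in>{0..T}. x t = x 0 + integral {0..t} v"
    unfolding y_def right_minus_eq by blast
qed

section \<open>Trajectories of the control system\<close>

text \<open>Everything in \<open>feasible\<close> except the conditions on \<open>x T\<close>, with
  the weak differential equation in integral form. Without the endpoint conditions the set of such
  pairs is convex.\<close>

definition admissible ::
    "real \<Rightarrow> real^'n^'n \<Rightarrow> real^'m^'n \<Rightarrow> real^'n^'l \<Rightarrow> real^'m^'l \<Rightarrow> (real \<Rightarrow> real^'l) \<Rightarrow> real^'n \<Rightarrow>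
     (real \<Rightarrow> real^'n) \<Rightarrow> (real \<Rightarrow> real^'m) \<Rightarrow> bool" where
  "admissible T A B C D f x0 x u \<longleftrightarrow>
     u \<in> L2_space T \<and> continuous_on {0..T} x \<and>
     (\<forall>t\<in>{0..T}. x t = x0 + integral {0..t} (\<lambda>s. A *v x s + B *v u s)) \<and>
     (AE t in lebesgue_on {0<..<T}. C *v x t + D *v u t - f t \<le> 0)"

text \<open>Solutions of the homogeneous problem: with zero initial state and
  \<open>C \<phi> + D w = 0\<close>, adding one to an admissible pair moves the endpoint and keeps
  admissibility. Continuity of \<open>w\<close> allows uniform bounds.\<close>

definition correction ::
    "real \<Rightarrow> real^'n^'n \<Rightarrow> real^'m^'n \<Rightarrow> real^'n^'l \<Rightarrow> real^'m^'l \<Rightarrow>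
     (real \<Rightarrow> real^'n) \<Rightarrow> (real \<Rightarrow> real^'m) \<Rightarrow> bool" where
  "correction T A B C D \<phi> w \<longleftrightarrow>
     continuous_on {0..T} \<phi> \<and> continuous_on {0..T} w \<and>
     (\<forall>t\<in>{0..T}. \<phi> t = integral {0..t} (\<lambda>s. A *v \<phi> s + B *v w s) \<and> C *v \<phi> t + D *v w t = 0)"

lemma dynamics_L2:
  fixes A :: "real^'n^'n" and B :: "real^'m^'n"
  assumes "continuous_on {0..T} x" "u \<in> L2_space T"
  shows "(\<lambda>s. A *v x s + B *v u s) \<in> L2_space T"
  by (intro L2_add L2_matrix_mult L2_continuous assms)

lemma dynamics_integrable_on:
  fixes A :: "real^'n^'n" and B :: "real^'m^'n"
  assumes "continuous_on {0..T} x" "u \<in> L2_space T" "t \<in> {0..T}"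
  shows "(\<lambda>s. A *v x s + B *v u s) integrable_on {0..t}"
  using integrable_on_subinterval[OF interval_integrable_on(1)[OF L2_integrable[OF dynamics_L2[OF assms(1,2)]]], of 0 t]
    assms(3) by simp

text \<open>\<open>has_weak_derivative\<close> sees \<open>v\<close> only under the integral, so
  \<open>v\<close> can be replaced by the function \<open>A x + B u\<close> to which it is equal
  almost everywhere; then \<open>has_weak_derivative_iff\<close> applies.\<close>

lemma weak_dynamics_iff:
  fixes A :: "real^'n^'n" and B :: "real^'m^'n"
  assumes T: "0 < T"
  shows "(x \<in> H1_space T \<and> u \<in> L2_space T \<and>
      (\<exists>v \<in> L2_space T. has_weak_derivative T x v \<and>
        (AE t in lebesgue_interval T. v t = A *v x t + B *v u t)) \<and> x 0 = x0) \<longleftrightarrow>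
    (u \<in> L2_space T \<and> continuous_on {0..T} x \<and>
      (\<forall>t\<in>{0..T}. x t = x0 + integral {0..t} (\<lambda>s. A *v x s + B *v u s)))" (is "?L \<longleftrightarrow> ?R")
proof
  let ?g = "\<lambda>s. A *v x s + B *v u s"
  assume L: ?L
  then obtain v where v: "v \<in> L2_space T" "has_weak_derivative T x v"
    "AE t in lebesgue_interval T. v t = ?g t" by blast
  have x: "continuous_on {0..T} x" using L unfolding H1_space_def by blast
  have g: "?g \<in> L2_space T" using L by (intro dynamics_L2 x) blast
  have "has_weak_derivative T x ?g"
    unfolding has_weak_derivative_def
  proof (intro allI impI)
    fix \<phi> assume \<phi>: "test_function T \<phi>"
    have "continuous_on {0..T} \<phi>"
      using test_function_derivative(1)[OF \<phi>] by (meson DERIV_continuous_on has_field_derivative_at_within)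
    then have \<phi>m: "\<phi> \<in> borel_measurable (lebesgue_interval T)"
      by (rule continuous_measurable_interval)
    have eq: "(\<integral>t. \<phi> t *\<^sub>R v t \<partial>lebesgue_interval T) = (\<integral>t. \<phi> t *\<^sub>R ?g t \<partial>lebesgue_interval T)"
    proof (rule integral_cong_AE)
      show "AE t in lebesgue_interval T. \<phi> t *\<^sub>R v t = \<phi> t *\<^sub>R ?g t"
        using v(3) by eventually_elim simp
    qed (intro borel_measurable_scaleR \<phi>m L2_spaceD v g)+
    show "(\<integral>t. deriv \<phi> t *\<^sub>R x t \<partial>lebesgue_interval T) = - (\<integral>t. \<phi> t *\<^sub>R ?g t \<partial>lebesgue_interval T)"
      using v(2) \<phi> unfolding has_weak_derivative_def eq[symmetric] by blast
  qed
  then show ?R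
    using has_weak_derivative_iff[OF T x L2_integrable[OF g]] L x by blast
next
  let ?g = "\<lambda>s. A *v x s + B *v u s"
  assume R: ?R
  then have x: "continuous_on {0..T} x" and g: "?g \<in> L2_space T"
    by (blast intro: dynamics_L2)+
  have x0: "x 0 = x0" using bspec[of "{0..T}" _ 0] R T by force
  have "has_weak_derivative T x ?g"
    using has_weak_derivative_iff[OF T x L2_integrable[OF g]] R unfolding x0 by blast
  then have weak: "\<exists>v \<in> L2_space T. has_weak_derivative T x v \<and>
      (AE t in lebesgue_interval T. v t = A *v x t + B *v u t)"
    using g by (intro bexI[of _ ?g]) simp_all
  then have "x \<in> H1_space T"
    unfolding H1_space_def using L2_continuous[OF x] x by blast
  with weak R x0 show ?L by blast
qed

lemma admissible_add_correction:
  assumes xu: "admissible T A B C D f x0 x u" and \<phi>w: "correction T A B C D \<phi> w"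
  shows "admissible T A B C D f x0 (\<lambda>t. x t + \<phi> t) (\<lambda>t. u t + w t)"
proof -
  have x: "continuous_on {0..T} x" "u \<in> L2_space T"
    using xu unfolding admissible_def by blast+
  have \<phi>: "continuous_on {0..T} \<phi>" "w \<in> L2_space T"
    using \<phi>w L2_continuous unfolding correction_def by blast+
  have "x t + \<phi> t = x0 + integral {0..t} (\<lambda>s. A *v (x s + \<phi> s) + B *v (u s + w s))"
    if t: "t \<in> {0..T}" for t
  proof -
    have e1: "x t = x0 + integral {0..t} (\<lambda>s. A *v x s + B *v u s)"
      using xu t unfolding admissible_def by blast
    have e2: "\<phi> t = integral {0..t} (\<lambda>s. A *v \<phi> s + B *v w s)"
      using \<phi>w t unfolding correction_def by blast
    have "x t + \<phi> t = x0 + (integral {0..t} (\<lambda>s. A *v x s + B *v u s) + integral {0..t} (\<lambda>s. A *v \<phi> s + B *v w s))"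
      by (simp only: e1 e2 add.assoc)
    also have "integral {0..t} (\<lambda>s. A *v x s + B *v u s) + integral {0..t} (\<lambda>s. A *v \<phi> s + B *v w s)
        = integral {0..t} (\<lambda>s. (A *v x s + B *v u s) + (A *v \<phi> s + B *v w s))"
      by (rule Henstock_Kurzweil_Integration.integral_add[OF dynamics_integrable_on[OF x t]
            dynamics_integrable_on[OF \<phi> t], symmetric])
    also have "(\<lambda>s. (A *v x s + B *v u s) + (A *v \<phi> s + B *v w s))
        = (\<lambda>s. A *v (x s + \<phi> s) + B *v (u s + w s))"
      by (rule ext) (simp only: matrix_vector_right_distrib ac_simps)
    finally show ?thesis .
  qed
  moreover have "AE t in lebesgue_interval T. C *v (x t + \<phi> t) + D *v (u t + w t) - f t \<le> 0"
  proof -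
    have "AE t in lebesgue_interval T. C *v x t + D *v u t - f t \<le> 0"
      using xu unfolding admissible_def by blast
    moreover have "AE t in lebesgue_interval T. t \<in> {0..T}" by (rule AE_I2) simp
    ultimately show ?thesis
    proof eventually_elim
      case (elim t)
      then have "C *v \<phi> t + D *v w t = 0" using \<phi>w unfolding correction_def by blast
      then have "C *v (x t + \<phi> t) + D *v (u t + w t) - f t = C *v x t + D *v u t - f t"
        by (simp add: matrix_vector_right_distrib algebra_simps)
      then show ?case using elim by simp
    qed
  qed
  ultimately show ?thesis
    unfolding admissible_def using x \<phi> by (intro conjI ballI L2_add continuous_on_add) auto
qed

lemma correction_linear_combination:
  fixes A :: "real^'n^'n" and B :: "real^'m^'n" and C :: "real^'n^'l" and D :: "real^'m^'l"
  assumes "finite I" and cor: "\<And>i. i \<in> I \<Longrightarrow> correction T A B C D (\<phi> i) (w i)"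
  shows "correction T A B C D (\<lambda>t. \<Sum>i\<in>I. c i *\<^sub>R \<phi> i t) (\<lambda>t. \<Sum>i\<in>I. c i *\<^sub>R w i t)"
proof -
  have \<phi>: "continuous_on {0..T} (\<phi> i)" "continuous_on {0..T} (w i)" if "i \<in> I" for i
    using cor[OF that] unfolding correction_def by blast+
  have lin: "N *v (\<Sum>i\<in>I. c i *\<^sub>R y i) = (\<Sum>i\<in>I. c i *\<^sub>R (N *v y i))" for N :: "real^'j^'k" and y
    unfolding linear_sum[OF matrix_vector_mul_linear] matrix_vector_mult_scaleR ..
  have "(\<Sum>i\<in>I. c i *\<^sub>R \<phi> i t) = integral {0..t} (\<lambda>s. A *v (\<Sum>i\<in>I. c i *\<^sub>R \<phi> i s) + B *v (\<Sum>i\<in>I. c i *\<^sub>R w i s))"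
    if t: "t \<in> {0..T}" for t
  proof -
    have "(\<Sum>i\<in>I. c i *\<^sub>R \<phi> i t) = (\<Sum>i\<in>I. integral {0..t} (\<lambda>s. c i *\<^sub>R (A *v \<phi> i s + B *v w i s)))"
      using cor t unfolding correction_def integral_cmul
      by (intro sum.cong refl arg_cong[of _ _ "scaleR _"]) blast
    also have "\<dots> = integral {0..t} (\<lambda>s. \<Sum>i\<in>I. c i *\<^sub>R (A *v \<phi> i s + B *v w i s))"
      using \<phi> L2_continuous t
      by (intro Henstock_Kurzweil_Integration.integral_sum[symmetric] assms(1) integrable_cmul dynamics_integrable_on[where T = T]) blast+
    finally show ?thesis
      by (simp add: lin scaleR_add_right sum.distrib)
  qed
  moreover have "C *v (\<Sum>i\<in>I. c i *\<^sub>R \<phi> i t) + D *v (\<Sum>i\<in>I. c i *\<^sub>R w i t) = 0" if t: "t \<in> {0..T}" for t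
  proof -
    have "C *v \<phi> i t + D *v w i t = 0" if "i \<in> I" for i
      using cor[OF that] t unfolding correction_def by blast
    then have "(\<Sum>i\<in>I. c i *\<^sub>R (C *v \<phi> i t + D *v w i t)) = 0"
      by (intro sum.neutral) simp
    then show ?thesis by (simp add: lin scaleR_add_right sum.distrib)
  qed
  ultimately show ?thesis
    unfolding correction_def using \<phi> by (intro conjI ballI continuous_on_sum continuous_on_scaleR continuous_on_const) auto
qed

section \<open>Elimination of the path constraint and steering of the endpoint\<close>

lemma full_row_rank_pseudoinverse:
  fixes D :: "real^'m^'l"
  assumes "rank D = CARD('l)"
  shows "D ** pseudoinverse D = mat 1"
proof -
  note inv = pseudoinverse_full_row_rank[OF assms]
  have "D ** transpose D ** matrix_inv (D ** transpose D) = mat 1"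
    using inv(1) unfolding invertible_def matrix_inv_def by (metis (mono_tags, lifting) someI_ex)
  then show ?thesis by (simp add: inv(2) matrix_mul_assoc)
qed

text \<open>The control is a particular solution of \<open>D u = h - C x\<close> plus an element of the kernel of \<open>D\<close>;
  only the latter remains as a free input.\<close>

lemma eliminate_constraint:
  fixes A :: "real^'n^'n" and B :: "real^'m^'n" and C :: "real^'n^'l" and D :: "real^'m^'l" and Y :: "real^'k^'m"
  assumes "rank D = CARD('l)" and "D ** Y = 0"
  defines "u \<equiv> \<lambda>x h w. pseudoinverse D *v (h - C *v x) + Y *v w"
  shows "C *v x + D *v u x h w = h"
    and "A *v x + B *v u x h w =
      (A - B ** pseudoinverse D ** C) *v x + (B *v (pseudoinverse D *v h) + (B ** Y) *v w)"
proof -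
  have "D *v (pseudoinverse D *v y) = y" for y
    by (simp add: matrix_vector_mul_assoc full_row_rank_pseudoinverse[OF assms(1)])
  moreover have "D *v (Y *v w) = 0"
    by (simp add: matrix_vector_mul_assoc assms(2))
  ultimately show "C *v x + D *v u x h w = h"
    by (simp add: u_def matrix_vector_right_distrib)
  show "A *v x + B *v u x h w =
      (A - B ** pseudoinverse D ** C) *v x + (B *v (pseudoinverse D *v h) + (B ** Y) *v w)"
    by (simp add: u_def matrix_vector_right_distrib matrix_vector_mult_diff_distrib
        matrix_vector_mult_diff_rdistrib flip: matrix_vector_mul_assoc)
qed

lemma integral_of_vector_derivative:
  fixes \<phi> :: "real \<Rightarrow> 'a::euclidean_space"
  assumes "\<And>t. t \<in> {0..T} \<Longrightarrow> (\<phi> has_vector_derivative \<phi>' t) (at t within {0..T})" and t: "t \<in> {0..T}"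
  shows "\<phi> t = \<phi> 0 + integral {0..t} \<phi>'"
proof -
  have "(\<phi>' has_integral \<phi> t - \<phi> 0) {0..t}"
  proof (rule fundamental_theorem_of_calculus)
    show "0 \<le> t" using t by simp
    fix s assume s: "s \<in> {0..t}"
    show "(\<phi> has_vector_derivative \<phi>' s) (at s within {0..t})"
    proof (rule has_vector_derivative_within_subset[OF assms(1)])
      show "s \<in> {0..T}" "{0..t} \<subseteq> {0..T}" using s t by auto
    qed
  qed
  then show ?thesis by (simp add: integral_unique)
qed

text \<open>With \<open>h = 0\<close> the feedback of \<open>eliminate_constraint\<close> turns the
  constrained system into the free system of the pair \<open>A - B ** pseudoinverse D ** C\<close>,
  \<open>B ** Y\<close>, which the rank condition makes controllable.\<close>

lemma correction_exists:
  fixes A :: "real^'n^'n" and B :: "real^'m^'n" and C :: "real^'n^'l" and D :: "real^'m^'l" and Y :: "real^'k^'m"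
  assumes T: "0 < T" and D: "rank D = CARD('l)" "D ** Y = 0"
    and R: "rank (krylov_matrix (A - B ** pseudoinverse D ** C) (B ** Y)) = CARD('n)"
  shows "\<exists>\<phi> w. correction T A B C D \<phi> w \<and> \<phi> T = z"
proof -
  let ?N = "A - B ** pseudoinverse D ** C"
  obtain \<phi> w where w: "continuous_on {0..T} w" and \<phi>0: "\<phi> 0 = 0" and \<phi>T: "\<phi> T = z"
    and \<phi>: "\<And>t. t \<in> {0..T} \<Longrightarrow> (\<phi> has_vector_derivative ?N *v \<phi> t + (B ** Y) *v w t) (at t within {0..T})"
    using controllability[OF T R, of z] by blast
  define u where "u = (\<lambda>t. pseudoinverse D *v (0 - C *v \<phi> t) + Y *v w t)"
  have \<phi>c: "continuous_on {0..T} \<phi>"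
    unfolding continuous_on_eq_continuous_within by (blast intro: has_vector_derivative_continuous \<phi>)
  note bl = bounded_linear.continuous_on[OF matrix_vector_mul_bounded_linear]
  have uc: "continuous_on {0..T} u"
    unfolding u_def by (intro continuous_on_add bl continuous_on_diff continuous_on_const \<phi>c w)
  have dyn: "A *v \<phi> t + B *v u t = ?N *v \<phi> t + (B ** Y) *v w t" for t
    unfolding u_def eliminate_constraint(2)[OF D, where C = C] by simp
  have "\<phi> t = integral {0..t} (\<lambda>s. A *v \<phi> s + B *v u s)" if "t \<in> {0..T}" for t
    using integral_of_vector_derivative[OF \<phi> that] \<phi>0 unfolding dyn by simp
  moreover have "C *v \<phi> t + D *v u t = 0" for t
    unfolding u_def by (rule eliminate_constraint(1)[OF D])
  ultimately have "correction T A B C D \<phi> u"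
    unfolding correction_def using \<phi>c uc by blast
  with \<phi>T show ?thesis by blast
qed

lemma norm_linear_combination_le:
  fixes z :: "real^'n" and y :: "'n \<Rightarrow> 'c::real_normed_vector"
  assumes "\<And>i. norm (y i) \<le> b i"
  shows "norm (\<Sum>i\<in>UNIV. z $ i *\<^sub>R y i) \<le> (\<Sum>i\<in>UNIV. b i) * norm z"
proof -
  have "norm (\<Sum>i\<in>UNIV. z $ i *\<^sub>R y i) \<le> (\<Sum>i\<in>UNIV. \<bar>z $ i\<bar> * norm (y i))"
    using norm_sum[of "\<lambda>i. z $ i *\<^sub>R y i" UNIV] by simp
  also have "\<dots> \<le> (\<Sum>i\<in>UNIV. norm z * b i)"
    by (intro sum_mono mult_mono assms component_le_norm_cart) auto
  finally show ?thesis by (simp add: sum_distrib_left mult.commute)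
qed

text \<open>Corrections towards the unit vectors are fixed once and combined with coefficients
  \<open>z $ i\<close>; linearity in \<open>z\<close> yields one constant for all targets.\<close>

lemma correction_exists_bounded:
  fixes A :: "real^'n^'n" and B :: "real^'m^'n" and C :: "real^'n^'l" and D :: "real^'m^'l" and Y :: "real^'k^'m"
  assumes T: "0 < T" and D: "rank D = CARD('l)" "D ** Y = 0"
    and R: "rank (krylov_matrix (A - B ** pseudoinverse D ** C) (B ** Y)) = CARD('n)"
  shows "\<exists>c. \<forall>z. \<exists>\<phi> w. correction T A B C D \<phi> w \<and> \<phi> T = z \<and>
    (\<forall>t\<in>{0..T}. norm (\<phi> t) \<le> c * norm z \<and> norm (w t) \<le> c * norm z)"
proof -
  have "\<forall>i. \<exists>\<phi> w. correction T A B C D \<phi> w \<and> \<phi> T = axis i 1"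
    using correction_exists[OF T D R] by blast
  then obtain \<Phi> W where cor: "\<And>i. correction T A B C D (\<Phi> i) (W i)" and end': "\<And>i. \<Phi> i T = axis i 1"
    by metis
  have "\<exists>b. \<forall>t\<in>{0..T}. norm (\<Phi> i t) \<le> b \<and> norm (W i t) \<le> b" for i
  proof -
    have c: "continuous_on {0..T} (\<Phi> i)" "continuous_on {0..T} (W i)"
      using cor[of i] unfolding correction_def by blast+
    obtain b1 where "\<And>t. t \<in> {0..T} \<Longrightarrow> norm (\<Phi> i t) \<le> b1"
      using continuous_bounded_interval[OF c(1)] by blast
    moreover obtain b2 where "\<And>t. t \<in> {0..T} \<Longrightarrow> norm (W i t) \<le> b2"
      using continuous_bounded_interval[OF c(2)] by blast
    ultimately show ?thesis by (intro exI[of _ "max b1 b2"]) (simp add: le_max_iff_disj)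
  qed
  then obtain b where b: "\<And>i t. t \<in> {0..T} \<Longrightarrow> norm (\<Phi> i t) \<le> b i" "\<And>i t. t \<in> {0..T} \<Longrightarrow> norm (W i t) \<le> b i"
    by metis
  show ?thesis
  proof (intro exI[of _ "\<Sum>i\<in>UNIV. b i"] allI)
    fix z :: "real^'n"
    let ?\<phi> = "\<lambda>t. \<Sum>i\<in>UNIV. z $ i *\<^sub>R \<Phi> i t" and ?w = "\<lambda>t. \<Sum>i\<in>UNIV. z $ i *\<^sub>R W i t"
    have "correction T A B C D ?\<phi> ?w"
      by (rule correction_linear_combination) (auto intro: cor)
    moreover have "?\<phi> T = z"
      using basis_expansion[of z] by (simp add: end' scalar_mult_eq_scaleR)
    moreover have "\<forall>t\<in>{0..T}. norm (?\<phi> t) \<le> (\<Sum>i\<in>UNIV. b i) * norm z \<and> norm (?w t) \<le> (\<Sum>i\<in>UNIV. b i) * norm z"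
      by (intro ballI conjI norm_linear_combination_le b)
    ultimately show "\<exists>\<phi> w. correction T A B C D \<phi> w \<and> \<phi> T = z \<and>
      (\<forall>t\<in>{0..T}. norm (\<phi> t) \<le> (\<Sum>i\<in>UNIV. b i) * norm z \<and> norm (w t) \<le> (\<Sum>i\<in>UNIV. b i) * norm z)"
      by blast
  qed
qed

text \<open>A trajectory with \<open>C x + D u = f\<close> is constructed without regard to its
  endpoint, which a correction then moves to \<open>z\<close>.\<close>

lemma admissible_exists:
  fixes A :: "real^'n^'n" and B :: "real^'m^'n" and C :: "real^'n^'l" and D :: "real^'m^'l" and Y :: "real^'k^'m"
  assumes T: "0 < T" and D: "rank D = CARD('l)" "D ** Y = 0"
    and R: "rank (krylov_matrix (A - B ** pseudoinverse D ** C) (B ** Y)) = CARD('n)"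
    and f: "f \<in> L2_space T"
  shows "\<exists>x u. admissible T A B C D f x0 x u \<and> x T = z"
proof -
  let ?N = "A - B ** pseudoinverse D ** C"
  define h where "h = (\<lambda>t. B *v (pseudoinverse D *v f t))"
  have hL: "h \<in> L2_space T" unfolding h_def by (intro L2_matrix_mult f)
  \<comment> \<open>The forcing \<open>h\<close> is only square integrable. Subtracting its
    primitive \<open>\<eta>\<close> leaves an equation for \<open>c = x - \<eta>\<close> with the
    continuous forcing \<open>?N *v \<eta> t\<close>, to which \<open>linear_ode_solution\<close>
    applies.\<close>
  define \<eta> where "\<eta> = (\<lambda>t. integral {0..t} h)"
  have \<eta>c: "continuous_on {0..T} \<eta>"
    using continuous_indefinite_integral[OF L2_integrable[OF hL], of 0] by (simp add: \<eta>_def)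
  note bl = bounded_linear.continuous_on[OF matrix_vector_mul_bounded_linear]
  have kc: "continuous_on {0..T} (\<lambda>t. ?N *v \<eta> t)" by (intro bl \<eta>c)
  obtain c where c: "\<And>t. t \<in> {0..T} \<Longrightarrow> (c has_vector_derivative ?N *v c t + ?N *v \<eta> t) (at t within {0..T})"
    and c0: "c 0 = x0"
    using linear_ode_solution[OF kc, where N = ?N and a = x0] by blast
  have cc: "continuous_on {0..T} c"
    unfolding continuous_on_eq_continuous_within by (blast intro: has_vector_derivative_continuous c)
  define x where "x = (\<lambda>t. c t + \<eta> t)"
  \<comment> \<open>The zero input \<open>Y *v 0\<close> gives \<open>u\<close> the form required by
    \<open>eliminate_constraint\<close>.\<close>
  define u where "u = (\<lambda>t. pseudoinverse D *v (f t - C *v x t) + Y *v 0)"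
  have xc: "continuous_on {0..T} x" unfolding x_def by (intro continuous_on_add cc \<eta>c)
  have uL: "u \<in> L2_space T"
    unfolding u_def matrix_vector_mult_0_right add_0_right
    by (intro L2_matrix_mult L2_diff L2_continuous bl xc f)
  have dyn: "A *v x t + B *v u t = (?N *v c t + ?N *v \<eta> t) + h t" for t
    unfolding u_def eliminate_constraint(2)[OF D, where C = C] by (simp add: x_def h_def matrix_vector_right_distrib)
  have "x t = x0 + integral {0..t} (\<lambda>s. A *v x s + B *v u s)" if t: "t \<in> {0..T}" for t
  proof -
    have "(\<lambda>s. ?N *v c s + ?N *v \<eta> s) integrable_on {0..t}"
    proof (rule integrable_continuous_real[OF continuous_on_subset])
      show "continuous_on {0..T} (\<lambda>s. ?N *v c s + ?N *v \<eta> s)"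
        by (intro continuous_on_add bl cc \<eta>c)
    qed (use t in simp)
    moreover have "h integrable_on {0..t}"
      using integrable_on_subinterval[OF interval_integrable_on(1)[OF L2_integrable[OF hL]], of 0 t] t by simp
    ultimately have "integral {0..t} (\<lambda>s. A *v x s + B *v u s)
        = integral {0..t} (\<lambda>s. ?N *v c s + ?N *v \<eta> s) + \<eta> t"
      unfolding dyn \<eta>_def by (rule Henstock_Kurzweil_Integration.integral_add)
    then show ?thesis
      using integral_of_vector_derivative[OF c t] c0 by (simp add: x_def)
  qed
  moreover have "C *v x t + D *v u t = f t" for t
    unfolding u_def by (rule eliminate_constraint(1)[OF D])
  ultimately have adm: "admissible T A B C D f x0 x u"
    unfolding admissible_def using xc uL by simp
  obtain \<phi> w where cor: "correction T A B C D \<phi> w" and \<phi>T: "\<phi> T = z - x T"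
    using correction_exists[OF T D R] by blast
  show ?thesis
    by (intro exI conjI, rule admissible_add_correction[OF adm cor]) (simp add: \<phi>T)
qed

section \<open>Completeness and energy estimates\<close>

abbreviation L2_sq :: "real \<Rightarrow> (real \<Rightarrow> real^'n) \<Rightarrow> real" where
  "L2_sq T x \<equiv> \<integral>t. (norm (x t))\<^sup>2 \<partial>lebesgue_interval T"

lemma L2_norm_square: "(L2_norm T x)\<^sup>2 = L2_sq T x"
  unfolding L2_norm_def by (rule real_sqrt_pow2) (simp add: Bochner_Integration.integral_nonneg)

lemma L2_sq_nonneg: "0 \<le> L2_sq T x"
  by (simp add: Bochner_Integration.integral_nonneg)

text \<open>Cauchy-Schwarz as nonnegativity of a variance: \<open>a / T\<close> is the mean of
  \<open>norm (x t)\<close> over the interval.\<close>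

lemma L1_square_le_L2:
  assumes T: "0 < T" and x: "x \<in> L2_space T"
  shows "(\<integral>t. norm (x t) \<partial>lebesgue_interval T)\<^sup>2 \<le> T * L2_sq T x"
proof -
  let ?L = "lebesgue_interval T"
  define a where "a = (\<integral>t. norm (x t) \<partial>?L)"
  have i1: "integrable ?L (\<lambda>t. norm (x t))" by (rule integrable_norm[OF L2_integrable[OF x]])
  have i2: "integrable ?L (\<lambda>t. (norm (x t))\<^sup>2)" by (rule L2_spaceD(2)[OF x])
  have c: "(\<integral>t. c \<partial>?L) = T * c" for c :: real
    using T by (simp add: measure_restrict_space)
  have "0 \<le> (\<integral>t. (norm (x t) - a / T)\<^sup>2 \<partial>?L)"
    by (simp add: Bochner_Integration.integral_nonneg)
  also have "(\<lambda>t. (norm (x t) - a / T)\<^sup>2) = (\<lambda>t. ((norm (x t))\<^sup>2 - (2 * (a / T)) * norm (x t)) + (a / T)\<^sup>2)"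
    by (rule ext) (simp add: power2_diff)
  also have "(\<integral>t. ((norm (x t))\<^sup>2 - (2 * (a / T)) * norm (x t)) + (a / T)\<^sup>2 \<partial>?L)
      = (L2_sq T x - (2 * (a / T)) * a) + T * (a / T)\<^sup>2"
    by (subst Bochner_Integration.integral_add, intro Bochner_Integration.integrable_diff i2 integrable_mult_right i1,
        rule integrable_interval_const, subst Bochner_Integration.integral_diff,
        rule i2, intro integrable_mult_right i1) (simp only: c a_def integral_mult_right_zero)
  finally have "T * 0 \<le> T * ((L2_sq T x - (2 * (a / T)) * a) + T * (a / T)\<^sup>2)"
    using T by (intro mult_left_mono) auto
  also have "\<dots> = T * L2_sq T x - a\<^sup>2"
    using T by (simp add: field_simps power2_eq_square)
  finally show ?thesis by (simp add: a_def)
qed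

lemma norm_integral_le_L2:
  fixes x :: "real \<Rightarrow> real^'n"
  assumes T: "0 < T" and x: "x \<in> L2_space T" and t: "t \<in> {0..T}"
  shows "(norm (integral {0..t} x))\<^sup>2 \<le> T * L2_sq T x"
proof -
  have xi: "integrable (lebesgue_interval T) x" by (rule L2_integrable[OF x])
  have S: "{..<t} \<inter> {0<..<T} = {0<..<t}" using t by auto
  have "integral {0..t} x = (\<integral>s. (if s \<in> {..<t} then x s else 0) \<partial>lebesgue_interval T)"
    using integral_indicator_interval(2)[OF xi, of "{..<t}"] by (simp add: S integral_open_interval_real)
  also have "norm \<dots> \<le> (\<integral>s. norm (x s) \<partial>lebesgue_interval T)"
    by (rule Bochner_Integration.integral_norm_bound_integral[OF integral_indicator_interval(1)[OF xi]
          integrable_norm[OF xi]]) auto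
  finally have "(norm (integral {0..t} x))\<^sup>2 \<le> (\<integral>s. norm (x s) \<partial>lebesgue_interval T)\<^sup>2"
    by (rule power_mono) simp
  also have "\<dots> \<le> T * L2_sq T x" by (rule L1_square_le_L2[OF T x])
  finally show ?thesis .
qed

text \<open>Riesz-Fischer. On a finite interval an L2 Cauchy sequence is L1 Cauchy, which yields a
  subsequence converging almost everywhere; Fatou's lemma then gives L2 convergence of the full
  sequence. The subsequence is returned as well, for the constraints that are pointwise in
  time.\<close>

lemma L2_complete:
  fixes w :: "nat \<Rightarrow> real \<Rightarrow> real^'n"
  assumes T: "0 < T" and w: "\<And>k. w k \<in> L2_space T"
    and cauchy: "\<And>e. 0 < e \<Longrightarrow> \<exists>N. \<forall>i\<ge>N. \<forall>j\<ge>N. L2_sq T (\<lambda>t. w i t - w j t) < e"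
  obtains v r where "v \<in> L2_space T" "(\<lambda>k. L2_sq T (\<lambda>t. w k t - v t)) \<longlonglongrightarrow> 0"
    "strict_mono r" "AE t in lebesgue_interval T. (\<lambda>k. w (r k) t) \<longlonglongrightarrow> v t"
proof -
  let ?L = "lebesgue_interval T"
  have L1: "\<exists>N. \<forall>i\<ge>N. \<forall>j\<ge>N. (\<integral>t. norm (w i t - w j t) \<partial>?L) < e" if e: "0 < e" for e
  proof -
    have "0 < e\<^sup>2 / T" using e T by simp
    then obtain N where N: "\<And>i j. i \<ge> N \<Longrightarrow> j \<ge> N \<Longrightarrow> L2_sq T (\<lambda>t. w i t - w j t) < e\<^sup>2 / T"
      using cauchy by blast
    have "(\<integral>t. norm (w i t - w j t) \<partial>?L) < e" if "i \<ge> N" "j \<ge> N" for i j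
    proof -
      have "(\<integral>t. norm (w i t - w j t) \<partial>?L)\<^sup>2 \<le> T * L2_sq T (\<lambda>t. w i t - w j t)"
        by (rule L1_square_le_L2[OF T L2_diff[OF w w]])
      also have "\<dots> < e\<^sup>2" using N[OF that] T by (simp add: field_simps)
      finally show ?thesis using e by (simp add: power2_less_imp_less)
    qed
    then show ?thesis by blast
  qed
  obtain r where r: "strict_mono r" and rc: "AE t in ?L. Cauchy (\<lambda>k. w (r k) t)"
    by (rule cauchy_L1_AE_cauchy_subseq[where s = w and M = ?L]) (use L2_integrable[OF w] L1 in blast)+
  \<comment> \<open>Where the subsequence diverges, \<open>lim\<close> is an arbitrary value; this
    concerns a null set only.\<close>
  define v where "v = (\<lambda>t. lim (\<lambda>k. w (r k) t))"
  have conv: "AE t in ?L. (\<lambda>k. w (r k) t) \<longlonglongrightarrow> v t"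
    using rc by eventually_elim (simp add: v_def Cauchy_convergent_iff convergent_LIMSEQ_iff)
  have wm: "w k \<in> borel_measurable ?L" for k by (rule L2_spaceD(1)[OF w])
  have vm: "v \<in> borel_measurable ?L"
    unfolding v_def by (rule borel_measurable_lim_metric) (rule wm)
  have dm: "(\<lambda>t. ennreal ((norm (w k t - y t))\<^sup>2)) \<in> borel_measurable ?L" if "y \<in> borel_measurable ?L" for k y
    using wm[of k] that by measurable
  \<comment> \<open>Fatou's lemma in the index \<open>i\<close> of the subsequence, with
    \<open>k\<close> fixed. The nonnegative integral is used because integrability of the squared
    difference is not yet known.\<close>
  have fatou: "\<exists>N. \<forall>k\<ge>N. (\<integral>\<^sup>+t. ennreal ((norm (w k t - v t))\<^sup>2) \<partial>?L) \<le> ennreal e" if e: "0 < e" for e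
  proof -
    obtain N where N: "\<And>i j. i \<ge> N \<Longrightarrow> j \<ge> N \<Longrightarrow> L2_sq T (\<lambda>t. w i t - w j t) < e"
      using cauchy[OF e] by blast
    have "(\<integral>\<^sup>+t. ennreal ((norm (w k t - v t))\<^sup>2) \<partial>?L) \<le> ennreal e" if k: "k \<ge> N" for k
    proof -
      have "(\<integral>\<^sup>+t. ennreal ((norm (w k t - v t))\<^sup>2) \<partial>?L)
          = (\<integral>\<^sup>+t. liminf (\<lambda>i. ennreal ((norm (w k t - w (r i) t))\<^sup>2)) \<partial>?L)"
      proof (rule nn_integral_cong_AE)
        show "AE t in ?L. ennreal ((norm (w k t - v t))\<^sup>2) = liminf (\<lambda>i. ennreal ((norm (w k t - w (r i) t))\<^sup>2))"
          using conv
        proof eventually_elim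
          case (elim t)
          then have "(\<lambda>i. ennreal ((norm (w k t - w (r i) t))\<^sup>2)) \<longlonglongrightarrow> ennreal ((norm (w k t - v t))\<^sup>2)"
            by (intro tendsto_ennrealI tendsto_power tendsto_norm tendsto_diff tendsto_const)
          then show ?case by (rule lim_imp_Liminf[OF sequentially_bot, symmetric])
        qed
      qed
      also have "\<dots> \<le> liminf (\<lambda>i. \<integral>\<^sup>+t. ennreal ((norm (w k t - w (r i) t))\<^sup>2) \<partial>?L)"
        by (rule nn_integral_liminf) (rule dm[OF wm])
      also have "\<dots> \<le> ennreal e"
      proof (rule Liminf_le)
        have "(\<integral>\<^sup>+t. ennreal ((norm (w k t - w (r i) t))\<^sup>2) \<partial>?L) \<le> ennreal e" if "i \<ge> N" for i
        proof -
          have "r i \<ge> N" using seq_suble[OF r, of i] that by linarith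
          then have "L2_sq T (\<lambda>t. w k t - w (r i) t) \<le> e" using N[OF k] by (simp add: less_imp_le)
          moreover have "(\<integral>\<^sup>+t. ennreal ((norm (w k t - w (r i) t))\<^sup>2) \<partial>?L) = ennreal (L2_sq T (\<lambda>t. w k t - w (r i) t))"
            by (rule nn_integral_eq_integral[OF L2_spaceD(2)[OF L2_diff[OF w w]]]) simp
          ultimately show ?thesis by (simp add: ennreal_leI)
        qed
        then show "\<forall>\<^sub>F i in sequentially. (\<integral>\<^sup>+t. ennreal ((norm (w k t - w (r i) t))\<^sup>2) \<partial>?L) \<le> ennreal e"
          unfolding eventually_sequentially by blast
      qed simp
      finally show ?thesis .
    qed
    then show ?thesis by blast
  qed
  have diff_L2: "(\<lambda>t. w k t - v t) \<in> L2_space T"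
    if "(\<integral>\<^sup>+t. ennreal ((norm (w k t - v t))\<^sup>2) \<partial>?L) \<le> ennreal e" for k e
  proof -
    have m: "(\<lambda>t. w k t - v t) \<in> borel_measurable ?L" using wm vm by (rule borel_measurable_diff)
    have "integrable ?L (\<lambda>t. (norm (w k t - v t))\<^sup>2)"
    proof (rule integrableI_nonneg)
      show "(\<lambda>t. (norm (w k t - v t))\<^sup>2) \<in> borel_measurable ?L" using m by measurable
      show "(\<integral>\<^sup>+t. ennreal ((norm (w k t - v t))\<^sup>2) \<partial>?L) < \<infinity>"
        using that ennreal_less_top[of e] by (simp add: order_le_less_trans)
    qed simp
    then show ?thesis using m by (simp add: L2_space_def)
  qed
  obtain N1 where "(\<integral>\<^sup>+t. ennreal ((norm (w N1 t - v t))\<^sup>2) \<partial>?L) \<le> ennreal 1"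
    using fatou[of 1] by auto
  then have "(\<lambda>t. w N1 t - (w N1 t - v t)) \<in> L2_space T"
    by (intro L2_diff w diff_L2)
  then have v: "v \<in> L2_space T" by simp
  have "(\<lambda>k. L2_sq T (\<lambda>t. w k t - v t)) \<longlonglongrightarrow> 0"
  proof (rule LIMSEQ_I)
    fix e :: real assume "0 < e"
    then obtain N where N: "\<forall>k\<ge>N. (\<integral>\<^sup>+t. ennreal ((norm (w k t - v t))\<^sup>2) \<partial>?L) \<le> ennreal (e / 2)"
      using fatou[of "e / 2"] by auto
    have "norm (L2_sq T (\<lambda>t. w k t - v t) - 0) < e" if "k \<ge> N" for k
    proof -
      have "ennreal (L2_sq T (\<lambda>t. w k t - v t)) = (\<integral>\<^sup>+t. ennreal ((norm (w k t - v t))\<^sup>2) \<partial>?L)"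
        by (rule nn_integral_eq_integral[OF L2_spaceD(2)[OF L2_diff[OF w v]], symmetric]) simp
      also have "\<dots> \<le> ennreal (e / 2)" using N that by blast
      finally have "L2_sq T (\<lambda>t. w k t - v t) \<le> e / 2" using \<open>0 < e\<close> by (simp add: ennreal_le_iff)
      moreover have "0 \<le> L2_sq T (\<lambda>t. w k t - v t)" by (rule L2_sq_nonneg)
      ultimately show ?thesis using \<open>0 < e\<close> by simp
    qed
    then show "\<exists>N. \<forall>k\<ge>N. norm (L2_sq T (\<lambda>t. w k t - v t) - 0) < e" by blast
  qed
  with v r conv show thesis by (intro that)
qed

text \<open>The quadratic part of the objective in shifted variables; applied to the difference of
  two pairs it measures their squared distance.\<close>

definition energy :: "real \<Rightarrow> real \<Rightarrow> (real \<Rightarrow> real^'n) \<Rightarrow> (real \<Rightarrow> real^'m) \<Rightarrow> real" where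
  "energy T \<delta> h k = 1/2 * L2_sq T h + \<delta>/2 * L2_sq T k"

lemma energy_nonneg: "0 \<le> \<delta> \<Longrightarrow> 0 \<le> energy T \<delta> h k"
  unfolding energy_def by (intro add_nonneg_nonneg mult_nonneg_nonneg L2_sq_nonneg) auto

text \<open>Expansion of the square of \<open>s *\<^sub>R a - b\<close>. The free weight
  \<open>s\<close> brings the factor of the main term arbitrarily close to 1, at the price of a
  large factor on the perturbation.\<close>

lemma norm_add_square_Young:
  fixes a b :: "'a::real_inner"
  assumes s: "0 < s"
  shows "(norm (a + b))\<^sup>2 \<le> (1 + s) * (norm a)\<^sup>2 + (1 + 1 / s) * (norm b)\<^sup>2"
proof -
  have "0 \<le> (1 / s) * (norm (s *\<^sub>R a - b))\<^sup>2" using s by simp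
  also have "\<dots> = s * (norm a)\<^sup>2 - 2 * (a \<bullet> b) + (1 / s) * (norm b)\<^sup>2"
    using s unfolding power2_norm_eq_inner
    by (simp add: inner_diff inner_commute field_simps)
  finally show ?thesis
    unfolding power2_norm_eq_inner by (simp add: inner_add inner_commute algebra_simps)
qed

lemma L2_sq_add_le:
  assumes "0 < s" "x \<in> L2_space T" "y \<in> L2_space T"
  shows "L2_sq T (\<lambda>t. x t + y t) \<le> (1 + s) * L2_sq T x + (1 + 1 / s) * L2_sq T y"
proof -
  have "L2_sq T (\<lambda>t. x t + y t) \<le> (\<integral>t. (1 + s) * (norm (x t))\<^sup>2 + (1 + 1 / s) * (norm (y t))\<^sup>2 \<partial>lebesgue_interval T)"
    by (intro Bochner_Integration.integral_mono Bochner_Integration.integrable_add integrable_mult_right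
        L2_spaceD(2) L2_add assms norm_add_square_Young)
  also have "\<dots> = (1 + s) * L2_sq T x + (1 + 1 / s) * L2_sq T y"
    by (subst Bochner_Integration.integral_add)
      (intro integrable_mult_right L2_spaceD(2) assms | simp only: integral_mult_right_zero)+
  finally show ?thesis .
qed

lemma energy_add_le:
  assumes "0 < s" "0 \<le> \<delta>" "x \<in> L2_space T" "y \<in> L2_space T" "u \<in> L2_space T" "w \<in> L2_space T"
  shows "energy T \<delta> (\<lambda>t. x t + y t) (\<lambda>t. u t + w t) \<le> (1 + s) * energy T \<delta> x u + (1 + 1 / s) * energy T \<delta> y w"
proof -
  have "1/2 * L2_sq T (\<lambda>t. x t + y t) \<le> 1/2 * ((1 + s) * L2_sq T x + (1 + 1 / s) * L2_sq T y)"
    by (intro mult_left_mono L2_sq_add_le assms) simp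
  moreover have "\<delta>/2 * L2_sq T (\<lambda>t. u t + w t) \<le> \<delta>/2 * ((1 + s) * L2_sq T u + (1 + 1 / s) * L2_sq T w)"
    by (intro mult_left_mono L2_sq_add_le assms) (use assms in simp)
  ultimately have "energy T \<delta> (\<lambda>t. x t + y t) (\<lambda>t. u t + w t) \<le> 1/2 * ((1 + s) * L2_sq T x + (1 + 1 / s) * L2_sq T y)
      + \<delta>/2 * ((1 + s) * L2_sq T u + (1 + 1 / s) * L2_sq T w)"
    unfolding energy_def by (rule add_mono)
  also have "\<dots> = (1 + s) * energy T \<delta> x u + (1 + 1 / s) * energy T \<delta> y w"
    unfolding energy_def by (simp only: distrib_left distrib_right mult_ac add_ac)
  finally show ?thesis .
qed

lemma L2_sq_parallelogram:
  assumes "x \<in> L2_space T" "y \<in> L2_space T"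
  shows "L2_sq T (\<lambda>t. (1/2) *\<^sub>R (x t + y t)) = 1/2 * L2_sq T x + 1/2 * L2_sq T y - 1/4 * L2_sq T (\<lambda>t. x t - y t)"
proof -
  have *: "(norm ((1/2) *\<^sub>R (a + b)))\<^sup>2 = 1/2 * (norm a)\<^sup>2 + 1/2 * (norm b)\<^sup>2 - 1/4 * (norm (a - b))\<^sup>2"
    for a b :: "real^'a"
    unfolding power2_norm_eq_inner by (simp add: inner_add inner_diff inner_commute field_simps)
  note i = L2_spaceD(2)[OF assms(1)] L2_spaceD(2)[OF assms(2)] L2_spaceD(2)[OF L2_diff[OF assms]]
  show ?thesis
    unfolding *
    by (subst Bochner_Integration.integral_diff, intro Bochner_Integration.integrable_add integrable_mult_right i,
        intro integrable_mult_right i, subst Bochner_Integration.integral_add,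
        (intro integrable_mult_right i)+) (simp only: integral_mult_right_zero)
qed

lemma energy_parallelogram:
  assumes "x \<in> L2_space T" "y \<in> L2_space T" "u \<in> L2_space T" "w \<in> L2_space T"
  shows "energy T \<delta> (\<lambda>t. (1/2) *\<^sub>R (x t + y t)) (\<lambda>t. (1/2) *\<^sub>R (u t + w t)) =
    1/2 * energy T \<delta> x u + 1/2 * energy T \<delta> y w - 1/4 * energy T \<delta> (\<lambda>t. x t - y t) (\<lambda>t. u t - w t)"
  unfolding energy_def L2_sq_parallelogram[OF assms(1,2)] L2_sq_parallelogram[OF assms(3,4)]
  by (simp add: algebra_simps)

text \<open>A weight \<open>s\<close> with \<open>s * R' \<le> e / 2\<close> is fixed first; the
  large factor \<open>1 + 1 / s\<close> that it causes is then absorbed by the limit.\<close>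

lemma energy_continuous_dependence:
  assumes \<delta>: "0 \<le> \<delta>" and bd: "\<forall>\<^sub>F k in sequentially. energy T \<delta> (x k) (u k) \<le> R"
    and lim: "(\<lambda>k. energy T \<delta> (y k) (w k)) \<longlonglongrightarrow> 0"
    and L2: "\<And>k. x k \<in> L2_space T" "\<And>k. y k \<in> L2_space T" "\<And>k. u k \<in> L2_space T" "\<And>k. w k \<in> L2_space T"
    and e: "0 < e"
  shows "\<forall>\<^sub>F k in sequentially.
    energy T \<delta> (\<lambda>t. x k t + y k t) (\<lambda>t. u k t + w k t) \<le> energy T \<delta> (x k) (u k) + e"
proof -
  \<comment> \<open>Truncation at 0 keeps the denominator in \<open>s\<close> positive whatever the
    sign of \<open>R\<close>.\<close>
  define R' where "R' = max R 0"
  have R: "0 \<le> R'" "R \<le> R'" by (simp_all add: R'_def)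
  define s where "s = e / (2 * (R' + 1))"
  have s: "0 < s" using e R by (simp add: s_def)
  have sR: "s * R' \<le> e / 2" using e R by (simp add: s_def field_simps)
  have "(\<lambda>k. (1 + 1 / s) * energy T \<delta> (y k) (w k)) \<longlonglongrightarrow> (1 + 1 / s) * 0"
    by (intro tendsto_mult tendsto_const lim)
  then have "\<forall>\<^sub>F k in sequentially. (1 + 1 / s) * energy T \<delta> (y k) (w k) < e / 2"
    by (rule order_tendstoD(2)) (use e in simp)
  then show ?thesis
    using bd
  proof eventually_elim
    case (elim k)
    have "energy T \<delta> (\<lambda>t. x k t + y k t) (\<lambda>t. u k t + w k t)
        \<le> (1 + s) * energy T \<delta> (x k) (u k) + (1 + 1 / s) * energy T \<delta> (y k) (w k)"
      by (rule energy_add_le[OF s \<delta> L2])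
    moreover have "s * energy T \<delta> (x k) (u k) \<le> s * R'"
      using s elim(2) R(2) by (intro mult_left_mono) auto
    moreover have "(1 + s) * energy T \<delta> (x k) (u k) = energy T \<delta> (x k) (u k) + s * energy T \<delta> (x k) (u k)"
      by (simp add: distrib_right)
    ultimately show ?case using elim sR by linarith
  qed
qed

lemma L2_sq_le_sup:
  assumes "0 < T" and "\<And>t. t \<in> {0..T} \<Longrightarrow> norm (x t) \<le> b" and "x \<in> L2_space T"
  shows "L2_sq T x \<le> T * b\<^sup>2"
proof -
  have "L2_sq T x \<le> (\<integral>t. b\<^sup>2 \<partial>lebesgue_interval T)"
  proof (rule Bochner_Integration.integral_mono[OF L2_spaceD(2)[OF assms(3)] integrable_interval_const])
    fix t assume "t \<in> space (lebesgue_interval T)"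
    then show "(norm (x t))\<^sup>2 \<le> b\<^sup>2" using assms(2)[of t] by (intro power_mono) auto
  qed
  also have "\<dots> = T * b\<^sup>2" using assms(1) by (simp add: measure_restrict_space)
  finally show ?thesis .
qed

lemma L2_sq_matrix_mult_le:
  fixes N :: "real^'n^'m"
  obtains c where "0 \<le> c" "\<And>x. x \<in> L2_space T \<Longrightarrow> L2_sq T (\<lambda>t. N *v x t) \<le> c * L2_sq T x"
proof -
  obtain c where c: "\<And>v. norm (N *v v) \<le> norm v * c"
    using bounded_linear.bounded[OF matrix_vector_mul_bounded_linear[of N]] by auto
  have "L2_sq T (\<lambda>t. N *v x t) \<le> c\<^sup>2 * L2_sq T x" if x: "x \<in> L2_space T" for x
  proof -
    have "(norm (N *v x t))\<^sup>2 \<le> c\<^sup>2 * (norm (x t))\<^sup>2" for t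
      using power_mono[OF c[of "x t"], of 2] by (simp add: power_mult_distrib mult.commute)
    then have "L2_sq T (\<lambda>t. N *v x t) \<le> (\<integral>t. c\<^sup>2 * (norm (x t))\<^sup>2 \<partial>lebesgue_interval T)"
      by (intro Bochner_Integration.integral_mono integrable_mult_right L2_spaceD(2) L2_matrix_mult x)
    then show ?thesis by (simp only: integral_mult_right_zero)
  qed
  then show thesis using that[of "c\<^sup>2"] by simp
qed

section \<open>Existence of optimal controls\<close>

lemma admissibleD:
  assumes "admissible T A B C D f x0 x u"
  shows "u \<in> L2_space T" "continuous_on {0..T} x" "x \<in> L2_space T"
    "\<And>t. t \<in> {0..T} \<Longrightarrow> x t = x0 + integral {0..t} (\<lambda>s. A *v x s + B *v u s)"
    "AE t in lebesgue_interval T. C *v x t + D *v u t - f t \<le> 0"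
  using assms L2_continuous[of T x] unfolding admissible_def by blast+

lemma admissible_midpoint:
  assumes xu: "admissible T A B C D f x0 x u" and yw: "admissible T A B C D f x0 y w"
  shows "admissible T A B C D f x0 (\<lambda>t. (1/2) *\<^sub>R (x t + y t)) (\<lambda>t. (1/2) *\<^sub>R (u t + w t))"
  unfolding admissible_def
proof (intro conjI ballI)
  note x = admissibleD[OF xu] and y = admissibleD[OF yw]
  have eq: "N *v ((1/2) *\<^sub>R (a + b)) + N' *v ((1/2) *\<^sub>R (c + d)) = (1/2) *\<^sub>R ((N *v a + N' *v c) + (N *v b + N' *v d))"
    for N :: "real^'i^'j" and N' :: "real^'k^'j" and a b c d
    by (simp only: matrix_vector_mult_scaleR matrix_vector_right_distrib scaleR_add_right ac_simps)
  show "(\<lambda>t. (1/2) *\<^sub>R (u t + w t)) \<in> L2_space T"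
    by (intro L2_scaleR L2_add x y)
  show "continuous_on {0..T} (\<lambda>t. (1/2) *\<^sub>R (x t + y t))"
    by (intro continuous_on_scaleR continuous_on_const continuous_on_add x y)
  show "(1/2) *\<^sub>R (x t + y t) = x0 + integral {0..t} (\<lambda>s. A *v ((1/2) *\<^sub>R (x s + y s)) + B *v ((1/2) *\<^sub>R (u s + w s)))"
    if t: "t \<in> {0..T}" for t
  proof -
    have "integral {0..t} (\<lambda>s. A *v ((1/2) *\<^sub>R (x s + y s)) + B *v ((1/2) *\<^sub>R (u s + w s)))
        = (1/2) *\<^sub>R (integral {0..t} (\<lambda>s. A *v x s + B *v u s) + integral {0..t} (\<lambda>s. A *v y s + B *v w s))"
      unfolding eq integral_cmul
      by (subst Henstock_Kurzweil_Integration.integral_add[OF dynamics_integrable_on[OF x(2,1) t]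
            dynamics_integrable_on[OF y(2,1) t]]) (rule refl)
    moreover have "(1/2) *\<^sub>R (x t + y t) = (1/2) *\<^sub>R ((x0 + integral {0..t} (\<lambda>s. A *v x s + B *v u s))
        + (x0 + integral {0..t} (\<lambda>s. A *v y s + B *v w s)))"
      by (simp only: x(4)[OF t, symmetric] y(4)[OF t, symmetric])
    moreover have "(1/2) *\<^sub>R ((x0 + a) + (x0 + b)) = x0 + (1/2) *\<^sub>R (a + b)" for a b
    proof -
      have "(1/2) *\<^sub>R x0 + (1/2) *\<^sub>R x0 = x0" by (simp flip: scaleR_add_left)
      then show ?thesis by (simp add: scaleR_add_right add.assoc)
    qed
    ultimately show ?thesis by (simp only:)
  qed
  show "AE t in lebesgue_interval T. C *v ((1/2) *\<^sub>R (x t + y t)) + D *v ((1/2) *\<^sub>R (u t + w t)) - f t \<le> 0"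
    using x(5) y(5)
  proof eventually_elim
    case (elim t)
    show ?case
      unfolding eq less_eq_vec_def
    proof
      fix i
      have "(C *v x t + D *v u t - f t) $ i \<le> 0" "(C *v y t + D *v w t - f t) $ i \<le> 0"
        using elim unfolding less_eq_vec_def by simp_all
      then show "((1/2) *\<^sub>R ((C *v x t + D *v u t) + (C *v y t + D *v w t)) - f t) $ i \<le> 0 $ i"
        by simp
    qed
  qed
qed

lemma dynamics_sq_le:
  fixes A :: "real^'n^'n" and B :: "real^'m^'n"
  obtains c where "0 \<le> c" "\<And>x u. x \<in> L2_space T \<Longrightarrow> u \<in> L2_space T \<Longrightarrow>
    L2_sq T (\<lambda>t. A *v x t + B *v u t) \<le> c * (L2_sq T x + L2_sq T u)"
proof -
  obtain a where a: "0 \<le> a" "\<And>x. x \<in> L2_space T \<Longrightarrow> L2_sq T (\<lambda>t. A *v x t) \<le> a * L2_sq T x"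
    using L2_sq_matrix_mult_le[of T A] by blast
  obtain b where b: "0 \<le> b" "\<And>x. x \<in> L2_space T \<Longrightarrow> L2_sq T (\<lambda>t. B *v x t) \<le> b * L2_sq T x"
    using L2_sq_matrix_mult_le[of T B] by blast
  show thesis
  proof
    show "0 \<le> 2 * (a + b)" using a b by simp
    fix x :: "real \<Rightarrow> real^'n" and u :: "real \<Rightarrow> real^'m"
    assume xu: "x \<in> L2_space T" "u \<in> L2_space T"
    have "L2_sq T (\<lambda>t. A *v x t + B *v u t) \<le> (1 + 1) * L2_sq T (\<lambda>t. A *v x t) + (1 + 1 / 1) * L2_sq T (\<lambda>t. B *v u t)"
      by (intro L2_sq_add_le L2_matrix_mult xu) simp
    also have "\<dots> \<le> 2 * (a * L2_sq T x) + 2 * (b * L2_sq T u)"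
      using a(2)[OF xu(1)] b(2)[OF xu(2)] by simp
    also have "\<dots> \<le> 2 * (a + b) * (L2_sq T x + L2_sq T u)"
      using mult_nonneg_nonneg[OF a(1) L2_sq_nonneg[of T u]] mult_nonneg_nonneg[OF b(1) L2_sq_nonneg[of T x]]
      by (simp add: algebra_simps)
    finally show "L2_sq T (\<lambda>t. A *v x t + B *v u t) \<le> 2 * (a + b) * (L2_sq T x + L2_sq T u)" .
  qed
qed

text \<open>The integral equation bounds \<open>x T\<close> by the L2 norms of \<open>x\<close> and
  \<open>u\<close>. The cost controls both, so endpoints along a minimizing sequence are
  bounded.\<close>

lemma admissible_endpoint_le:
  fixes A :: "real^'n^'n" and B :: "real^'m^'n"
  assumes T: "0 < T"
  obtains c where "0 \<le> c" "\<And>C D f x u. admissible T A B (C :: real^'n^'l) D f x0 x u \<Longrightarrow>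
    (norm (x T))\<^sup>2 \<le> c * (1 + L2_sq T x + L2_sq T u)"
proof -
  obtain c where c: "0 \<le> c" "\<And>x u. x \<in> L2_space T \<Longrightarrow> u \<in> L2_space T \<Longrightarrow>
      L2_sq T (\<lambda>t. A *v x t + B *v u t) \<le> c * (L2_sq T x + L2_sq T u)"
    using dynamics_sq_le[of T A B] by blast
  show thesis
  proof
    show "0 \<le> 2 * (norm x0)\<^sup>2 + 2 * (T * c)" using T c by simp
    fix C :: "real^'n^'l" and D f x u
    assume adm: "admissible T A B C D f x0 x u"
    note x = admissibleD[OF adm]
    have TT: "T \<in> {0..T}" using T by simp
    have "(norm (integral {0..T} (\<lambda>s. A *v x s + B *v u s)))\<^sup>2 \<le> T * L2_sq T (\<lambda>s. A *v x s + B *v u s)"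
      by (rule norm_integral_le_L2[OF T dynamics_L2[OF x(2,1)] TT])
    also have "\<dots> \<le> T * (c * (L2_sq T x + L2_sq T u))"
      using T by (intro mult_left_mono c(2) x) simp
    finally have I: "(norm (integral {0..T} (\<lambda>s. A *v x s + B *v u s)))\<^sup>2 \<le> T * c * (L2_sq T x + L2_sq T u)"
      by (simp add: mult.assoc)
    have "(norm (x T))\<^sup>2 = (norm (x0 + integral {0..T} (\<lambda>s. A *v x s + B *v u s)))\<^sup>2"
      by (simp only: x(4)[OF TT, symmetric])
    also have "\<dots> \<le> 2 * (norm x0)\<^sup>2 + 2 * (norm (integral {0..T} (\<lambda>s. A *v x s + B *v u s)))\<^sup>2"
      by (rule norm_add_square_le)
    also have "\<dots> \<le> 2 * (norm x0)\<^sup>2 * 1 + 2 * (T * c) * (L2_sq T x + L2_sq T u)"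
      using I by simp
    also have "\<dots> \<le> (2 * (norm x0)\<^sup>2 + 2 * (T * c)) * (1 + L2_sq T x + L2_sq T u)"
    proof -
      have "0 \<le> 2 * (norm x0)\<^sup>2 * (L2_sq T x + L2_sq T u) + 2 * (T * c) * 1"
        using T c L2_sq_nonneg[of T x] L2_sq_nonneg[of T u] by (intro add_nonneg_nonneg mult_nonneg_nonneg) auto
      then show ?thesis by (simp add: algebra_simps)
    qed
    finally show "(norm (x T))\<^sup>2 \<le> (2 * (norm x0)\<^sup>2 + 2 * (T * c)) * (1 + L2_sq T x + L2_sq T u)" .
  qed
qed

text \<open>An L2 limit has no point values, so the limit trajectory \<open>y\<close> is rebuilt
  from the integral equation driven by \<open>v\<close> and \<open>w\<close>. L2 convergence of the
  dynamics gives \<open>x k t \<longlonglongrightarrow> y t\<close> at every \<open>t\<close>, and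
  the subsequence \<open>r1\<close> identifies \<open>y\<close> with \<open>v\<close> almost
  everywhere.\<close>

lemma admissible_limit:
  fixes x :: "nat \<Rightarrow> real \<Rightarrow> real^'n" and u :: "nat \<Rightarrow> real \<Rightarrow> real^'m"
  assumes T: "0 < T" and adm: "\<And>k. admissible T A B C D f x0 (x k) (u k)"
    and v: "v \<in> L2_space T" and w: "w \<in> L2_space T"
    and lx: "(\<lambda>k. L2_sq T (\<lambda>t. x k t - v t)) \<longlonglongrightarrow> 0" and lu: "(\<lambda>k. L2_sq T (\<lambda>t. u k t - w t)) \<longlonglongrightarrow> 0"
    and r1: "strict_mono r1" "AE t in lebesgue_interval T. (\<lambda>k. x (r1 k) t) \<longlonglongrightarrow> v t"
    and r2: "strict_mono r2" "AE t in lebesgue_interval T. (\<lambda>k. u (r2 k) t) \<longlonglongrightarrow> w t"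
  obtains y where "admissible T A B C D f x0 y w" "\<And>t. t \<in> {0..T} \<Longrightarrow> (\<lambda>k. x k t) \<longlonglongrightarrow> y t"
    "AE t in lebesgue_interval T. y t = v t"
proof -
  note x = admissibleD[OF adm]
  let ?g = "\<lambda>s. A *v v s + B *v w s"
  have g: "?g \<in> L2_space T" by (intro L2_add L2_matrix_mult v w)
  have int_on: "h integrable_on {0..t}" if "h \<in> L2_space T" "t \<in> {0..T}" for h :: "real \<Rightarrow> real^'n" and t
    using integrable_on_subinterval[OF interval_integrable_on(1)[OF L2_integrable[OF that(1)]], of 0 t] that(2) by simp
  define y where "y = (\<lambda>t. x0 + integral {0..t} ?g)"
  have yc: "continuous_on {0..T} y"
    unfolding y_def by (rule continuous_indefinite_integral[OF L2_integrable[OF g]])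
  obtain c where c: "0 \<le> c" "\<And>x u. x \<in> L2_space T \<Longrightarrow> u \<in> L2_space T \<Longrightarrow>
      L2_sq T (\<lambda>t. A *v x t + B *v u t) \<le> c * (L2_sq T x + L2_sq T u)"
    using dynamics_sq_le[of T A B] by blast
  have conv: "(\<lambda>k. x k t) \<longlonglongrightarrow> y t" if t: "t \<in> {0..T}" for t
  proof (rule LIM_zero_cancel, rule Lim_null_comparison)
    define b where "b = (\<lambda>k. T * (c * (L2_sq T (\<lambda>t. x k t - v t) + L2_sq T (\<lambda>t. u k t - w t))))"
    have "b \<longlonglongrightarrow> T * (c * (0 + 0))"
      unfolding b_def by (intro tendsto_mult tendsto_const tendsto_add lx lu)
    then show "(\<lambda>k. sqrt (b k)) \<longlonglongrightarrow> 0"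
      using tendsto_real_sqrt[of b "T * (c * (0 + 0))"] by simp
    have "norm (x k t - y t) \<le> sqrt (b k)" for k
    proof (rule real_le_rsqrt)
      have "x k t - y t = integral {0..t} (\<lambda>s. (A *v x k s + B *v u k s) - ?g s)"
        unfolding y_def
        by (subst Henstock_Kurzweil_Integration.integral_diff[OF dynamics_integrable_on[OF x(2,1) t] int_on[OF g t]])
          (subst x(4)[OF t], simp only: add_diff_cancel_left)
      also have "(\<lambda>s. (A *v x k s + B *v u k s) - ?g s) = (\<lambda>s. A *v (x k s - v s) + B *v (u k s - w s))"
        by (rule ext) (simp add: matrix_vector_mult_diff_distrib)
      finally have "(norm (x k t - y t))\<^sup>2 = (norm (integral {0..t} (\<lambda>s. A *v (x k s - v s) + B *v (u k s - w s))))\<^sup>2"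
        by (simp only:)
      also have "\<dots> \<le> T * L2_sq T (\<lambda>s. A *v (x k s - v s) + B *v (u k s - w s))"
        by (intro norm_integral_le_L2 T t L2_add L2_matrix_mult L2_diff x v w)
      also have "\<dots> \<le> b k"
        unfolding b_def using T by (intro mult_left_mono c L2_diff x v w) simp
      finally show "(norm (x k t - y t))\<^sup>2 \<le> b k" .
    qed
    then show "\<forall>\<^sub>F k in sequentially. norm (x k t - y t) \<le> sqrt (b k)"
      by (intro always_eventually allI)
  qed
  have inI: "AE t in lebesgue_interval T. t \<in> {0..T}" by (rule AE_I2) simp
  have yv: "AE t in lebesgue_interval T. y t = v t"
    using inI r1(2)
  proof eventually_elim
    case (elim t)
    have "(\<lambda>k. x (r1 k) t) \<longlonglongrightarrow> y t"
      using LIMSEQ_subseq_LIMSEQ[OF conv[OF elim(1)] r1(1)] by (simp add: o_def)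
    then show ?case using elim(2) LIMSEQ_unique by blast
  qed
  \<comment> \<open>The definition of \<open>y\<close> has \<open>v\<close> on the right-hand side;
    as \<open>y = v\<close> almost everywhere, \<open>y\<close> may stand there instead.\<close>
  have yeq: "y t = x0 + integral {0..t} (\<lambda>s. A *v y s + B *v w s)" if t: "t \<in> {0..T}" for t
  proof -
    let ?h = "\<lambda>s. (A *v y s + B *v w s) - ?g s"
    have yw: "(\<lambda>s. A *v y s + B *v w s) \<in> L2_space T" by (rule dynamics_L2[OF yc w])
    have h: "?h \<in> L2_space T" by (rule L2_diff[OF yw g])
    have "AE s in lebesgue_interval T. (norm (?h s))\<^sup>2 = 0"
      using yv by eventually_elim simp
    then have "L2_sq T ?h = 0" by (rule integral_eq_zero_AE)
    then have "(norm (integral {0..t} ?h))\<^sup>2 \<le> 0"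
      using norm_integral_le_L2[OF T h t] by simp
    then have "integral {0..t} ?h = 0" by simp
    moreover have "integral {0..t} ?h = integral {0..t} (\<lambda>s. A *v y s + B *v w s) - integral {0..t} ?g"
      by (rule Henstock_Kurzweil_Integration.integral_diff[OF int_on[OF yw t] int_on[OF g t]])
    ultimately show ?thesis unfolding y_def by (simp only: right_minus_eq)
  qed
  \<comment> \<open>The countably many exceptional null sets are merged, so that the inequality can
    pass to the limit along \<open>r2\<close> at a single \<open>t\<close>.\<close>
  have "AE t in lebesgue_interval T. \<forall>k. C *v x k t + D *v u k t - f t \<le> 0"
    unfolding AE_all_countable using x(5) by blast
  with inI r2(2) have "AE t in lebesgue_interval T. C *v y t + D *v w t - f t \<le> 0"
  proof eventually_elim
    case (elim t)
    have lim_x: "(\<lambda>k. x (r2 k) t) \<longlonglongrightarrow> y t"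
      using LIMSEQ_subseq_LIMSEQ[OF conv[OF elim(1)] r2(1)] by (simp add: o_def)
    have "(\<lambda>k. C *v x (r2 k) t + D *v u (r2 k) t - f t) \<longlonglongrightarrow> C *v y t + D *v w t - f t"
      by (intro tendsto_diff tendsto_add tendsto_const
          bounded_linear.tendsto[OF matrix_vector_mul_bounded_linear] lim_x elim(2))
    note lim = tendsto_vec_nth[OF this]
    show ?case
      unfolding less_eq_vec_def
    proof
      fix i
      have "(C *v x (r2 k) t + D *v u (r2 k) t - f t) $ i \<le> 0 $ i" for k
        using elim(3) unfolding less_eq_vec_def by blast
      then show "(C *v y t + D *v w t - f t) $ i \<le> 0 $ i"
        by (intro LIMSEQ_le_const2[OF lim]) blast
    qed
  qed
  then have "admissible T A B C D f x0 y w"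
    unfolding admissible_def by (intro conjI ballI w yc yeq)
  with conv yv show thesis by (intro that)
qed

lemma L2_sq_le_energy:
  assumes "0 < \<delta>"
  shows "L2_sq T h \<le> 2 * energy T \<delta> h k" "L2_sq T k \<le> 2 / \<delta> * energy T \<delta> h k"
proof -
  have "0 \<le> \<delta> / 2 * L2_sq T k"
    using assms by (intro mult_nonneg_nonneg L2_sq_nonneg) simp
  then show "L2_sq T h \<le> 2 * energy T \<delta> h k" unfolding energy_def by simp
  have "\<delta> * L2_sq T k \<le> 2 * energy T \<delta> h k" unfolding energy_def using L2_sq_nonneg[of T h] by simp
  then show "L2_sq T k \<le> 2 / \<delta> * energy T \<delta> h k"
    using assms by (simp add: field_simps)
qed

text \<open>Boundedness below of \<open>\<Psi>\<close> bounds the energy along a minimizing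
  sequence; the bound on the endpoints then comes from the dynamics, not from growth of
  \<open>\<Psi>\<close>.\<close>

theorem optimal_control_exists:
  fixes A :: "real^'n^'n" and B :: "real^'m^'n" and C :: "real^'n^'l" and D :: "real^'m^'l"
    and \<Psi> :: "real^'n \<Rightarrow> real"
  assumes T: "0 < T" and \<delta>: "0 < \<delta>" and xd: "xd \<in> L2_space T" and ud: "ud \<in> L2_space T"
    and Z: "closed Z" and cont: "continuous_on UNIV \<Psi>" and bdd: "bdd_below (range \<Psi>)"
    and cor: "\<And>z. \<exists>\<phi> w. correction T A B C D \<phi> w \<and> \<phi> T = z \<and>
      (\<forall>t\<in>{0..T}. norm (\<phi> t) \<le> c * norm z \<and> norm (w t) \<le> c * norm z)"
    and ne: "admissible T A B C D f x0 x1 u1" "x1 T \<in> Z"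
  shows "\<exists>x u. admissible T A B C D f x0 x u \<and> x T \<in> Z \<and>
    (\<forall>y w. admissible T A B C D f x0 y w \<and> y T \<in> Z \<longrightarrow>
      \<Psi> (x T) + energy T \<delta> (\<lambda>t. x t - xd t) (\<lambda>t. u t - ud t)
        \<le> \<Psi> (y T) + energy T \<delta> (\<lambda>t. y t - xd t) (\<lambda>t. w t - ud t))"
proof -
  let ?adm = "admissible T A B C D f x0"
  define E where "E = (\<lambda>x u. energy T \<delta> (\<lambda>t. x t - xd t) (\<lambda>t. u t - ud t))"
  define V where "V = {\<Psi> (x T) + E x u |x u. ?adm x u \<and> x T \<in> Z}"
  define m where "m = Inf V"
  have \<delta>0: "0 \<le> \<delta>" using \<delta> by simp
  have E0: "0 \<le> E x u" for x u unfolding E_def by (rule energy_nonneg[OF \<delta>0])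
  obtain lb where lb: "\<And>z. lb \<le> \<Psi> z" using bdd unfolding bdd_below_def by blast
  have Vlb: "lb \<le> v" if "v \<in> V" for v
    using that lb E0 unfolding V_def by (auto intro!: add_increasing2)
  have Vne: "V \<noteq> {}" using ne unfolding V_def by blast
  have Vbdd: "bdd_below V" using Vlb by (rule bdd_belowI)
  have m_le: "m \<le> \<Psi> (x T) + E x u" if "?adm x u" "x T \<in> Z" for x u
    unfolding m_def by (rule cInf_lower[OF _ Vbdd]) (use that in \<open>unfold V_def, blast\<close>)
  have "\<exists>x u. ?adm x u \<and> x T \<in> Z \<and> \<Psi> (x T) + E x u < m + 1 / real (Suc k)" for k
  proof -
    have "\<exists>v\<in>V. v < m + 1 / real (Suc k)"
      unfolding cInf_less_iff[OF Vne Vbdd, symmetric] m_def by simp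
    then show ?thesis unfolding V_def by blast
  qed
  then obtain X U where XU: "\<And>k. ?adm (X k) (U k)" "\<And>k. X k T \<in> Z"
    "\<And>k. \<Psi> (X k T) + E (X k) (U k) < m + 1 / real (Suc k)" by metis
  note XL = admissibleD(1,3)[OF XU(1)]
  \<comment> \<open>The values stay below \<open>m + 1\<close> and \<open>\<Psi>\<close> above
    \<open>lb\<close>, so the difference bounds the energies.\<close>
  define R where "R = m + 1 - lb"
  have ER: "E (X k) (U k) \<le> R" for k
  proof -
    have "1 / real (Suc k) \<le> 1" by simp
    then show ?thesis using XU(3)[of k] lb[of "X k T"] unfolding R_def by linarith
  qed
  have bounded: "bounded (range (\<lambda>k. X k T))"
  proof -
    obtain a where a: "0 \<le> a" "\<And>x u. ?adm x u \<Longrightarrow> (norm (x T))\<^sup>2 \<le> a * (1 + L2_sq T x + L2_sq T u)"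
      using admissible_endpoint_le[OF T, of A B x0] by metis
    \<comment> \<open>The squared norms of \<open>x - xd\<close> and \<open>u - ud\<close> are at
      most \<open>2 R\<close> and \<open>2 R / \<delta>\<close>; returning to \<open>x\<close> and
      \<open>u\<close> doubles these and adds twice those of the targets.\<close>
    define b where "b = a * (1 + (4 * R + 2 * L2_sq T xd) + (4 / \<delta> * R + 2 * L2_sq T ud))"
    have split: "L2_sq T x \<le> 2 * L2_sq T (\<lambda>t. x t - y t) + 2 * L2_sq T y"
      if "x \<in> L2_space T" "y \<in> L2_space T" for x y :: "real \<Rightarrow> real^'i"
      using L2_sq_add_le[OF zero_less_one L2_diff[OF that] that(2)] by simp
    have "norm (X k T) \<le> sqrt b" for k
    proof (rule real_le_rsqrt)
      have "L2_sq T (\<lambda>t. X k t - xd t) \<le> 2 * R"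
        using L2_sq_le_energy(1)[OF \<delta>, of T "\<lambda>t. X k t - xd t" "\<lambda>t. U k t - ud t"] ER[of k]
        unfolding E_def by linarith
      moreover have "L2_sq T (\<lambda>t. U k t - ud t) \<le> 2 / \<delta> * R"
        using L2_sq_le_energy(2)[OF \<delta>, where k = "\<lambda>t. U k t - ud t" and h = "\<lambda>t. X k t - xd t" and T = T]
          mult_left_mono[OF ER[of k], of "2 / \<delta>"] \<delta>
        unfolding E_def by simp
      ultimately have "1 + L2_sq T (X k) + L2_sq T (U k)
          \<le> 1 + (4 * R + 2 * L2_sq T xd) + (4 / \<delta> * R + 2 * L2_sq T ud)"
        using split[OF XL(2) xd, of k] split[OF XL(1) ud, of k] by simp
      then have "a * (1 + L2_sq T (X k) + L2_sq T (U k)) \<le> b"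
        unfolding b_def by (rule mult_left_mono[OF _ a(1)])
      with a(2)[OF XU(1)] show "(norm (X k T))\<^sup>2 \<le> b" by (rule order_trans)
    qed
    then show ?thesis unfolding bounded_iff by blast
  qed
  obtain z r where r: "strict_mono r" and "((\<lambda>k. X k T) \<circ> r) \<longlonglongrightarrow> z"
    using bounded_imp_convergent_subsequence[OF bounded] by blast
  then have z: "(\<lambda>k. X (r k) T) \<longlonglongrightarrow> z" by (simp add: o_def)
  have zZ: "z \<in> Z"
    by (rule closed_sequentially[OF Z _ z]) (rule XU(2))
  \<comment> \<open>What the infimum leaves for the energy when the endpoint is exactly
    \<open>z\<close>: a lower bound for all such pairs, approached by the corrected
    sequence.\<close>
  define \<mu> where "\<mu> = m - \<Psi> z"
  have low: "\<mu> \<le> E x u" if "?adm x u" "x T = z" for x u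
    using m_le[OF that(1)] that(2) zZ unfolding \<mu>_def by simp
  have "\<forall>k. \<exists>\<phi> w. correction T A B C D \<phi> w \<and> \<phi> T = z - X (r k) T \<and>
      (\<forall>t\<in>{0..T}. norm (\<phi> t) \<le> c * norm (z - X (r k) T) \<and> norm (w t) \<le> c * norm (z - X (r k) T))"
    using cor by blast
  then obtain \<Phi> W where \<Phi>: "\<And>k. correction T A B C D (\<Phi> k) (W k)" "\<And>k. \<Phi> k T = z - X (r k) T"
    "\<And>k t. t \<in> {0..T} \<Longrightarrow> norm (\<Phi> k t) \<le> c * norm (z - X (r k) T)"
    "\<And>k t. t \<in> {0..T} \<Longrightarrow> norm (W k t) \<le> c * norm (z - X (r k) T)"
    by metis
  have \<Phi>L: "\<Phi> k \<in> L2_space T" "W k \<in> L2_space T" for k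
    using \<Phi>(1)[of k] unfolding correction_def by (blast intro: L2_continuous)+
  define X' where "X' = (\<lambda>k t. X (r k) t + \<Phi> k t)"
  define U' where "U' = (\<lambda>k t. U (r k) t + W k t)"
  have adm': "?adm (X' k) (U' k)" for k
    unfolding X'_def U'_def by (rule admissible_add_correction[OF XU(1) \<Phi>(1)])
  have X'T: "X' k T = z" for k unfolding X'_def by (simp add: \<Phi>(2))
  note X'L = admissibleD(1,3)[OF adm']
  have energy_\<Phi>: "(\<lambda>k. energy T \<delta> (\<Phi> k) (W k)) \<longlonglongrightarrow> 0"
  proof (rule tendsto_sandwich[OF _ _ tendsto_const])
    let ?b = "\<lambda>k. 1/2 * (T * (c * norm (z - X (r k) T))\<^sup>2) + \<delta>/2 * (T * (c * norm (z - X (r k) T))\<^sup>2)"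
    have "?b \<longlonglongrightarrow> 1/2 * (T * (c * norm (z - z))\<^sup>2) + \<delta>/2 * (T * (c * norm (z - z))\<^sup>2)"
      by (intro tendsto_add tendsto_mult tendsto_const tendsto_power tendsto_norm tendsto_diff z)
    then show "?b \<longlonglongrightarrow> 0" by simp
    have "energy T \<delta> (\<Phi> k) (W k) \<le> ?b k" for k
      unfolding energy_def using \<delta>0 by (intro add_mono mult_left_mono L2_sq_le_sup T \<Phi> \<Phi>L) auto
    then show "\<forall>\<^sub>F k in sequentially. energy T \<delta> (\<Phi> k) (W k) \<le> ?b k" by (intro always_eventually allI)
    show "\<forall>\<^sub>F k in sequentially. 0 \<le> energy T \<delta> (\<Phi> k) (W k)"
      by (intro always_eventually allI energy_nonneg \<delta>0)
  qed
  \<comment> \<open>The corrections cost arbitrarily little and \<open>\<Psi>\<close> converges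
    along the endpoints, so near-optimality passes to the corrected sequence.\<close>
  have up: "\<forall>\<^sub>F k in sequentially. E (X' k) (U' k) \<le> \<mu> + e" if e: "0 < e" for e
  proof -
    have "\<forall>\<^sub>F k in sequentially. energy T \<delta> (\<lambda>t. (X (r k) t - xd t) + \<Phi> k t) (\<lambda>t. (U (r k) t - ud t) + W k t)
        \<le> energy T \<delta> (\<lambda>t. X (r k) t - xd t) (\<lambda>t. U (r k) t - ud t) + e / 2"
      using ER half_gt_zero[OF e] unfolding E_def
      by (intro energy_continuous_dependence[where R = R] \<delta>0 energy_\<Phi> L2_diff XL xd ud \<Phi>L always_eventually allI)
    moreover have "(\<lambda>k. m + 1 / real (Suc (r k)) - \<Psi> (X (r k) T)) \<longlonglongrightarrow> m + 0 - \<Psi> z"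
    proof (intro tendsto_diff tendsto_add tendsto_const)
      show "(\<lambda>k. 1 / real (Suc (r k))) \<longlonglongrightarrow> 0"
        using LIMSEQ_subseq_LIMSEQ[OF LIMSEQ_Suc[OF lim_1_over_n] r] by (simp add: o_def)
      show "(\<lambda>k. \<Psi> (X (r k) T)) \<longlonglongrightarrow> \<Psi> z"
        by (rule continuous_on_tendsto_compose[OF cont z]) simp_all
    qed
    then have "\<forall>\<^sub>F k in sequentially. m + 1 / real (Suc (r k)) - \<Psi> (X (r k) T) < \<mu> + e / 2"
      by (rule order_tendstoD(2)) (use e in \<open>simp add: \<mu>_def\<close>)
    ultimately show ?thesis
    proof eventually_elim
      case (elim k)
      have "E (X' k) (U' k) = energy T \<delta> (\<lambda>t. (X (r k) t - xd t) + \<Phi> k t) (\<lambda>t. (U (r k) t - ud t) + W k t)"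
        unfolding E_def X'_def U'_def by (simp only: add_diff_eq diff_add_eq)
      moreover have "E (X (r k)) (U (r k)) < m + 1 / real (Suc (r k)) - \<Psi> (X (r k) T)"
        using XU(3)[of "r k"] by linarith
      ultimately show ?case using elim unfolding E_def by linarith
    qed
  qed
  have cauchy: "\<exists>N. \<forall>i\<ge>N. \<forall>j\<ge>N. energy T \<delta> (\<lambda>t. X' i t - X' j t) (\<lambda>t. U' i t - U' j t) \<le> 4 * e"
    if e: "0 < e" for e
  proof -
    obtain N where N: "\<And>k. k \<ge> N \<Longrightarrow> E (X' k) (U' k) \<le> \<mu> + e"
      using up[OF e] unfolding eventually_sequentially by blast
    have "energy T \<delta> (\<lambda>t. X' i t - X' j t) (\<lambda>t. U' i t - U' j t) \<le> 4 * e" if ij: "i \<ge> N" "j \<ge> N" for i j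
    proof -
      have half: "(1/2) *\<^sub>R ((a - d) + (b - d)) = (1/2) *\<^sub>R (a + b) - d" for a b d :: "real^'i"
      proof -
        have "(1/2) *\<^sub>R d + (1/2) *\<^sub>R d = d" by (simp flip: scaleR_add_left)
        then show ?thesis by (simp add: scaleR_add_right scaleR_diff_right algebra_simps)
      qed
      \<comment> \<open>The midpoint is admissible with endpoint \<open>z\<close>, hence its energy
        is at least \<open>\<mu>\<close>; the parallelogram identity then leaves at most
        \<open>4 * e\<close> for the difference.\<close>
      have "\<mu> \<le> E (\<lambda>t. (1/2) *\<^sub>R (X' i t + X' j t)) (\<lambda>t. (1/2) *\<^sub>R (U' i t + U' j t))"
        by (rule low[OF admissible_midpoint[OF adm' adm']]) (simp add: X'T flip: scaleR_add_left)
      also have "\<dots> = energy T \<delta> (\<lambda>t. (1/2) *\<^sub>R ((X' i t - xd t) + (X' j t - xd t)))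
          (\<lambda>t. (1/2) *\<^sub>R ((U' i t - ud t) + (U' j t - ud t)))"
        unfolding E_def half ..
      also have "\<dots> = 1/2 * E (X' i) (U' i) + 1/2 * E (X' j) (U' j)
          - 1/4 * energy T \<delta> (\<lambda>t. (X' i t - xd t) - (X' j t - xd t)) (\<lambda>t. (U' i t - ud t) - (U' j t - ud t))"
        unfolding E_def by (intro energy_parallelogram L2_diff X'L xd ud)
      also have "(\<lambda>t. (X' i t - xd t) - (X' j t - xd t)) = (\<lambda>t. X' i t - X' j t)" by simp
      also have "(\<lambda>t. (U' i t - ud t) - (U' j t - ud t)) = (\<lambda>t. U' i t - U' j t)" by simp
      finally show ?thesis using N[OF ij(1)] N[OF ij(2)] by linarith
    qed
    then show ?thesis by blast
  qed
  have cx: "\<exists>N. \<forall>i\<ge>N. \<forall>j\<ge>N. L2_sq T (\<lambda>t. X' i t - X' j t) < e" if e: "0 < e" for e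
  proof -
    \<comment> \<open>The squared L2 distance is at most twice the energy, so \<open>e / 16\<close>
      leads to \<open>e / 2\<close>, strictly below \<open>e\<close>.\<close>
    obtain N where N: "\<And>i j. i \<ge> N \<Longrightarrow> j \<ge> N \<Longrightarrow>
        energy T \<delta> (\<lambda>t. X' i t - X' j t) (\<lambda>t. U' i t - U' j t) \<le> 4 * (e / 16)"
      using cauchy[of "e / 16"] e by auto
    have "L2_sq T (\<lambda>t. X' i t - X' j t) < e" if "i \<ge> N" "j \<ge> N" for i j
      using N[OF that] e
        L2_sq_le_energy(1)[OF \<delta>, of T "\<lambda>t. X' i t - X' j t" "\<lambda>t. U' i t - U' j t"] by linarith
    then show ?thesis by blast
  qed
  have cu: "\<exists>N. \<forall>i\<ge>N. \<forall>j\<ge>N. L2_sq T (\<lambda>t. U' i t - U' j t) < e" if e: "0 < e" for e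
  proof -
    have e': "0 < \<delta> * e / 16" using e \<delta> by simp
    obtain N where N: "\<And>i j. i \<ge> N \<Longrightarrow> j \<ge> N \<Longrightarrow>
        energy T \<delta> (\<lambda>t. X' i t - X' j t) (\<lambda>t. U' i t - U' j t) \<le> 4 * (\<delta> * e / 16)"
      using cauchy[OF e'] by blast
    have "L2_sq T (\<lambda>t. U' i t - U' j t) < e" if "i \<ge> N" "j \<ge> N" for i j
    proof -
      have "L2_sq T (\<lambda>t. U' i t - U' j t) \<le> 2 / \<delta> * energy T \<delta> (\<lambda>t. X' i t - X' j t) (\<lambda>t. U' i t - U' j t)"
        by (rule L2_sq_le_energy(2)[OF \<delta>])
      also have "\<dots> \<le> 2 / \<delta> * (4 * (\<delta> * e / 16))"
        using \<delta> by (intro mult_left_mono N that) simp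
      also have "\<dots> < e" using \<delta> e by simp
      finally show ?thesis .
    qed
    then show ?thesis by blast
  qed
  obtain v r1 where v: "v \<in> L2_space T" "(\<lambda>k. L2_sq T (\<lambda>t. X' k t - v t)) \<longlonglongrightarrow> 0"
    "strict_mono r1" "AE t in lebesgue_interval T. (\<lambda>k. X' (r1 k) t) \<longlonglongrightarrow> v t"
    using L2_complete[OF T X'L(2) cx] by blast
  obtain w r2 where w: "w \<in> L2_space T" "(\<lambda>k. L2_sq T (\<lambda>t. U' k t - w t)) \<longlonglongrightarrow> 0"
    "strict_mono r2" "AE t in lebesgue_interval T. (\<lambda>k. U' (r2 k) t) \<longlonglongrightarrow> w t"
    using L2_complete[OF T X'L(1) cu] by blast
  obtain y where y: "?adm y w" "\<And>t. t \<in> {0..T} \<Longrightarrow> (\<lambda>k. X' k t) \<longlonglongrightarrow> y t"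
    "AE t in lebesgue_interval T. y t = v t"
    using admissible_limit[OF T adm' v(1) w(1) v(2) w(2) v(3,4) w(3,4)] by blast
  have yT: "y T = z"
  proof -
    have "(\<lambda>k. z) \<longlonglongrightarrow> y T" using y(2)[of T] T unfolding X'T by simp
    then show ?thesis by (rule LIMSEQ_unique[OF _ tendsto_const])
  qed
  have "E y w \<le> \<mu>"
  proof (rule field_le_epsilon)
    fix e :: real assume e: "0 < e"
    \<comment> \<open>Energy convergence is available for \<open>v\<close>; the trajectory
      \<open>y\<close> differs from it on a null set only.\<close>
    have Eyw: "E y w = energy T \<delta> (\<lambda>t. v t - xd t) (\<lambda>t. w t - ud t)"
    proof -
      have "L2_sq T (\<lambda>t. y t - xd t) = L2_sq T (\<lambda>t. v t - xd t)"
      proof (rule integral_cong_AE)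
        show "AE t in lebesgue_interval T. (norm (y t - xd t))\<^sup>2 = (norm (v t - xd t))\<^sup>2"
          using y(3) by eventually_elim simp
      qed (intro borel_measurable_integrable L2_spaceD(2) L2_diff admissibleD(3)[OF y(1)] v(1) xd)+
      then show ?thesis unfolding E_def energy_def by (simp only:)
    qed
    \<comment> \<open>The limit pair is read as a late member of the sequence plus a perturbation of
      vanishing energy, which gives lower semicontinuity.\<close>
    have "\<forall>\<^sub>F k in sequentially.
        energy T \<delta> (\<lambda>t. (X' k t - xd t) + (v t - X' k t)) (\<lambda>t. (U' k t - ud t) + (w t - U' k t))
          \<le> energy T \<delta> (\<lambda>t. X' k t - xd t) (\<lambda>t. U' k t - ud t) + e / 2"
    proof (rule energy_continuous_dependence[OF \<delta>0, where R = "\<mu> + 1"])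
      show "\<forall>\<^sub>F k in sequentially. energy T \<delta> (\<lambda>t. X' k t - xd t) (\<lambda>t. U' k t - ud t) \<le> \<mu> + 1"
        using up[of 1] unfolding E_def by simp
      have "(\<lambda>k. energy T \<delta> (\<lambda>t. X' k t - v t) (\<lambda>t. U' k t - w t)) \<longlonglongrightarrow> 1/2 * 0 + \<delta>/2 * 0"
        unfolding energy_def by (intro tendsto_add tendsto_mult tendsto_const v(2) w(2))
      then show "(\<lambda>k. energy T \<delta> (\<lambda>t. v t - X' k t) (\<lambda>t. w t - U' k t)) \<longlonglongrightarrow> 0"
        unfolding energy_def by (simp add: norm_minus_commute)
    qed (use e in \<open>auto intro!: L2_diff X'L xd ud v(1) w(1)\<close>)
    moreover have "\<forall>\<^sub>F k in sequentially. E (X' k) (U' k) \<le> \<mu> + e / 2"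
      using e by (intro up) simp
    ultimately have "\<forall>\<^sub>F k in sequentially. E y w \<le> \<mu> + e"
    proof eventually_elim
      case (elim k)
      have "energy T \<delta> (\<lambda>t. (X' k t - xd t) + (v t - X' k t)) (\<lambda>t. (U' k t - ud t) + (w t - U' k t))
          = energy T \<delta> (\<lambda>t. v t - xd t) (\<lambda>t. w t - ud t)"
        by simp
      then show ?case using elim Eyw unfolding E_def by linarith
    qed
    then show "E y w \<le> \<mu> + e" by simp
  qed
  then have "\<Psi> (y T) + E y w \<le> m" unfolding yT \<mu>_def by simp
  then have opt: "\<Psi> (y T) + E y w \<le> \<Psi> (x T) + E x u" if "?adm x u" "x T \<in> Z" for x u
    using m_le[OF that] by (rule order_trans)
  show ?thesis
    using y(1) yT zZ opt unfolding E_def by blast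
qed

section \<open>Expectations\<close>

text \<open>\<open>\<xi>\<close> is measurable into the trace of the Borel sets on its own image,
  whether or not that image is a Borel set.\<close>

lemma measurable_support:
  assumes "\<xi> \<in> borel_measurable P" and "h \<in> borel_measurable (restrict_space borel (\<xi> ` space P))"
  shows "(\<lambda>\<omega>. h (\<xi> \<omega>)) \<in> borel_measurable P"
proof -
  have "\<xi> \<in> P \<rightarrow>\<^sub>M restrict_space borel (\<xi> ` space P)"
    using assms(1) by (intro measurable_restrict_space2) auto
  then show ?thesis by (rule measurable_compose[OF _ assms(2)])
qed

lemma integrable_dominated:
  fixes h :: "'w \<Rightarrow> 'a::{banach, second_countable_topology}" and \<kappa> :: "'w \<Rightarrow> real"
  assumes "integrable P \<kappa>" "h \<in> borel_measurable P" "AE \<omega> in P. norm (h \<omega>) \<le> \<kappa> \<omega>"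
  shows "integrable P h"
  using assms(3)
  by (intro Bochner_Integration.integrable_bound[OF assms(1,2)]) (auto elim!: eventually_mono)

lemma expectation_affine:
  fixes M :: "'w \<Rightarrow> real^'n^'m"
  assumes "integrable P M" "integrable P q"
  shows "(\<integral>\<omega>. M \<omega> *v z + q \<omega> \<partial>P) = (\<integral>\<omega>. M \<omega> \<partial>P) *v z + (\<integral>\<omega>. q \<omega> \<partial>P)"
proof -
  have bl: "bounded_linear (\<lambda>N :: real^'n^'m. N *v z)"
    by (rule bounded_bilinear.bounded_linear_left[OF bounded_bilinear_matrix_vector_mult])
  have "(\<integral>\<omega>. M \<omega> *v z + q \<omega> \<partial>P) = (\<integral>\<omega>. M \<omega> *v z \<partial>P) + (\<integral>\<omega>. q \<omega> \<partial>P)"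
    by (rule Bochner_Integration.integral_add[OF integrable_bounded_linear[OF bl assms(1)] assms(2)])
  then show ?thesis
    by (simp only: integral_bounded_linear[OF bl assms(1)])
qed

lemma continuously_differentiable_imp_continuous:
  assumes "continuously_differentiable h"
  shows "isCont h z"
  using assms has_derivative_continuous unfolding continuously_differentiable_def by blast

lemma expectation_norm_le:
  fixes h :: "'w \<Rightarrow> 'a::{banach, second_countable_topology}"
  assumes \<kappa>: "integrable P \<kappa>" and h: "h \<in> borel_measurable P" "AE \<omega> in P. norm (h \<omega>) \<le> \<kappa> \<omega> * c"
  shows "norm (\<integral>\<omega>. h \<omega> \<partial>P) \<le> (\<integral>\<omega>. \<kappa> \<omega> \<partial>P) * c"
proof -
  have i: "integrable P (\<lambda>\<omega>. \<kappa> \<omega> * c)" by (rule integrable_mult_left[OF \<kappa>])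
  have "norm (\<integral>\<omega>. h \<omega> \<partial>P) \<le> (\<integral>\<omega>. norm (h \<omega>) \<partial>P)" by (rule integral_norm_bound)
  also have "\<dots> \<le> (\<integral>\<omega>. \<kappa> \<omega> * c \<partial>P)"
    by (rule integral_mono_AE[OF integrable_norm[OF integrable_dominated[OF i h]] i h(2)])
  finally show ?thesis by simp
qed

text \<open>Dominated convergence: a convergent sequence of arguments is bounded by some
  \<open>b\<close>, and \<open>\<kappa> \<omega> * b\<close> dominates. The null set in
  \<open>growth\<close> may depend on the argument, since the bound is used separately for each
  member of the sequence.\<close>

lemma expectation_continuous_of_growth:
  fixes G :: "real^'n \<Rightarrow> 'w \<Rightarrow> real^'p"
  assumes meas: "\<And>z. G z \<in> borel_measurable P" and \<kappa>: "integrable P \<kappa>" "\<And>\<omega>. \<omega> \<in> space P \<Longrightarrow> 0 \<le> \<kappa> \<omega>"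
    and growth: "\<And>z. AE \<omega> in P. norm (G z \<omega>) \<le> \<kappa> \<omega> * norm z"
    and cont: "AE \<omega> in P. \<forall>z. isCont (\<lambda>z. G z \<omega>) z"
  shows "continuous_on UNIV (\<lambda>z. \<integral>\<omega>. G z \<omega> \<partial>P)"
  unfolding continuous_on_sequentially
proof (intro allI ballI impI, elim conjE)
  fix x a assume x: "x \<longlonglongrightarrow> (a :: real^'n)"
  obtain b where b: "\<And>k. norm (x k) \<le> b"
    using Bseq_def[of x] convergentI[OF x] convergent_imp_Bseq by blast
  have "(\<lambda>k. \<integral>\<omega>. G (x k) \<omega> \<partial>P) \<longlonglongrightarrow> (\<integral>\<omega>. G a \<omega> \<partial>P)"
  proof (rule integral_dominated_convergence[where w = "\<lambda>\<omega>. \<kappa> \<omega> * b"])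
    show "integrable P (\<lambda>\<omega>. \<kappa> \<omega> * b)" by (rule integrable_mult_left[OF \<kappa>(1)])
    show "AE \<omega> in P. (\<lambda>k. G (x k) \<omega>) \<longlonglongrightarrow> G a \<omega>"
      using cont
    proof eventually_elim
      case (elim \<omega>)
      then have "isCont (\<lambda>z. G z \<omega>) a" ..
      then show ?case by (rule isCont_tendsto_compose[OF _ x])
    qed
    show "AE \<omega> in P. norm (G (x k) \<omega>) \<le> \<kappa> \<omega> * b" for k
      using growth[of "x k"] AE_space
    proof eventually_elim
      case (elim \<omega>)
      have "\<kappa> \<omega> * norm (x k) \<le> \<kappa> \<omega> * b" by (rule mult_left_mono[OF b \<kappa>(2)[OF elim(2)]])
      with elim(1) show ?case by (rule order_trans)
    qed
  qed (rule meas)+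
  then show "((\<lambda>z. \<integral>\<omega>. G z \<omega> \<partial>P) \<circ> x) \<longlonglongrightarrow> (\<integral>\<omega>. G a \<omega> \<partial>P)"
    unfolding o_def .
qed

text \<open>The integrals may be undefined, hence 0; but then they are so for every argument.\<close>

lemma expectation_continuous_of_Lipschitz:
  fixes G :: "real^'n \<Rightarrow> 'w \<Rightarrow> real"
  assumes meas: "\<And>z. G z \<in> borel_measurable P" and \<kappa>: "integrable P \<kappa>"
    and lip: "\<And>z1 z2. AE \<omega> in P. \<bar>G z1 \<omega> - G z2 \<omega>\<bar> \<le> \<kappa> \<omega> * norm (z1 - z2)"
  shows "continuous_on UNIV (\<lambda>z. \<integral>\<omega>. G z \<omega> \<partial>P)"
proof -
  have d: "integrable P (\<lambda>\<omega>. G z1 \<omega> - G z2 \<omega>)" for z1 z2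
    by (rule integrable_dominated[OF integrable_mult_left[OF \<kappa>, of "norm (z1 - z2)"]])
      (intro borel_measurable_diff meas, use lip in simp)
  have tr: "integrable P (G z1)" if "integrable P (G z2)" for z1 z2
    using Bochner_Integration.integrable_add[OF d[of z1 z2] that] by simp
  show ?thesis
  proof (cases "\<exists>z. integrable P (G z)")
    case False
    then have "(\<lambda>z. \<integral>\<omega>. G z \<omega> \<partial>P) = (\<lambda>z. 0)"
      by (intro ext not_integrable_integral_eq) blast
    then show ?thesis by (simp only: continuous_on_const)
  next
    case True
    then have i: "integrable P (G z)" for z using tr by blast
    \<comment> \<open>The absolute value makes the Lipschitz constant nonnegative, as
      \<open>\<kappa>\<close> carries no sign condition here.\<close>
    define L where "L = \<bar>\<integral>\<omega>. \<kappa> \<omega> \<partial>P\<bar> + 1"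
    have lipE: "\<bar>(\<integral>\<omega>. G z1 \<omega> \<partial>P) - (\<integral>\<omega>. G z2 \<omega> \<partial>P)\<bar> \<le> L * norm (z1 - z2)" for z1 z2
    proof -
      have "norm (\<integral>\<omega>. G z1 \<omega> - G z2 \<omega> \<partial>P) \<le> (\<integral>\<omega>. \<kappa> \<omega> \<partial>P) * norm (z1 - z2)"
        by (rule expectation_norm_le[OF \<kappa>]) (intro borel_measurable_diff meas, use lip in simp)
      also have "\<dots> \<le> L * norm (z1 - z2)"
        unfolding L_def by (rule mult_right_mono) auto
      finally show ?thesis by (simp add: Bochner_Integration.integral_diff[OF i i])
    qed
    have "L-lipschitz_on UNIV (\<lambda>z. \<integral>\<omega>. G z \<omega> \<partial>P)"
      by (rule lipschitz_onI) (use lipE in \<open>simp_all add: dist_norm L_def\<close>)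
    then show ?thesis by (rule lipschitz_on_continuous_on)
  qed
qed

lemma closed_lcp_solutions: "closed {z. lcp_solution N p z}"
proof -
  have "closed {z. 0 \<le> z $ i \<and> 0 \<le> (N *v z) $ i + p $ i \<and> z $ i * ((N *v z) $ i + p $ i) = 0}" for i
    unfolding matrix_vector_mult_def vec_lambda_beta
    by (intro closed_Collect_conj closed_Collect_le closed_Collect_eq continuous_intros)
  then show ?thesis
    unfolding lcp_solution_iff by (rule closed_Collect_all)
qed

theorem theorem2p1:
  fixes P :: "'w measure" and \<xi> :: "'w \<Rightarrow> real^'d" and \<Xi> :: "(real^'d) set"
    and T \<delta> :: real
    and A :: "real^'n^'n" and B :: "real^'m^'n" and C :: "real^'n^'l" and D :: "real^'m^'l"
    and x0 :: "real^'n" and f :: "real \<Rightarrow> real^'l"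
    and xd :: "real \<Rightarrow> real^'n" and ud :: "real \<Rightarrow> real^'m"
    and K :: "(real^'p) set"
    and F :: "real^'n \<Rightarrow> real^'d \<Rightarrow> real" and g :: "real^'n \<Rightarrow> real^'d \<Rightarrow> real^'p"
    and M :: "real^'d \<Rightarrow> real^'n^'n" and q :: "real^'d \<Rightarrow> real^'n"
    and \<kappa>1 \<kappa>2 \<kappa>3 \<kappa>4 :: "real^'d \<Rightarrow> real"
    and Y :: "real^'k^'m"
  defines "\<Xi> \<equiv> \<xi> ` space P"
  assumes "prob_space P" and "\<xi> \<in> borel_measurable P"
    and "T > 0" and "\<delta> > 0"
    and "f \<in> L2_space T" and "xd \<in> L2_space T" and "ud \<in> L2_space T"
    and "K \<noteq> {}" and "closed K" and "convex K"
    and "AE \<omega> in P. continuously_differentiable (\<lambda>z. F z (\<xi> \<omega>))"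
    and "AE \<omega> in P. continuously_differentiable (\<lambda>z. g z (\<xi> \<omega>))"
    and "\<And>z. F z \<in> borel_measurable (restrict_space borel \<Xi>)"
    and "\<And>z. g z \<in> borel_measurable (restrict_space borel \<Xi>)"
    and "M \<in> borel_measurable (restrict_space borel \<Xi>)"
    and "q \<in> borel_measurable (restrict_space borel \<Xi>)"
    (* (a) *)
    and "\<And>\<kappa>. \<kappa> \<in> {\<kappa>1, \<kappa>2, \<kappa>3, \<kappa>4} \<Longrightarrow>
           \<kappa> \<in> borel_measurable (restrict_space borel \<Xi>) \<and> (\<forall>s\<in>\<Xi>. 0 \<le> \<kappa> s) \<and>
           integrable P (\<lambda>\<omega>. \<kappa> (\<xi> \<omega>))"
    and "\<And>z1 z2. AE \<omega> in P. \<bar>F z1 (\<xi> \<omega>) - F z2 (\<xi> \<omega>)\<bar> \<le> \<kappa>1 (\<xi> \<omega>) * norm (z1 - z2)"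
    and "\<And>z. AE \<omega> in P. norm (g z (\<xi> \<omega>)) \<le> \<kappa>2 (\<xi> \<omega>) * norm z"
    and "\<And>s. s \<in> \<Xi> \<Longrightarrow> norm (M s) \<le> \<kappa>3 s"
    and "\<And>s. s \<in> \<Xi> \<Longrightarrow> norm (q s) \<le> \<kappa>4 s"
    (* (b) *)
    and "rank D = CARD('l)" and "CARD('l) < CARD('m)"
    and "CARD('k) = CARD('m) - CARD('l)" and "rank Y = CARD('k)" and "D ** Y = 0"
    and "rank (krylov_matrix (A - B ** pseudoinverse D ** C) (B ** Y)) = CARD('n)"
    (* (c) *)
    and "cball 0 (beta_const (\<integral>\<omega>. M (\<xi> \<omega>) \<partial>P) * (\<integral>\<omega>. \<kappa>2 (\<xi> \<omega>) \<partial>P) *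
           vec_norm1 (\<integral>\<omega>. q (\<xi> \<omega>) \<partial>P)) \<subseteq> K"
    (* (d) *)
    and "{v. 0 \<le> (\<integral>\<omega>. M (\<xi> \<omega>) *v v + q (\<xi> \<omega>) \<partial>P) \<and> 0 \<le> v} \<noteq> {}"
    (* (e) *)
    and "adequate (\<integral>\<omega>. M (\<xi> \<omega>) \<partial>P) \<or> Z_matrix (\<integral>\<omega>. M (\<xi> \<omega>) \<partial>P)"
  shows "(\<exists>x u. feasible P \<xi> T A B C D f x0 M q g K x u) \<and>
    (bdd_below (range (\<lambda>z. \<integral>\<omega>. F z (\<xi> \<omega>) \<partial>P)) \<longrightarrow>
      (\<exists>x u. feasible P \<xi> T A B C D f x0 M q g K x u \<and>
         (\<forall>y w. feasible P \<xi> T A B C D f x0 M q g K y w \<longrightarrow>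
            objective P \<xi> T F \<delta> xd ud x u \<le> objective P \<xi> T F \<delta> xd ud y w)))"
proof -
  note \<xi> = assms(3) and T = assms(4) and \<delta> = assms(5) and f = assms(6) and xd = assms(7)
    and ud = assms(8) and K = assms(10) and gdiff = assms(13)
  note Fm = assms(14) and gm = assms(15) and Mm = assms(16) and qm = assms(17)
  note \<kappa> = assms(18) and Flip = assms(19) and ggrow = assms(20) and Mb = assms(21) and qb = assms(22)
  note D = assms(23,27) and R = assms(28) and Kball = assms(29) and V = assms(30) and mat = assms(31)
  note meas = measurable_support[OF \<xi>, folded \<Xi>_def]
  have int\<kappa>: "integrable P (\<lambda>\<omega>. \<kappa>1 (\<xi> \<omega>))" "integrable P (\<lambda>\<omega>. \<kappa>2 (\<xi> \<omega>))"
    "integrable P (\<lambda>\<omega>. \<kappa>3 (\<xi> \<omega>))" "integrable P (\<lambda>\<omega>. \<kappa>4 (\<xi> \<omega>))"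
    using \<kappa> by simp_all
  have in\<Xi>: "\<xi> \<omega> \<in> \<Xi>" if "\<omega> \<in> space P" for \<omega>
    using that by (simp add: \<Xi>_def)
  have \<kappa>2: "0 \<le> \<kappa>2 (\<xi> \<omega>)" if "\<omega> \<in> space P" for \<omega>
    using \<kappa>[of \<kappa>2] in\<Xi>[OF that] by blast
  define N where "N = (\<integral>\<omega>. M (\<xi> \<omega>) \<partial>P)"
  define p where "p = (\<integral>\<omega>. q (\<xi> \<omega>) \<partial>P)"
  define G where "G = (\<lambda>z. \<integral>\<omega>. g z (\<xi> \<omega>) \<partial>P)"
  define \<Psi> where "\<Psi> = (\<lambda>z. \<integral>\<omega>. F z (\<xi> \<omega>) \<partial>P)"
  have "integrable P (\<lambda>\<omega>. M (\<xi> \<omega>))" "integrable P (\<lambda>\<omega>. q (\<xi> \<omega>))"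
    by (rule integrable_dominated[OF int\<kappa>(3) meas[OF Mm] AE_I2], erule Mb[OF in\<Xi>])
      (rule integrable_dominated[OF int\<kappa>(4) meas[OF qm] AE_I2], erule qb[OF in\<Xi>])
  then have aff: "(\<integral>\<omega>. M (\<xi> \<omega>) *v z + q (\<xi> \<omega>) \<partial>P) = N *v z + p" for z
    unfolding N_def p_def by (rule expectation_affine)
  have Gc: "continuous_on UNIV G"
    unfolding G_def
  proof (rule expectation_continuous_of_growth[OF meas[OF gm] int\<kappa>(2) \<kappa>2 ggrow])
    show "AE \<omega> in P. \<forall>z. isCont (\<lambda>z. g z (\<xi> \<omega>)) z"
      using gdiff by eventually_elim (intro allI continuously_differentiable_imp_continuous)
  qed
  have \<Psi>c: "continuous_on UNIV \<Psi>"
    unfolding \<Psi>_def by (rule expectation_continuous_of_Lipschitz[OF meas[OF Fm] int\<kappa>(1) Flip])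
  \<comment> \<open>All endpoint conditions in one set; continuity of \<open>G\<close> and
    closedness of \<open>K\<close> make it closed, as \<open>optimal_control_exists\<close>
    requires.\<close>
  define Z where "Z = {z. lcp_solution N p z \<and> G z \<in> K}"
  have Zc: "closed Z"
  proof -
    have "Z = {z. lcp_solution N p z} \<inter> (G -` K \<inter> UNIV)" unfolding Z_def by blast
    moreover have "closed (G -` K \<inter> UNIV)"
      by (rule continuous_closed_preimage[OF Gc closed_UNIV K, unfolded Int_commute[of UNIV]])
    ultimately show ?thesis by (simp only: closed_Int closed_lcp_solutions)
  qed
  have feas: "feasible P \<xi> T A B C D f x0 M q g K x u \<longleftrightarrow> admissible T A B C D f x0 x u \<and> x T \<in> Z" for x u
    unfolding feasible_def admissible_def aff Z_def lcp_solution_def mem_Collect_eq G_def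
    using weak_dynamics_iff[OF T, of x u A B x0] by blast
  have obj: "objective P \<xi> T F \<delta> xd ud x u = \<Psi> (x T) + energy T \<delta> (\<lambda>t. x t - xd t) (\<lambda>t. u t - ud t)" for x u
    unfolding objective_def \<Psi>_def energy_def L2_norm_square by (rule add.assoc)
  obtain z where "z \<in> Z"
  proof -
    obtain v where "0 \<le> N *v v + p" "0 \<le> v" using V unfolding aff by blast
    then obtain z where z: "lcp_solution N p z" "norm z \<le> beta_const N * vec_norm1 p"
      using lcp_solution_bounded[of N v p] mat unfolding N_def[symmetric] by blast
    have E\<kappa>: "0 \<le> (\<integral>\<omega>. \<kappa>2 (\<xi> \<omega>) \<partial>P)"
      by (rule Bochner_Integration.integral_nonneg) (rule \<kappa>2)
    \<comment> \<open>The growth bound of \<open>g\<close> times the bound on \<open>norm z\<close>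
      is exactly the radius of the ball in (c).\<close>
    have "norm (G z) \<le> (\<integral>\<omega>. \<kappa>2 (\<xi> \<omega>) \<partial>P) * norm z"
      unfolding G_def by (rule expectation_norm_le[OF int\<kappa>(2) meas[OF gm] ggrow])
    also have "\<dots> \<le> (\<integral>\<omega>. \<kappa>2 (\<xi> \<omega>) \<partial>P) * (beta_const N * vec_norm1 p)"
      by (rule mult_left_mono[OF z(2) E\<kappa>])
    finally have "norm (G z) \<le> beta_const N * (\<integral>\<omega>. \<kappa>2 (\<xi> \<omega>) \<partial>P) * vec_norm1 p"
      by (simp only: mult_ac)
    then have "G z \<in> K"
      using Kball unfolding N_def[symmetric] p_def[symmetric] by (auto simp: subset_iff)
    with z(1) show thesis by (intro that[of z]) (simp add: Z_def)
  qed
  moreover obtain x1 u1 where adm1: "admissible T A B C D f x0 x1 u1" "x1 T = z"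
    using admissible_exists[OF T D R f] by blast
  ultimately have x1Z: "x1 T \<in> Z" by simp
  obtain c where c: "\<And>z. \<exists>\<phi> w. correction T A B C D \<phi> w \<and> \<phi> T = z \<and>
      (\<forall>t\<in>{0..T}. norm (\<phi> t) \<le> c * norm z \<and> norm (w t) \<le> c * norm z)"
    using correction_exists_bounded[OF T D R] by blast
  show ?thesis
    unfolding feas obj
  proof (intro conjI impI)
    show "\<exists>x u. admissible T A B C D f x0 x u \<and> x T \<in> Z"
      using adm1(1) x1Z by blast
    assume "bdd_below (range (\<lambda>z. \<integral>\<omega>. F z (\<xi> \<omega>) \<partial>P))"
    then have bdd: "bdd_below (range \<Psi>)" unfolding \<Psi>_def .
    show "\<exists>x u. (admissible T A B C D f x0 x u \<and> x T \<in> Z) \<and>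
      (\<forall>y w. admissible T A B C D f x0 y w \<and> y T \<in> Z \<longrightarrow>
        \<Psi> (x T) + energy T \<delta> (\<lambda>t. x t - xd t) (\<lambda>t. u t - ud t)
          \<le> \<Psi> (y T) + energy T \<delta> (\<lambda>t. y t - xd t) (\<lambda>t. w t - ud t))"
      using optimal_control_exists[OF T \<delta> xd ud Zc \<Psi>c bdd c adm1(1) x1Z] by blast
  qed
qed

end
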